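(* Let $X$ be a Banach space and let $\Gamma:[0,1]\to cwk(X)$ be a multifunction. Then the following conditions are equivalent: (i) $\Gamma$ is McShane integrable; (ii) $\Gamma$ is Henstock integrable and $\mathcal{S}_H(\Gamma)\subset\mathcal{S}_{MS}(\Gamma)$; (iii) $\Gamma$ is Henstock integrable and $\mathcal{S}_H(\Gamma)\subset\mathcal{S}_P(\Gamma)$; (iv) $\Gamma$ is Henstock integrable and $\mathcal{S}_P(\Gamma)\neq\emptyset$; (v) $\Gamma$ is Henstock and Pettis integrable.
   Context: $X$ is an arbitrary (not necessarily separable) real Banach space with dual $X^*$, and $cwk(X)$ is the family of all non-empty convex weakly compact subsets of $X$, with Minkowski addition, multiplication by positive scalars, and the Hausdorff distance $d_H$. The support function is $s(x^*,C)=\sup\{\langle x^*,x\rangle:x\in C\}$. A multifunction is a map $\Gamma:[0,1]\to cwk(X)$; a selection of $\Gamma$ is a function $f:[0,1]\to X$ with $f(t)\in\Gamma(t)$ for every $t\in[0,1]$. $\mathcal{L}$ is the family of Lebesgue measurable subsets of $[0,1]$. A gauge is any strictly positive function $\delta$ on $[0,1]$. A partition of $[0,1]$ is a finite collection $\{(I_1,t_1),\dots,(I_p,t_p)\}$ of nonoverlapping closed subintervals $I_i$ with union $[0,1]$ and points $t_i\in[0,1]$; it is a Perron partition if $t_i\in I_i$ for all $i$; it is $\delta$-fine if $I_i\subset(t_i-\delta(t_i),t_i+\delta(t_i))$ for all $i$. $\Gamma$ is Henstock (resp. McShane) integrable on $[0,1]$ if there is $\Phi_\Gamma([0,1])\in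 cwk(X)$ such that for every $\varepsilon>0$ there is a gauge $\delta$ with $d_H\big(\Phi_\Gamma([0,1]),\sum_{i=1}^p\Gamma(t_i)|I_i|\big)<\varepsilon$ for every $\delta$-fine Perron partition (resp. every $\delta$-fine partition) of $[0,1]$. $\Gamma$ is Pettis integrable if for every $x^*\in X^*$ the function $s(x^*,\Gamma(\cdot))$ is Lebesgue integrable and for each $A\in\mathcal{L}$ there is $W_A\in cwk(X)$ with $s(x^*,W_A)=\int_A s(x^*,\Gamma)\,d\lambda$ for every $x^*\in X^*$. For functions $f:[0,1]\to X$ these notions are applied to $t\mapsto\{f(t)\}$ (with integral in $X$ and norm distance). $\mathcal{S}_H(\Gamma)$, $\mathcal{S}_{MS}(\Gamma)$, $\mathcal{S}_P(\Gamma)$ are the sets of selections of $\Gamma$ that are, respectively, Henstock, McShane, Pettis integrable. *)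

theory Defs
  imports "HOL-Analysis.Analysis" "HOL-Library.Set_Algebras"
begin

definition weak_topology :: "'a::real_normed_vector topology" where
  "weak_topology =
    topology_generated_by {blinfun_apply x' -` U | (x' :: 'a \<Rightarrow>\<^sub>L real) U. open U}"

definition cwk :: "'a::real_normed_vector set set" where
  "cwk = {C. C \<noteq> {} \<and> convex C \<and> compactin weak_topology C}"

(* For both functions below, the suprema are over nonempty bounded sets of reals whenever the
   set arguments lie in cwk, because weakly compact sets are norm bounded. *)

definition support_fun :: "('a::real_normed_vector \<Rightarrow>\<^sub>L real) \<Rightarrow> 'a set \<Rightarrow> real" where
  "support_fun x' C = (SUP x\<in>C. blinfun_apply x' x)"

definition hausdorff_distance :: "'a::metric_space set \<Rightarrow> 'a set \<Rightarrow> real" where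
  "hausdorff_distance A B = max (SUP a\<in>A. infdist a B) (SUP b\<in>B. infdist b A)"

(* A partition is a set of pairs (tag, interval), in the order used by the library's
   tagged_division_of. Tags need not lie in their intervals; Perron partitions are the
   library's tagged divisions, see the lemma below. *)

definition free_partition :: "(real \<times> real set) set \<Rightarrow> bool" where
  "free_partition p \<longleftrightarrow>
    finite p \<and>
    (\<forall>(t, I)\<in>p. t \<in> {0..1} \<and> (\<exists>a b. a \<le> b \<and> I = {a..b})) \<and>
    (\<forall>(t, I)\<in>p. \<forall>(u, J)\<in>p. (t, I) \<noteq> (u, J) \<longrightarrow> interior I \<inter> interior J = {}) \<and>
    (\<Union>(t, I)\<in>p. I) = {0..1}"

lemma tagged_division_of_unit_iff:
  "p tagged_division_of {0..1} \<longleftrightarrow> free_partition p \<and> (\<forall>(t, I)\<in>p. t \<in> I)"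
proof
  assume p: "p tagged_division_of {0..1}"
  have tag: "t \<in> I" "I \<subseteq> {0..1}" "\<exists>a b. I = cbox a b" if "(t, I) \<in> p" for t I
    using tagged_division_ofD(2-4)[OF p that] by auto
  have "\<exists>a b. a \<le> b \<and> I = {a..b}" if "(t, I) \<in> p" for t I
    using tag[OF that] by fastforce
  moreover have "t \<in> {0..1}" if "(t, I) \<in> p" for t I
    using tag[OF that] by blast
  moreover have "(\<Union>(t, I)\<in>p. I) = {0..1}"
    using tagged_division_ofD(6)[OF p] by auto
  moreover have "interior I \<inter> interior J = {}"
    if "(t, I) \<in> p" "(u, J) \<in> p" "(t, I) \<noteq> (u, J)" for t I u J
    using tagged_division_ofD(5)[OF p that] .
  moreover have "finite p" using tagged_division_ofD(1)[OF p] .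
  ultimately have "free_partition p" unfolding free_partition_def by blast
  then show "free_partition p \<and> (\<forall>(t, I)\<in>p. t \<in> I)" using tag(1) by blast
next
  assume "free_partition p \<and> (\<forall>(t, I)\<in>p. t \<in> I)"
  then have p: "free_partition p" and tag: "\<And>t I. (t, I) \<in> p \<Longrightarrow> t \<in> I" by auto
  have U: "(\<Union>(t, I)\<in>p. I) = {0..1}" using p by (simp add: free_partition_def)
  show "p tagged_division_of {0..1}"
  proof (rule tagged_division_ofI)
    show "finite p" using p by (simp add: free_partition_def)
    show "\<Union>{K. \<exists>x. (x, K) \<in> p} = {0..1}" using U by blast
    fix x K assume K: "(x, K) \<in> p"
    show "x \<in> K" using tag K by blast
    show "K \<subseteq> {0..1}" using U K by blast
    show "\<exists>a b. K = cbox a b" using p K by (force simp: free_partition_def)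
    fix y L assume "(y, L) \<in> p" "(x, K) \<noteq> (y, L)"
    then show "interior K \<inter> interior L = {}"
      using p K unfolding free_partition_def by blast
  qed
qed

definition unit_gauge :: "(real \<Rightarrow> real) \<Rightarrow> bool" where
  "unit_gauge \<delta> \<longleftrightarrow> (\<forall>t\<in>{0..1}. 0 < \<delta> t)"

definition delta_fine :: "(real \<Rightarrow> real) \<Rightarrow> (real \<times> real set) set \<Rightarrow> bool" where
  "delta_fine \<delta> p \<longleftrightarrow> (\<lambda>t. {t - \<delta> t <..< t + \<delta> t}) fine p"

(* The sum is the Minkowski sum from Set_Algebras. *)

definition mf_riemann_sum ::
    "(real \<Rightarrow> 'a::real_normed_vector set) \<Rightarrow> (real \<times> real set) set \<Rightarrow> 'a set" where
  "mf_riemann_sum \<Gamma> p = (\<Sum>(t, I)\<in>p. (\<lambda>x. measure lborel I *\<^sub>R x) ` \<Gamma> t)"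

definition mf_henstock_integrable :: "(real \<Rightarrow> 'a::real_normed_vector set) \<Rightarrow> bool" where
  "mf_henstock_integrable \<Gamma> \<longleftrightarrow>
    (\<exists>\<Phi>\<in>cwk. \<forall>\<epsilon>>0. \<exists>\<delta>. unit_gauge \<delta> \<and>
      (\<forall>p. p tagged_division_of {0..1} \<and> delta_fine \<delta> p \<longrightarrow>
        hausdorff_distance \<Phi> (mf_riemann_sum \<Gamma> p) < \<epsilon>))"

definition mf_mcshane_integrable :: "(real \<Rightarrow> 'a::real_normed_vector set) \<Rightarrow> bool" where
  "mf_mcshane_integrable \<Gamma> \<longleftrightarrow>
    (\<exists>\<Phi>\<in>cwk. \<forall>\<epsilon>>0. \<exists>\<delta>. unit_gauge \<delta> \<and>
      (\<forall>p. free_partition p \<and> delta_fine \<delta> p \<longrightarrow>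
        hausdorff_distance \<Phi> (mf_riemann_sum \<Gamma> p) < \<epsilon>))"

definition mf_pettis_integrable :: "(real \<Rightarrow> 'a::real_normed_vector set) \<Rightarrow> bool" where
  "mf_pettis_integrable \<Gamma> \<longleftrightarrow>
    (\<forall>x'. set_integrable lebesgue {0..1} (\<lambda>t. support_fun x' (\<Gamma> t))) \<and>
    (\<forall>A\<in>sets lebesgue. A \<subseteq> {0..1} \<longrightarrow>
      (\<exists>W\<in>cwk. \<forall>x'. support_fun x' W =
        set_lebesgue_integral lebesgue A (\<lambda>t. support_fun x' (\<Gamma> t))))"

(* Vector-valued functions: the notions above for \<lambda>t. {f t}, with the integral a point of the
   space. The lemmas below identify sums, distance and support function of singletons. *)

definition henstock_integrable :: "(real \<Rightarrow> 'a::real_normed_vector) \<Rightarrow> bool" where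
  "henstock_integrable f \<longleftrightarrow>
    (\<exists>w. \<forall>\<epsilon>>0. \<exists>\<delta>. unit_gauge \<delta> \<and>
      (\<forall>p. p tagged_division_of {0..1} \<and> delta_fine \<delta> p \<longrightarrow>
        norm (w - (\<Sum>(t, I)\<in>p. measure lborel I *\<^sub>R f t)) < \<epsilon>))"

definition mcshane_integrable :: "(real \<Rightarrow> 'a::real_normed_vector) \<Rightarrow> bool" where
  "mcshane_integrable f \<longleftrightarrow>
    (\<exists>w. \<forall>\<epsilon>>0. \<exists>\<delta>. unit_gauge \<delta> \<and>
      (\<forall>p. free_partition p \<and> delta_fine \<delta> p \<longrightarrow>
        norm (w - (\<Sum>(t, I)\<in>p. measure lborel I *\<^sub>R f t)) < \<epsilon>))"

definition pettis_integrable :: "(real \<Rightarrow> 'a::real_normed_vector) \<Rightarrow> bool" where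
  "pettis_integrable f \<longleftrightarrow>
    (\<forall>x' :: 'a \<Rightarrow>\<^sub>L real. set_integrable lebesgue {0..1} (\<lambda>t. blinfun_apply x' (f t))) \<and>
    (\<forall>A\<in>sets lebesgue. A \<subseteq> {0..1} \<longrightarrow>
      (\<exists>w. \<forall>x' :: 'a \<Rightarrow>\<^sub>L real. blinfun_apply x' w =
        set_lebesgue_integral lebesgue A (\<lambda>t. blinfun_apply x' (f t))))"

lemma hausdorff_distance_singleton:
  "hausdorff_distance {x} {y} = norm (x - y)" for x y :: "'a::real_normed_vector"
  by (simp add: hausdorff_distance_def dist_norm norm_minus_commute)

lemma support_fun_singleton: "support_fun x' {x} = blinfun_apply x' x"
  by (simp add: support_fun_def)

lemma mf_riemann_sum_singleton:
  "mf_riemann_sum (\<lambda>t. {f t}) p = {\<Sum>(t, I)\<in>p. measure lborel I *\<^sub>R f t}"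
proof (cases "finite p")
  case True
  then show ?thesis
    unfolding mf_riemann_sum_def
    by (induction p rule: finite_induct) (auto simp: set_plus_def)
next
  case False
  then show ?thesis by (simp add: mf_riemann_sum_def)
qed

lemma henstock_integrable_iff_integrable_on:
  "henstock_integrable f \<longleftrightarrow> f integrable_on {0..1}"
proof -
  have *: "(\<exists>\<delta>. unit_gauge \<delta> \<and> (\<forall>p. p tagged_division_of {0..1} \<and> delta_fine \<delta> p \<longrightarrow> P p)) \<longleftrightarrow>
      (\<exists>\<gamma>. gauge \<gamma> \<and> (\<forall>p. p tagged_division_of {0..1} \<and> \<gamma> fine p \<longrightarrow> P p))" for P
  proof (intro iffI; elim exE conjE)
    fix \<delta> assume \<delta>: "unit_gauge \<delta>"
      and P: "\<forall>p. p tagged_division_of {0..1} \<and> delta_fine \<delta> p \<longrightarrow> P p"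
    define \<gamma> where "\<gamma> = (\<lambda>t. if t \<in> {0..1} then {t - \<delta> t <..< t + \<delta> t} else UNIV)"
    have "gauge \<gamma>" using \<delta> by (auto simp: gauge_def \<gamma>_def unit_gauge_def)
    moreover have "P p" if p: "p tagged_division_of {0..1}" "\<gamma> fine p" for p
    proof -
      have "I \<subseteq> {t - \<delta> t <..< t + \<delta> t}" if "(t, I) \<in> p" for t I
        using fineD[OF p(2) that] tagged_division_ofD(2,3)[OF p(1) that]
        by (auto simp: \<gamma>_def split: if_splits)
      then have "delta_fine \<delta> p" unfolding delta_fine_def by (rule fineI)
      then show ?thesis using P p(1) by blast
    qed
    ultimately show "\<exists>\<gamma>. gauge \<gamma> \<and> (\<forall>p. p tagged_division_of {0..1} \<and> \<gamma> fine p \<longrightarrow> P p)"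
      by (intro exI[of _ \<gamma>]) simp
  next
    fix \<gamma> :: "real \<Rightarrow> real set" assume \<gamma>: "gauge \<gamma>"
      and P: "\<forall>p. p tagged_division_of {0..1} \<and> \<gamma> fine p \<longrightarrow> P p"
    have "\<exists>d. 0 < d \<and> ball t d \<subseteq> \<gamma> t" for t
      using openE[of "\<gamma> t" t] \<gamma> unfolding gauge_def by metis
    then have "\<exists>\<delta>. \<forall>t. 0 < \<delta> t \<and> ball t (\<delta> t) \<subseteq> \<gamma> t"
      by (intro choice allI)
    then obtain \<delta> where \<delta>: "\<And>t. 0 < \<delta> t" "\<And>t. ball t (\<delta> t) \<subseteq> \<gamma> t"
      by blast
    then have "unit_gauge \<delta>" by (simp add: unit_gauge_def)
    moreover have "\<gamma> fine p" if "delta_fine \<delta> p" for p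
    proof (rule fineI)
      fix t I assume "(t, I) \<in> p"
      then have "I \<subseteq> ball t (\<delta> t)"
        using that unfolding delta_fine_def ball_eq_greaterThanLessThan by (rule fineD[rotated])
      then show "I \<subseteq> \<gamma> t" using \<delta>(2) by (rule subset_trans)
    qed
    ultimately show "\<exists>\<delta>. unit_gauge \<delta> \<and>
        (\<forall>p. p tagged_division_of {0..1} \<and> delta_fine \<delta> p \<longrightarrow> P p)"
      using P by (intro exI[of _ \<delta>]) simp
  qed
  show ?thesis
    unfolding henstock_integrable_def integrable_on_def *
      has_integral[of f _ 0 1, unfolded cbox_interval]
    by (subst norm_minus_commute) (rule refl)
qed

definition selections :: "(real \<Rightarrow> 'a set) \<Rightarrow> (real \<Rightarrow> 'a) set" where
  "selections \<Gamma> = {f. \<forall>t\<in>{0..1}. f t \<in> \<Gamma> t}"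

definition henstock_selections ::
    "(real \<Rightarrow> 'a::real_normed_vector set) \<Rightarrow> (real \<Rightarrow> 'a) set" where
  "henstock_selections \<Gamma> = {f \<in> selections \<Gamma>. henstock_integrable f}"

definition mcshane_selections ::
    "(real \<Rightarrow> 'a::real_normed_vector set) \<Rightarrow> (real \<Rightarrow> 'a) set" where
  "mcshane_selections \<Gamma> = {f \<in> selections \<Gamma>. mcshane_integrable f}"

definition pettis_selections ::
    "(real \<Rightarrow> 'a::real_normed_vector set) \<Rightarrow> (real \<Rightarrow> 'a) set" where
  "pettis_selections \<Gamma> = {f \<in> selections \<Gamma>. pettis_integrable f}"

end

theory Submission
  imports Defs
begin

text \<open>
  Passing to support functions turns every notion into one about the family of real functions
  \<open>s(x', \<Gamma>(\<cdot>))\<close>, \<open>x'\<close> in the dual unit ball, with gauges uniform in \<open>x'\<close>. The central fact is that a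
  pointwise bounded equi-Henstock integrable family is equi-McShane integrable as soon as its
  indefinite integrals are equi-absolutely continuous. Equi-absolute continuity comes from McShane
  integrability, is inherited by the selections of \<open>\<Gamma>\<close> (apply the bound for the support functions to
  \<open>x'\<close> and \<open>-x'\<close>), and comes from Pettis integrability by an Orlicz--Pettis argument.

  Henstock integrability of \<open>\<Gamma>\<close> gives a Henstock integrable selection: let \<open>v\<close> strongly expose a point
  of the integral and choose in each \<open>\<Gamma>(t)\<close> a point where \<open>v\<close> is maximal; the Riemann sums almost
  maximise \<open>v\<close> and are therefore close to the exposed point. Finally, if \<open>f\<close> is a Pettis integrable
  selection, then \<open>p(x') = \<integral>\<^sub>A s(x', \<Gamma>)\<close> is sublinear and dominated by the support function of a translate
  of the Henstock integral of \<open>\<Gamma>\<close>, because \<open>s(x', \<Gamma>) - x' f \<ge> 0\<close>; hence \<open>p\<close> is itself the support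
  function of a weakly compact convex set.
\<close>

section \<open>Sublinear functionals and separation\<close>

text \<open>The dual ball has in general no countable norming subset, and a gauge is an arbitrary
  positive function, so suprema over functionals and level sets of gauges need not be measurable.
  Hence the passage from Henstock to McShane sums uses outer measure, finite combinatorics of dyadic
  cells, and exceptional subfamilies chosen independently of the functional. The obstacle there is
  that Saks-Henstock estimates for Perron partitions need tags inside their intervals, while cells
  around the tags that are large enough to contain the intervals overlap each other. Weak
  compactness serves to stay inside the space: a linear functional on the dual lying below the
  support function of a weakly compact convex set is evaluation at one of its points. This yields
  both the sets representing Pettis integrals and the sums of subseries in the Orlicz-Pettis
  argument. For the Henstock selection a mere support point would control the Riemann sums only in
  the direction \<open>v\<close>; strong exposure converts near maximality in that direction into
  closeness in norm.\<close>

definition sublinear :: "('a::real_vector \<Rightarrow> real) \<Rightarrow> bool" where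
  "sublinear p \<longleftrightarrow> (\<forall>x y. p (x + y) \<le> p x + p y) \<and> (\<forall>c\<ge>0. \<forall>x. p (c *\<^sub>R x) = c * p x)"

lemma sublinear_add: "sublinear p \<Longrightarrow> p (x + y) \<le> p x + p y"
  and sublinear_scale: "sublinear p \<Longrightarrow> 0 \<le> c \<Longrightarrow> p (c *\<^sub>R x) = c * p x"
  by (auto simp: sublinear_def)

lemma sublinear_zero: "sublinear p \<Longrightarrow> p 0 = 0"
  using sublinear_scale[of p 0 0] by simp

lemma sublinear_ge: "sublinear p \<Longrightarrow> - p (- x) \<le> p x"
  using sublinear_add[of p x "- x"] sublinear_zero[of p] by simp

text \<open>Applying the scaling inequality to \<open>1 / c\<close> gives the reverse one, and the
  factors \<open>2\<close> and \<open>1/2\<close> together force \<open>p 0 = 0\<close>.\<close>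

lemma sublinearI:
  assumes add: "\<And>x y. p (x + y) \<le> p x + p y"
    and scale: "\<And>c x. 0 < c \<Longrightarrow> p (c *\<^sub>R x) \<le> c * p x"
  shows "sublinear p"
  unfolding sublinear_def
proof (intro conjI allI impI)
  have "p 0 \<le> 2 * p 0" using scale[of 2 0] by (simp only: scaleR_zero_right zero_less_numeral)
  moreover have "p 0 \<le> (1/2) * p 0"
    using scale[of "1/2" 0] by (simp only: scaleR_zero_right half_gt_zero_iff zero_less_one)
  ultimately have p0: "p 0 = 0" by linarith
  fix c :: real and x assume "0 \<le> c"
  show "p (c *\<^sub>R x) = c * p x"
  proof (cases "c = 0")
    case False
    with \<open>0 \<le> c\<close> have c: "0 < c" by simp
    have "p ((1 / c) *\<^sub>R (c *\<^sub>R x)) \<le> (1 / c) * p (c *\<^sub>R x)" using c by (intro scale) simp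
    then have "c * p x \<le> p (c *\<^sub>R x)" using c by (simp add: pos_le_divide_eq mult.commute)
    then show ?thesis using scale[OF c, of x] by linarith
  qed (simp add: p0)
qed (rule add)

section \<open>Minimal sublinear functionals and the Hahn-Banach theorem\<close>

text \<open>For a chain, \<open>k\<close> is the smaller of two members. In
  \<open>sublinear_tilt\<close> and \<open>separation_infdist\<close> the members are in general not
  sublinear themselves, and \<open>k\<close> arises by adding or scaling their parameters. The
  common bound \<open>b\<close> keeps the infima finite.\<close>

lemma sublinear_INF:
  fixes \<phi> :: "'i \<Rightarrow> 'a::real_vector \<Rightarrow> real"
  assumes ne: "I \<noteq> {}"
    and lb: "\<And>i x. i \<in> I \<Longrightarrow> b x \<le> \<phi> i x"
    and add: "\<And>i j x y. i \<in> I \<Longrightarrow> j \<in> I \<Longrightarrow> \<exists>k\<in>I. \<phi> k (x + y) \<le> \<phi> i x + \<phi> j y"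
    and scale: "\<And>i c x. i \<in> I \<Longrightarrow> 0 < c \<Longrightarrow> \<exists>k\<in>I. \<phi> k (c *\<^sub>R x) \<le> c * \<phi> i x"
  shows "sublinear (\<lambda>x. INF i\<in>I. \<phi> i x)"
proof (rule sublinearI)
  let ?q = "\<lambda>x. INF i\<in>I. \<phi> i x"
  have bdd: "bdd_below ((\<lambda>i. \<phi> i x) ` I)" for x using lb by (auto intro!: bdd_belowI2)
  have le: "?q x \<le> \<phi> i x" if "i \<in> I" for i x by (rule cINF_lower[OF bdd that])
  fix x y
  have "?q (x + y) - \<phi> i x \<le> ?q y" if i: "i \<in> I" for i
  proof (rule cINF_greatest[OF ne])
    fix j assume j: "j \<in> I"
    obtain k where k: "k \<in> I" "\<phi> k (x + y) \<le> \<phi> i x + \<phi> j y" using add[OF i j] by blast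
    show "?q (x + y) - \<phi> i x \<le> \<phi> j y" using le[OF k(1), of "x + y"] k(2) by linarith
  qed
  then have "?q (x + y) - ?q y \<le> \<phi> i x" if i: "i \<in> I" for i using i by fastforce
  then have "?q (x + y) - ?q y \<le> ?q x" by (rule cINF_greatest[OF ne])
  then show "?q (x + y) \<le> ?q x + ?q y" by simp
next
  let ?q = "\<lambda>x. INF i\<in>I. \<phi> i x"
  fix c :: real and x assume c: "0 < c"
  have "?q (c *\<^sub>R x) / c \<le> \<phi> i x" if i: "i \<in> I" for i
  proof -
    obtain k where k: "k \<in> I" "\<phi> k (c *\<^sub>R x) \<le> c * \<phi> i x" using scale[OF i c] by blast
    have "?q (c *\<^sub>R x) \<le> \<phi> k (c *\<^sub>R x)"
      using lb by (intro cINF_lower[OF _ k(1)]) (auto intro!: bdd_belowI2)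
    with k(2) c show ?thesis by (simp add: field_simps)
  qed
  then have "?q (c *\<^sub>R x) / c \<le> ?q x" by (intro cINF_greatest[OF ne])
  then show "?q (c *\<^sub>R x) \<le> c * ?q x" using c by (simp add: field_simps)
qed

text \<open>Zorn's lemma for the reversed pointwise order. The infimum of a chain is finite because
  every sublinear \<open>q \<le> p\<close> satisfies \<open>- p (- x) \<le> q x\<close>.\<close>

lemma sublinear_minimal_below:
  assumes p: "sublinear p"
  obtains m where "sublinear m" "m \<le> p" "\<And>q. sublinear q \<Longrightarrow> q \<le> m \<Longrightarrow> q = m"
proof -
  let ?A = "{q. sublinear q \<and> q \<le> p}"
  have "\<exists>m\<in>?A. \<forall>a\<in>?A. a \<le> m \<longrightarrow> a = m"
  proof (rule predicate_Zorn)
    show "partial_order_on ?A (relation_of (\<lambda>a b. b \<le> a) ?A)"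
      by (intro partial_order_on_relation_ofI) auto
    fix C assume C: "C \<in> Chains (relation_of (\<lambda>a b. b \<le> a) ?A)"
    show "\<exists>u\<in>?A. \<forall>a\<in>C. u \<le> a"
    proof (cases "C = {}")
      case False
      have CA: "sublinear q" "q \<le> p" if "q \<in> C" for q
        using C that unfolding Chains_def relation_of_def by auto
      have total: "q \<le> q' \<or> q' \<le> q" if "q \<in> C" "q' \<in> C" for q q'
        using C that unfolding Chains_def relation_of_def by auto
      have lb: "- p (- x) \<le> q x" if "q \<in> C" for q x
        using sublinear_ge[OF CA(1)[OF that], of x] CA(2)[OF that] by (smt (verit) le_fun_def)
      define u where "u = (\<lambda>x. INF q\<in>C. q x)"
      have "sublinear u" unfolding u_def
      proof (rule sublinear_INF[OF False lb])
        fix i j x y assume "i \<in> C" "j \<in> C"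
        show "\<exists>k\<in>C. k (x + y) \<le> i x + j y"
          using total[OF \<open>i \<in> C\<close> \<open>j \<in> C\<close>]
        proof
          assume "i \<le> j"
          then show ?thesis
            using sublinear_add[OF CA(1)[OF \<open>i \<in> C\<close>], of x y] \<open>i \<in> C\<close>
            by (intro bexI[of _ i]) (auto simp: le_fun_def intro: order_trans)
        next
          assume "j \<le> i"
          then show ?thesis
            using sublinear_add[OF CA(1)[OF \<open>j \<in> C\<close>], of x y] \<open>j \<in> C\<close>
            by (intro bexI[of _ j]) (auto simp: le_fun_def intro: order_trans)
        qed
      next
        fix i c x assume "i \<in> C" "0 < (c::real)"
        then show "\<exists>k\<in>C. k (c *\<^sub>R x) \<le> c * i x"
          using sublinear_scale[OF CA(1), of i c x] by (intro bexI[of _ i]) auto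
      qed
      moreover have uq: "u \<le> q" if "q \<in> C" for q
        unfolding u_def le_fun_def using lb that by (auto intro!: cINF_lower bdd_belowI2)
      moreover have "u \<le> p" using False uq CA(2) by (meson all_not_in_conv order_trans)
      ultimately show ?thesis by (intro bexI[of _ u]) auto
    qed (use p in auto)
  qed
  then obtain m where m: "sublinear m" "m \<le> p"
      "\<And>q. sublinear q \<Longrightarrow> q \<le> p \<Longrightarrow> q \<le> m \<Longrightarrow> q = m"
    by blast
  then show ?thesis using that order_trans[OF _ m(2)] by blast
qed

text \<open>An infimal convolution that imposes a value of at most \<open>- m v\<close> at
  \<open>- v\<close>. A minimal \<open>m\<close> equals its own tilt, and the third claim then makes
  \<open>m\<close> superadditive in the direction \<open>v\<close>; the fourth prescribes the value
  at \<open>x0\<close> in the Hahn-Banach theorem.\<close>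

lemma sublinear_tilt:
  fixes m :: "'a::real_vector \<Rightarrow> real" and v :: 'a
  assumes m: "sublinear m"
  defines "q \<equiv> (\<lambda>x. INF t\<in>{0..}. m (x + t *\<^sub>R v) - t * m v)"
  shows "sublinear q" "q \<le> m" "q (x + v) \<ge> q x + m v" "q (- v) \<le> - m v"
proof -
  have lb: "- m (- x) \<le> m (x + t *\<^sub>R v) - t * m v" if "t \<in> {0..}" for t x
    using sublinear_add[OF m, of "x + t *\<^sub>R v" "- x"] sublinear_scale[OF m, of t v] that by simp
  show "sublinear q" unfolding q_def
  proof (rule sublinear_INF[OF _ lb])
    fix s t :: real and x y :: 'a assume st: "s \<in> {0..}" "t \<in> {0..}"
    show "\<exists>k\<in>{0..}. m (x + y + k *\<^sub>R v) - k * m v \<le>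
        m (x + s *\<^sub>R v) - s * m v + (m (y + t *\<^sub>R v) - t * m v)"
      using sublinear_add[OF m, of "x + s *\<^sub>R v" "y + t *\<^sub>R v"] st
      by (intro bexI[of _ "s + t"]) (auto simp: algebra_simps)
  next
    fix t c :: real and x :: 'a assume "t \<in> {0..}" "0 < c"
    then show "\<exists>k\<in>{0..}. m (c *\<^sub>R x + k *\<^sub>R v) - k * m v \<le> c * (m (x + t *\<^sub>R v) - t * m v)"
      using sublinear_scale[OF m, of c "x + t *\<^sub>R v"]
      by (intro bexI[of _ "c * t"]) (auto simp: algebra_simps)
  qed auto
  have le: "q x \<le> m (x + t *\<^sub>R v) - t * m v" if "0 \<le> t" for t x
    unfolding q_def using lb that by (intro cINF_lower) (auto intro!: bdd_belowI2)
  show "q \<le> m" using le[of 0] by (simp add: le_fun_def)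
  show "q (- v) \<le> - m v" using le[of 1 "- v"] sublinear_zero[OF m] by simp
  have "q x + m v \<le> m (x + v + t *\<^sub>R v) - t * m v" if "t \<in> {0..}" for t
    using le[of "t + 1" x] that by (simp add: algebra_simps)
  then have "q x + m v \<le> (INF t\<in>{0..}. m (x + v + t *\<^sub>R v) - t * m v)"
    by (intro cINF_greatest) auto
  then show "q (x + v) \<ge> q x + m v" unfolding q_def .
qed

lemma hahn_banach_sublinear:
  assumes p: "sublinear (p :: 'a::real_vector \<Rightarrow> real)"
  obtains f where "linear f" "\<And>x. f x \<le> p x" "f x0 = p x0"
proof -
  \<comment> \<open>Tilting before minimising pins the value: a linear functional below
    \<open>q\<close> is at most \<open>- p x0\<close> at \<open>- x0\<close>, hence at least
    \<open>p x0\<close> at \<open>x0\<close>.\<close>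
  define q where "q = (\<lambda>x. INF t\<in>{0..}. p (x + t *\<^sub>R x0) - t * p x0)"
  have q: "sublinear q" "q \<le> p" "q (- x0) \<le> - p x0"
    unfolding q_def using sublinear_tilt[OF p] by blast+
  obtain m where m: "sublinear m" "m \<le> q" "\<And>q. sublinear q \<Longrightarrow> q \<le> m \<Longrightarrow> q = m"
    using sublinear_minimal_below[OF q(1)] by metis
  have add: "m (x + v) = m x + m v" for x v
  proof -
    let ?q = "\<lambda>x. INF t\<in>{0..}. m (x + t *\<^sub>R v) - t * m v"
    \<comment> \<open>Minimality absorbs the tilt, and this supplies the missing
      superadditivity.\<close>
    have "?q = m" using m(3) sublinear_tilt(1,2)[OF m(1), of v] by blast
    then have "?q y = m y" for y by (rule fun_cong)
    then have "m x + m v \<le> m (x + v)" using sublinear_tilt(3)[OF m(1), where x = x and v = v] by simp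
    with sublinear_add[OF m(1), of x v] show ?thesis by simp
  qed
  have neg: "m (- x) = - m x" for x
    using add[of x "- x"] sublinear_zero[OF m(1)] by simp
  have scale: "m (c *\<^sub>R x) = c * m x" for c x
  proof (cases "0 \<le> c")
    case False
    then have "m ((- c) *\<^sub>R x) = (- c) * m x" by (intro sublinear_scale[OF m(1)]) auto
    then show ?thesis using neg[of "c *\<^sub>R x"] by simp
  qed (rule sublinear_scale[OF m(1)])
  have mp: "m x \<le> p x" for x using m(2) q(2) by (meson le_funD order_trans)
  have "m (- x0) \<le> - p x0" using m(2) q(3) by (meson le_funD order_trans)
  then have "m x0 = p x0" using neg[of x0] mp[of x0] by simp
  moreover have "linear m" using add scale by (intro linearI) auto
  ultimately show ?thesis using that mp by blast
qed

section \<open>Separation of a point from a convex set, with the distance as gap\<close>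

text \<open>Hahn-Banach for the infimum of \<open>norm (x + s *\<^sub>R (w - c)) - s * d\<close>
  over \<open>s \<ge> 0\<close> and \<open>c\<close> in \<open>C\<close>, where \<open>d\<close> is
  the distance. The choice \<open>s = 0\<close> bounds the functional by the norm, and
  \<open>s = 1\<close> with \<open>x = c - w\<close> yields the gap. A gap equal to the distance
  under a norm bound 1 is what later relates the Hausdorff distance to support functions.\<close>

lemma separation_infdist:
  fixes C :: "'a::real_normed_vector set"
  assumes "convex C" "C \<noteq> {}"
  obtains f :: "'a \<Rightarrow>\<^sub>L real" where "norm f \<le> 1" "\<And>c. c \<in> C \<Longrightarrow> blinfun_apply f c + infdist w C \<le> blinfun_apply f w"
proof -
  define d where "d = infdist w C"
  have d: "0 \<le> d" "d \<le> norm (w - c)" if "c \<in> C" for c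
    using infdist_le[OF that, of w] by (auto simp: d_def infdist_nonneg dist_norm)
  define \<phi> where "\<phi> = (\<lambda>(s, c) x. norm (x + s *\<^sub>R (w - c)) - s * d)"
  let ?I = "{0::real..} \<times> C"
  let ?p = "\<lambda>x. INF i\<in>?I. \<phi> i x"
  have lb: "- norm x \<le> \<phi> i x" if i: "i \<in> ?I" for i x
  proof -
    obtain s c where ic: "i = (s, c)" "0 \<le> s" "c \<in> C" using i by auto
    have "s * d \<le> norm (s *\<^sub>R (w - c))" using d[OF ic(3)] ic(2) by (simp add: mult_left_mono)
    also have "\<dots> \<le> norm (x + s *\<^sub>R (w - c)) + norm x" 
      using norm_triangle_ineq4[of "x + s *\<^sub>R (w - c)" x] by simp
    finally show ?thesis using ic by (simp add: \<phi>_def)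
  qed
  have bdd: "bdd_below ((\<lambda>i. \<phi> i x) ` ?I)" for x using lb by (auto intro!: bdd_belowI2)
  have sub: "sublinear ?p"
  proof (rule sublinear_INF[OF _ lb])
    obtain c where "c \<in> C" using assms(2) by blast
    then have "(0::real, c) \<in> ?I" by simp
    then show "?I \<noteq> {}" by (metis empty_iff)
    fix i j x y assume "i \<in> ?I" "j \<in> ?I"
    then obtain s c t e where ij: "i = (s, c)" "0 \<le> s" "c \<in> C" "j = (t, e)" "0 \<le> t" "e \<in> C" by auto
    show "\<exists>k\<in>?I. \<phi> k (x + y) \<le> \<phi> i x + \<phi> j y"
    proof (cases "s + t = 0")
      case True
      then have "s = 0" "t = 0" using ij by auto
      then show ?thesis using ij norm_triangle_ineq[of x y]
        by (intro bexI[of _ "(0, c)"]) (auto simp: \<phi>_def)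
    next
      case False
      then have st: "0 < s + t" using ij by auto
      \<comment> \<open>The base point for the sum is the convex combination of \<open>c\<close> and
        \<open>e\<close> with weights proportional to \<open>s\<close> and \<open>t\<close>; this is
        where convexity of \<open>C\<close> enters.\<close>
      let ?k = "(s + t, (s / (s + t)) *\<^sub>R c + (t / (s + t)) *\<^sub>R e)"
      have "(s / (s + t)) *\<^sub>R c + (t / (s + t)) *\<^sub>R e \<in> C"
        using ij st by (intro convexD[OF assms(1)]) (auto simp: add_divide_distrib[symmetric])
      moreover have "(s + t) *\<^sub>R (w - ((s / (s + t)) *\<^sub>R c + (t / (s + t)) *\<^sub>R e)) = s *\<^sub>R (w - c) + t *\<^sub>R (w - e)"
        using st by (simp add: scaleR_right_diff_distrib scaleR_add_right scaleR_add_left)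
      moreover have "norm (x + y + (s *\<^sub>R (w - c) + t *\<^sub>R (w - e))) - (s + t) * d
          \<le> (norm (x + s *\<^sub>R (w - c)) - s * d) + (norm (y + t *\<^sub>R (w - e)) - t * d)"
        using norm_triangle_ineq[of "x + s *\<^sub>R (w - c)" "y + t *\<^sub>R (w - e)"]
        by (simp add: distrib_right add.assoc add.left_commute)
      ultimately show ?thesis
        using ij st by (intro bexI[of _ ?k]) (simp_all add: \<phi>_def del: divide_eq_1_iff)
    qed
  next
    fix i c x assume "i \<in> ?I" "0 < (c::real)"
    then obtain s e where i: "i = (s, e)" "0 \<le> s" "e \<in> C" by auto
    have "norm (c *\<^sub>R x + (c * s) *\<^sub>R (w - e)) = norm (c *\<^sub>R (x + s *\<^sub>R (w - e)))"
      by (simp add: scaleR_add_right)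
    also have "\<dots> = c * norm (x + s *\<^sub>R (w - e))" using \<open>0 < c\<close> by simp
    finally have "\<phi> (c * s, e) (c *\<^sub>R x) = c * \<phi> i x"
      using i by (simp add: \<phi>_def right_diff_distrib mult.assoc)
    moreover have "(c * s, e) \<in> ?I" using i \<open>0 < c\<close> by simp
    ultimately show "\<exists>k\<in>?I. \<phi> k (c *\<^sub>R x) \<le> c * \<phi> i x" by (metis order_refl)
  qed
  obtain f where f: "linear f" "\<And>x. f x \<le> ?p x" using hahn_banach_sublinear[OF sub] by metis
  have le: "f x \<le> norm (x + s *\<^sub>R (w - c)) - s * d" if "0 \<le> s" "c \<in> C" for x s c
    using f(2)[of x] cINF_lower[OF bdd, of "(s, c)" x] that by (auto simp: \<phi>_def)
  obtain c0 where c0: "c0 \<in> C" using assms by blast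
  have fn: "\<bar>f x\<bar> \<le> norm x" for x
    using le[of 0 c0 x] le[of 0 c0 "- x"] c0 linear_neg[OF f(1), of x] by (auto simp: abs_le_iff)
  then have bl: "bounded_linear f"
    using f(1) by (intro bounded_linear_intro[of f 1]) (auto simp: linear_add linear_scale)
  have "norm (Blinfun f) \<le> 1"
    using fn by (intro norm_blinfun_bound) (auto simp: bounded_linear_Blinfun_apply[OF bl])
  moreover have "f c + d \<le> f w" if "c \<in> C" for c
    using le[of 1 c "- (w - c)"] that linear_neg[OF f(1), of "w - c"] linear_diff[OF f(1), of w c] by simp
  ultimately show ?thesis
    using that[of "Blinfun f"] by (simp add: bounded_linear_Blinfun_apply[OF bl] d_def)
qed

lemma norming_functional:
  fixes x :: "'a::real_normed_vector"
  obtains f :: "'a \<Rightarrow>\<^sub>L real" where "norm f \<le> 1" "blinfun_apply f x = norm x"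
proof -
  obtain f :: "'a \<Rightarrow>\<^sub>L real" where f: "norm f \<le> 1" "blinfun_apply f 0 + infdist x {0} \<le> blinfun_apply f x"
    using separation_infdist[of "{0::'a}" x] by auto
  have "blinfun_apply f x \<le> norm x"
    using norm_blinfun[of f x] f(1) mult_right_mono[OF f(1), of "norm x"] by auto
  with f that show ?thesis by (simp add: blinfun.zero_right)
qed

lemma blinfun_apply_le_norm: "norm f \<le> 1 \<Longrightarrow> \<bar>blinfun_apply f x\<bar> \<le> norm x" for f :: "'a::real_normed_vector \<Rightarrow>\<^sub>L real"
  using norm_blinfun[of f x] mult_right_mono[of "norm f" 1 "norm x"] by auto

section \<open>Weakly compact convex sets\<close>

lemma topspace_weak_topology [simp]: "topspace (weak_topology :: 'a::real_normed_vector topology) = UNIV"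
proof -
  have "UNIV = blinfun_apply (0 :: 'a \<Rightarrow>\<^sub>L real) -` UNIV" by simp
  then have "UNIV \<in> {blinfun_apply x' -` U | (x' :: 'a \<Rightarrow>\<^sub>L real) U. open U}" by blast
  then show ?thesis unfolding weak_topology_def by (auto simp: topology_generated_by_topspace)
qed

lemma continuous_map_weak_blinfun [continuous_intros]:
  fixes f :: "'a::real_normed_vector \<Rightarrow>\<^sub>L real"
  shows "continuous_map weak_topology euclideanreal (blinfun_apply f)"
  unfolding continuous_map_def weak_topology_def[symmetric]
proof (intro conjI allI impI)
  fix U :: "real set" assume "openin euclideanreal U"
  then have "blinfun_apply f -` U \<in> {blinfun_apply x' -` U | (x' :: 'a \<Rightarrow>\<^sub>L real) U. open U}"
    by auto
  then have "openin weak_topology (blinfun_apply f -` U)"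
    unfolding weak_topology_def by (rule topology_generated_by_Basis)
  then show "openin weak_topology {x \<in> topspace weak_topology. blinfun_apply f x \<in> U}"
    by (simp add: vimage_def)
qed auto

lemma continuous_map_weak_translation:
  fixes u :: "'a::real_normed_vector"
  shows "continuous_map weak_topology weak_topology (\<lambda>x. u + x)"
  unfolding weak_topology_def
proof (rule continuous_on_generated_topo; unfold weak_topology_def[symmetric])
  fix U assume "U \<in> {blinfun_apply x' -` U | (x' :: 'a \<Rightarrow>\<^sub>L real) U. open U}"
  then obtain f :: "'a \<Rightarrow>\<^sub>L real" and V where U: "U = blinfun_apply f -` V" "open V" by blast
  have "(\<lambda>x. u + x) -` U = blinfun_apply f -` ((\<lambda>r. blinfun_apply f u + r) -` V)"
    by (auto simp: U blinfun.add_right)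
  moreover have "open ((\<lambda>r. blinfun_apply f u + r) -` V)"
    using U(2) by (intro open_vimage continuous_intros)
  ultimately have "(\<lambda>x. u + x) -` U \<in> {blinfun_apply x' -` U | (x' :: 'a \<Rightarrow>\<^sub>L real) U. open U}"
    by (intro CollectI exI conjI) auto
  then have "openin weak_topology ((\<lambda>x. u + x) -` U)"
    by (subst weak_topology_def) (rule topology_generated_by_Basis)
  then show "openin weak_topology ((\<lambda>x. u + x) -` U \<inter> topspace weak_topology)"
    by (simp only: topspace_weak_topology Int_UNIV_right)
next
  have "\<Union> {blinfun_apply x' -` U | (x' :: 'a \<Rightarrow>\<^sub>L real) U. open U} = UNIV"
    using topspace_weak_topology[where 'a='a] unfolding weak_topology_def topology_generated_by_topspace .
  then show "(\<lambda>x. u + x) ` topspace weak_topology \<subseteq> \<Union> {blinfun_apply x' -` U | (x' :: 'a \<Rightarrow>\<^sub>L real) U. open U}"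
    by simp
qed

lemma closedin_weak_le:
  fixes f :: "'a::real_normed_vector \<Rightarrow>\<^sub>L real"
  shows "closedin weak_topology {x. blinfun_apply f x \<le> a}"
  using closedin_continuous_map_preimage[OF continuous_map_weak_blinfun[of f], of "{..a}"] by simp

lemma closedin_weak_eq:
  fixes f :: "'a::real_normed_vector \<Rightarrow>\<^sub>L real"
  shows "closedin weak_topology {x. blinfun_apply f x = a}"
  using closedin_continuous_map_preimage[OF continuous_map_weak_blinfun[of f], of "{a}"] by simp

lemma cwkD:
  assumes "C \<in> cwk"
  shows "C \<noteq> {}" "convex C" "compactin weak_topology C"
  using assms by (auto simp: cwk_def)

lemma cwk_Int_closedin:
  assumes "C \<in> cwk" "closedin weak_topology S" "convex S" "C \<inter> S \<noteq> {}"
  shows "C \<inter> S \<in> cwk"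
  using assms by (auto simp: cwk_def convex_Int intro: compact_Int_closedin)

lemma cwk_translation:
  assumes "C \<in> cwk"
  shows "(+) u ` C \<in> cwk"
  using cwkD[OF assms] image_compactin[OF _ continuous_map_weak_translation[of u]]
  by (auto simp: cwk_def convex_translation)

lemma compactin_weak_attains_inf:
  assumes "compactin weak_topology C" "C \<noteq> {}" "continuous_map weak_topology euclideanreal f"
  obtains c where "c \<in> C" "\<And>d. d \<in> C \<Longrightarrow> f c \<le> f d"
proof -
  have "compact (f ` C)" using image_compactin[OF assms(1,3)] by simp
  then obtain m where "m \<in> f ` C" "\<forall>t\<in>f ` C. m \<le> t"
    using compact_attains_inf[of "f ` C"] assms(2) by blast
  then show ?thesis using that by auto
qed

lemma cwk_fip:
  assumes C: "C \<in> cwk" and cl: "\<And>S. S \<in> \<S> \<Longrightarrow> closedin weak_topology S"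
    and fin: "\<And>F. finite F \<Longrightarrow> F \<subseteq> \<S> \<Longrightarrow> C \<inter> \<Inter>F \<noteq> {}"
  obtains c where "c \<in> C" "\<And>S. S \<in> \<S> \<Longrightarrow> c \<in> S"
proof -
  have "C \<inter> \<Inter>\<S> \<noteq> {}"
    using cwkD(3)[OF C] cl fin unfolding compactin_fip by blast
  then show ?thesis using that by blast
qed

text \<open>A weak cluster point expressed through closed half-spaces: \<open>\<S>\<close> collects
  those that contain a tail of the sequence, and finitely many of them share a term
  \<open>x n\<close>.\<close>

lemma cwk_cluster_point:
  fixes x :: "nat \<Rightarrow> 'a::real_normed_vector"
  assumes C: "C \<in> cwk" and x: "\<And>n. x n \<in> C"
  obtains c where "c \<in> C"
    "\<And>(f :: 'a \<Rightarrow>\<^sub>L real) a N. (\<And>n. N \<le> n \<Longrightarrow> blinfun_apply f (x n) \<le> a) \<Longrightarrow> blinfun_apply f c \<le> a"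
proof -
  define \<S> where "\<S> = {{y. blinfun_apply f y \<le> a} | (f :: 'a \<Rightarrow>\<^sub>L real) a. \<exists>N. \<forall>n\<ge>N. blinfun_apply f (x n) \<le> a}"
  obtain c where c: "c \<in> C" "\<And>S. S \<in> \<S> \<Longrightarrow> c \<in> S"
  proof (rule cwk_fip[OF C])
    show "closedin weak_topology S" if "S \<in> \<S>" for S
      using that by (auto simp: \<S>_def intro: closedin_weak_le)
    fix F assume F: "finite F" "F \<subseteq> \<S>"
    have "\<forall>S\<in>F. \<forall>\<^sub>F n in sequentially. x n \<in> S"
      using F(2) by (fastforce simp: \<S>_def eventually_sequentially)
    then have "\<forall>\<^sub>F n in sequentially. \<forall>S\<in>F. x n \<in> S"
      using F(1) by (simp add: eventually_ball_finite)
    then obtain n where "\<forall>S\<in>F. x n \<in> S" by (auto simp: eventually_sequentially)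
    then show "C \<inter> \<Inter>F \<noteq> {}" using x by blast
  qed blast
  show ?thesis
  proof (rule that[OF c(1)])
    fix f :: "'a \<Rightarrow>\<^sub>L real" and a N assume "\<And>n. N \<le> n \<Longrightarrow> blinfun_apply f (x n) \<le> a"
    then have "{y. blinfun_apply f y \<le> a} \<in> \<S>" by (auto simp: \<S>_def)
    then show "blinfun_apply f c \<le> a" using c(2) by blast
  qed
qed

lemma cwk_bdd_above:
  fixes f :: "'a::real_normed_vector \<Rightarrow>\<^sub>L real"
  assumes "C \<in> cwk"
  shows "bdd_above (blinfun_apply f ` C)"
proof -
  from assms have "compact (blinfun_apply f ` C)"
    using image_compactin[OF cwkD(3) continuous_map_weak_blinfun, of C f] by simp
  then show ?thesis by (intro bounded_imp_bdd_above compact_imp_bounded)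
qed

lemma support_fun_upper: "C \<in> cwk \<Longrightarrow> c \<in> C \<Longrightarrow> blinfun_apply f c \<le> support_fun f C"
  unfolding support_fun_def by (intro cSUP_upper cwk_bdd_above)

lemma support_fun_least: "C \<noteq> {} \<Longrightarrow> (\<And>c. c \<in> C \<Longrightarrow> blinfun_apply f c \<le> a) \<Longrightarrow> support_fun f C \<le> a"
  unfolding support_fun_def by (intro cSUP_least)

lemma support_fun_attained:
  assumes "C \<in> cwk"
  obtains c where "c \<in> C" "blinfun_apply f c = support_fun f C"
proof -
  have "continuous_map weak_topology euclideanreal (\<lambda>x. - blinfun_apply f x)"
    by (intro continuous_intros)
  then obtain c where c: "c \<in> C" "\<And>d. d \<in> C \<Longrightarrow> - blinfun_apply f c \<le> - blinfun_apply f d"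
    using compactin_weak_attains_inf[OF cwkD(3,1)[OF assms]] by blast
  have "support_fun f C \<le> blinfun_apply f c"
    using c(2) cwkD(1)[OF assms] by (intro support_fun_least) auto
  then show ?thesis using that c(1) support_fun_upper[OF assms c(1), of f] by force
qed

lemma sublinear_support_fun:
  assumes C: "C \<in> cwk"
  shows "sublinear (\<lambda>f. support_fun f C)"
proof (rule sublinearI)
  fix f g :: "'a \<Rightarrow>\<^sub>L real"
  show "support_fun (f + g) C \<le> support_fun f C + support_fun g C"
    using support_fun_upper[OF C] cwkD(1)[OF C]
    by (intro support_fun_least) (auto simp: blinfun.add_left intro: add_mono)
next
  fix c :: real and f :: "'a \<Rightarrow>\<^sub>L real" assume "0 < c"
  then show "support_fun (c *\<^sub>R f) C \<le> c * support_fun f C"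
    using support_fun_upper[OF C] cwkD(1)[OF C]
    by (intro support_fun_least) (auto simp: blinfun.scaleR_left)
qed

lemma support_fun_translation:
  assumes "C \<in> cwk"
  shows "support_fun f ((+) u ` C) = blinfun_apply f u + support_fun f C"
proof (rule antisym)
  show "support_fun f ((+) u ` C) \<le> blinfun_apply f u + support_fun f C"
    using cwkD(1)[OF assms] support_fun_upper[OF assms]
    by (intro support_fun_least) (auto simp: blinfun.add_right)
  obtain c where "c \<in> C" "blinfun_apply f c = support_fun f C" by (rule support_fun_attained[OF assms])
  then show "blinfun_apply f u + support_fun f C \<le> support_fun f ((+) u ` C)"
    using support_fun_upper[OF cwk_translation[OF assms], of "u + c" u f] by (simp add: blinfun.add_right)
qed

section \<open>Functionals on the dual that are represented in the space\<close>

text \<open>Compactness reduces the claim to finitely many \<open>f\<close>. For these the sum of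
  squares \<open>g\<close> is minimised over \<open>D\<close>; the domination of
  \<open>\<phi>\<close> at the negative gradient of \<open>g\<close>, combined with first-order
  optimality, makes the minimum zero.\<close>

lemma linear_dominated_by_support_fun:
  fixes \<phi> :: "('a::real_normed_vector \<Rightarrow>\<^sub>L real) \<Rightarrow> real"
  assumes D: "D \<in> cwk" and lin: "linear \<phi>" and le: "\<And>f. \<phi> f \<le> support_fun f D"
  obtains d where "d \<in> D" "\<And>f. blinfun_apply f d = \<phi> f"
proof -
  let ?S = "\<lambda>f. {y. blinfun_apply f y = \<phi> f}"
  obtain d where "d \<in> D" "\<And>S. S \<in> range ?S \<Longrightarrow> d \<in> S"
  proof (rule cwk_fip[OF D])
    show "closedin weak_topology S" if "S \<in> range ?S" for S using that closedin_weak_eq by auto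
    fix \<F> assume \<F>: "finite \<F>" "\<F> \<subseteq> range ?S"
    obtain F where F: "finite F" "\<F> = ?S ` F" using finite_subset_image[OF \<F>] by blast
    define g where "g = (\<lambda>y. \<Sum>f\<in>F. (blinfun_apply f y - \<phi> f)\<^sup>2)"
    have "continuous_map weak_topology euclideanreal g"
      unfolding g_def by (intro continuous_intros F)
    then obtain d where d: "d \<in> D" "\<And>e. e \<in> D \<Longrightarrow> g d \<le> g e"
      using compactin_weak_attains_inf[OF cwkD(3,1)[OF D]] by blast
    define a where "a f = blinfun_apply f d - \<phi> f" for f
    define h where "h = - (\<Sum>f\<in>F. a f *\<^sub>R f)"
    have happ: "blinfun_apply h y = - (\<Sum>f\<in>F. a f * blinfun_apply f y)" for y
      by (simp add: h_def blinfun.minus_left blinfun.sum_left blinfun.scaleR_left)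
    \<comment> \<open>first-order optimality of the minimiser \<open>d\<close>: it maximises \<open>h\<close>, the negative gradient\<close>
    have opt: "blinfun_apply h e \<le> blinfun_apply h d" if e: "e \<in> D" for e
    proof (rule ccontr)
      assume "\<not> ?thesis"
      then have neg: "0 < blinfun_apply h e - blinfun_apply h d" (is "0 < ?r") by simp
      define Q where "Q = (\<Sum>f\<in>F. (blinfun_apply f e - blinfun_apply f d)\<^sup>2)"
      have Q: "0 \<le> Q" by (simp add: Q_def sum_nonneg)
      \<comment> \<open>The step is so short that the quadratic term \<open>t * t * Q\<close> cannot
        outweigh the linear gain \<open>2 * t * ?r\<close>.\<close>
      define t where "t = min 1 (?r / (Q + 1))"
      have t: "0 < t" "t \<le> 1" "t * (Q + 1) \<le> ?r"
      proof -
        show "0 < t" "t \<le> 1" using neg Q by (auto simp: t_def)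
        have "t * (Q + 1) \<le> ?r / (Q + 1) * (Q + 1)" using Q by (intro mult_right_mono) (auto simp: t_def)
        then show "t * (Q + 1) \<le> ?r" using Q by simp
      qed
      have "(1 - t) *\<^sub>R d + t *\<^sub>R e \<in> D" using t d(1) e by (intro convexD[OF cwkD(2)[OF D]]) auto
      then have "g d \<le> g ((1 - t) *\<^sub>R d + t *\<^sub>R e)" by (rule d(2))
      also have "\<dots> = (\<Sum>f\<in>F. (a f)\<^sup>2 + t\<^sup>2 * (blinfun_apply f e - blinfun_apply f d)\<^sup>2
          + 2 * t * (a f * blinfun_apply f e - a f * blinfun_apply f d))"
        unfolding g_def
      proof (intro sum.cong refl)
        fix f
        have "blinfun_apply f ((1 - t) *\<^sub>R d + t *\<^sub>R e) - \<phi> f = a f + t * (blinfun_apply f e - blinfun_apply f d)"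
          by (simp add: a_def blinfun.add_right blinfun.scaleR_right left_diff_distrib right_diff_distrib)
        then show "(blinfun_apply f ((1 - t) *\<^sub>R d + t *\<^sub>R e) - \<phi> f)\<^sup>2 =
            (a f)\<^sup>2 + t\<^sup>2 * (blinfun_apply f e - blinfun_apply f d)\<^sup>2
            + 2 * t * (a f * blinfun_apply f e - a f * blinfun_apply f d)"
          by (simp only: power2_sum power_mult_distrib) (simp add: right_diff_distrib mult_ac)
      qed
      also have "\<dots> = (\<Sum>f\<in>F. (a f)\<^sup>2) + t\<^sup>2 * Q
          + 2 * t * (\<Sum>f\<in>F. a f * blinfun_apply f e - a f * blinfun_apply f d)"
        by (simp only: sum.distrib Q_def sum_distrib_left)
      also have "(\<Sum>f\<in>F. a f * blinfun_apply f e - a f * blinfun_apply f d) = - ?r"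
        by (simp only: sum_subtractf happ)
      also have "(\<Sum>f\<in>F. (a f)\<^sup>2) = g d" by (simp add: g_def a_def)
      finally have "t * (2 * ?r) \<le> t * (t * Q)" by (simp only: power2_eq_square; linarith)
      then have "2 * ?r \<le> t * Q" using t(1) by (simp only: mult_le_cancel_left_pos)
      moreover have "t * Q \<le> ?r" using t by (simp only: distrib_left; linarith)
      ultimately have "2 * ?r \<le> ?r" by (rule order_trans)
      with neg show False by simp
    qed
    \<comment> \<open>The maximum of \<open>h\<close> over \<open>D\<close> is attained at
      \<open>d\<close>; rearranged, \<open>\<phi> h \<le> blinfun_apply h d\<close> says that the
      sum of the squares of the \<open>a f\<close> is at most zero.\<close>
    have "\<phi> h \<le> support_fun h D" by (rule le)
    also have "\<dots> \<le> blinfun_apply h d" using opt cwkD(1)[OF D] by (intro support_fun_least) auto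
    also have "\<phi> h = - (\<Sum>f\<in>F. a f * \<phi> f)"
      unfolding h_def by (simp add: linear_neg[OF lin] linear_sum[OF lin] linear_scale[OF lin])
    finally have "(\<Sum>f\<in>F. a f * blinfun_apply f d) - (\<Sum>f\<in>F. a f * \<phi> f) \<le> 0"
      by (simp only: happ; linarith)
    moreover have "(\<Sum>f\<in>F. a f * blinfun_apply f d) - (\<Sum>f\<in>F. a f * \<phi> f) = (\<Sum>f\<in>F. (a f)\<^sup>2)"
      by (simp only: sum_subtractf[symmetric] right_diff_distrib[symmetric] a_def power2_eq_square)
    ultimately have "(\<Sum>f\<in>F. (a f)\<^sup>2) = 0" by (intro antisym) (simp_all add: sum_nonneg)
    then have "\<forall>f\<in>F. (a f)\<^sup>2 = 0" using F(1) by (simp add: sum_nonneg_eq_0_iff)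
    then have "d \<in> \<Inter>\<F>" using F(2) by (auto simp: a_def)
    then show "D \<inter> \<Inter>\<F> \<noteq> {}" using d(1) by blast
  qed blast
  then show ?thesis using that by blast
qed

text \<open>\<open>D\<close> is cut down by all half-spaces on which \<open>f\<close> is at most
  \<open>p f\<close>. To attain \<open>p f\<close>, take a linear functional below \<open>p\<close>
  that touches it at \<open>f\<close>: it also lies below the support function of \<open>D\<close>,
  hence is evaluation at a point of \<open>D\<close>, and that point belongs to
  \<open>W\<close>.\<close>

lemma sublinear_dominated_by_support_fun:
  fixes p :: "('a::real_normed_vector \<Rightarrow>\<^sub>L real) \<Rightarrow> real"
  assumes D: "D \<in> cwk" and p: "sublinear p" and le: "\<And>f. p f \<le> support_fun f D"
  obtains W where "W \<in> cwk" "\<And>f. support_fun f W = p f"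
proof -
  define W where "W = D \<inter> \<Inter>(range (\<lambda>f. {y. blinfun_apply f y \<le> p f}))"
  have ex: "\<exists>d\<in>W. blinfun_apply f d = p f" for f
  proof -
    obtain \<phi> where \<phi>: "linear \<phi>" "\<And>g. \<phi> g \<le> p g" "\<phi> f = p f"
      using hahn_banach_sublinear[OF p] by metis
    obtain d where "d \<in> D" "\<And>g. blinfun_apply g d = \<phi> g"
      using linear_dominated_by_support_fun[OF D \<phi>(1)] order_trans[OF \<phi>(2) le] by blast
    with \<phi> show ?thesis by (intro bexI[of _ d]) (auto simp: W_def)
  qed
  have "convex {y. blinfun_apply f y \<le> p f}" for f
    using convex_linear_vimage[of "blinfun_apply f" "{..p f}"] blinfun.bounded_linear_right[of f]
    by (auto simp: vimage_def bounded_linear.linear)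
  then have "W \<in> cwk" unfolding W_def
    using ex[of 0] unfolding W_def by (intro cwk_Int_closedin[OF D] closedin_Inter) (auto intro!: convex_Inter closedin_weak_le)
  moreover have "support_fun f W = p f" for f
  proof (rule antisym)
    show "support_fun f W \<le> p f" using ex[of 0] by (intro support_fun_least) (auto simp: W_def)
    show "p f \<le> support_fun f W" using ex[of f] support_fun_upper[OF \<open>W \<in> cwk\<close>] by metis
  qed
  ultimately show ?thesis using that by blast
qed

section \<open>Nested balls and the norm boundedness of weakly compact sets\<close>

text \<open>The Baire category argument as a recursion: a state \<open>s\<close> carries a ball and
  possibly further data, \<open>S n\<close> records what stage \<open>n\<close> achieves, and
  completeness supplies a point common to all balls.\<close>

lemma nested_cballs:
  fixes c :: "'s \<Rightarrow> 'a::complete_space" and r :: "'s \<Rightarrow> real"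
  assumes s0: "I s0" and pos: "\<And>s. I s \<Longrightarrow> 0 < r s"
    and step: "\<And>n s. I s \<Longrightarrow> \<exists>s'. I s' \<and> S n s s' \<and> cball (c s') (r s') \<subseteq> cball (c s) (r s) \<and> r s' \<le> r s / 2"
  obtains f v where "f 0 = s0" "\<And>n. I (f n)" "\<And>n. S n (f n) (f (Suc n))"
    "\<And>n. v \<in> cball (c (f n)) (r (f n))" "(\<lambda>n. r (f n)) \<longlonglongrightarrow> 0"
proof -
  have "\<exists>f. \<forall>n. (I (f n) \<and> (n = 0 \<longrightarrow> f n = s0)) \<and> (S n (f n) (f (Suc n)) \<and>
      cball (c (f (Suc n))) (r (f (Suc n))) \<subseteq> cball (c (f n)) (r (f n)) \<and> r (f (Suc n)) \<le> r (f n) / 2)"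
    by (rule dependent_nat_choice) (use s0 step in auto)
  then obtain f where f0: "f 0 = s0" and f: "\<And>n. I (f n)" "\<And>n. S n (f n) (f (Suc n))"
    and sub: "\<And>n. cball (c (f (Suc n))) (r (f (Suc n))) \<subseteq> cball (c (f n)) (r (f n))"
    and half: "\<And>n. r (f (Suc n)) \<le> r (f n) / 2"
    by blast
  have rle: "r (f n) \<le> r s0 * (1/2) ^ n" for n
    by (induction n) (use half in \<open>auto simp: f0 intro: order_trans\<close>)
  have r0: "0 < r (f n)" for n using pos f(1) by blast
  have lim: "(\<lambda>n. r (f n)) \<longlonglongrightarrow> 0"
  proof (rule tendsto_sandwich[of "\<lambda>_. 0" _ _ "\<lambda>n. r s0 * (1/2) ^ n"])
    show "(\<lambda>n. r s0 * (1/2) ^ n) \<longlonglongrightarrow> 0"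
      using tendsto_mult_right_zero[OF LIMSEQ_realpow_zero[of "1/2::real"]] by auto
  qed (use rle r0 in \<open>auto intro!: always_eventually less_imp_le\<close>)
  obtain v where "\<And>n. v \<in> cball (c (f n)) (r (f n))"
  proof (rule decreasing_closed_nest[of "\<lambda>n. cball (c (f n)) (r (f n))"])
    show "cball (c (f n)) (r (f n)) \<subseteq> cball (c (f m)) (r (f m))" if "m \<le> n" for m n
      using lift_Suc_antimono_le[of "\<lambda>n. cball (c (f n)) (r (f n))"] sub that by blast
    fix e :: real assume "0 < e"
    then have "\<forall>\<^sub>F n in sequentially. r (f n) < e / 2"
      using lim by (intro order_tendstoD(2)) auto
    then obtain n where n: "r (f n) < e / 2" by (auto simp: eventually_sequentially)
    have "dist x y < e" if "x \<in> cball (c (f n)) (r (f n))" "y \<in> cball (c (f n)) (r (f n))" for x y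
      using that n dist_triangle2[of x y "c (f n)"] by (simp add: dist_commute)
    then show "\<exists>n. \<forall>x\<in>cball (c (f n)) (r (f n)). \<forall>y\<in>cball (c (f n)) (r (f n)). dist x y < e" by blast
  qed (use r0 in \<open>auto simp: not_less intro: less_imp_le\<close>)
  then show ?thesis using that f0 f lim by blast
qed

text \<open>Uniform boundedness by a gliding hump: if \<open>C\<close> were unbounded, nested balls
  of functionals would produce some \<open>g\<close> with unbounded values on \<open>C\<close>,
  whereas weak compactness bounds \<open>g\<close> and \<open>- g\<close> on \<open>C\<close> from
  above.\<close>

lemma cwk_bounded:
  fixes C :: "'a::banach set"
  assumes C: "C \<in> cwk"
  obtains M where "0 < M" "\<And>c. c \<in> C \<Longrightarrow> norm c \<le> M"
proof (rule ccontr)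
  assume "\<not> thesis"
  with that have unb: "\<exists>c\<in>C. M < norm c" if "0 < M" for M using that by (metis not_le)
  define S where "S = (\<lambda>n (s :: ('a \<Rightarrow>\<^sub>L real) \<times> real) s'.
      \<exists>c\<in>C. \<forall>g\<in>cball (fst s') (snd s'). real n \<le> \<bar>blinfun_apply g c\<bar>)"
  have step: "\<exists>s'. 0 < snd s' \<and> S n s s' \<and>
      cball (fst s') (snd s') \<subseteq> cball (fst s) (snd s) \<and> snd s' \<le> snd s / 2"
    if "0 < snd s" for n and s :: "('a \<Rightarrow>\<^sub>L real) \<times> real"
  proof -
    obtain a r where s: "s = (a, r)" by fastforce
    have r: "0 < r" using that s by simp
    obtain c where c: "c \<in> C" "(real n + 1) * 4 / r < norm c" using unb[of "(real n + 1) * 4 / r"] r by auto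
    obtain h :: "'a \<Rightarrow>\<^sub>L real" where h: "norm h \<le> 1" "blinfun_apply h c = norm c" by (rule norming_functional)
    have big: "real n + 1 < r / 4 * norm c" using c(2) r by (simp add: field_simps)
    \<comment> \<open>The sign aligns the perturbation with the value already present, so that the
      two cannot cancel.\<close>
    define \<sigma> :: real where "\<sigma> = (if 0 \<le> blinfun_apply a c then 1 else - 1)"
    define b where "b = a + (\<sigma> * (r / 4)) *\<^sub>R h"
    have "\<bar>blinfun_apply b c\<bar> = \<bar>blinfun_apply a c\<bar> + r / 4 * norm c"
    proof -
      have "0 \<le> r / 4 * norm c" using r by simp
      then show ?thesis by (simp add: b_def \<sigma>_def blinfun.add_left blinfun.scaleR_left h(2))
    qed
    then have bc: "real n + 1 < \<bar>blinfun_apply b c\<bar>" using big by linarith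
    have dist: "dist a b \<le> r / 4"
      using r h(1) by (auto simp: b_def dist_norm \<sigma>_def mult_left_le)
    \<comment> \<open>The second entry limits the change of the value at \<open>c\<close> over the
      new ball to 1, which the surplus in \<open>real n + 1\<close> absorbs.\<close>
    define \<rho> where "\<rho> = min (r / 4) (1 / (norm c + 1))"
    have \<rho>: "0 < \<rho>" "\<rho> \<le> r / 4" "\<rho> * norm c \<le> 1"
    proof -
      have n1: "0 < norm c + 1" by (simp add: add_nonneg_pos)
      show "0 < \<rho>" "\<rho> \<le> r / 4" using r n1 by (auto simp: \<rho>_def)
      have "\<rho> * norm c \<le> 1 / (norm c + 1) * norm c" by (intro mult_right_mono) (auto simp: \<rho>_def)
      also have "\<dots> \<le> 1" using n1 by (simp add: field_simps)
      finally show "\<rho> * norm c \<le> 1" .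
    qed
    have "real n \<le> \<bar>blinfun_apply g c\<bar>" if "g \<in> cball b \<rho>" for g
    proof -
      have "\<bar>blinfun_apply (b - g) c\<bar> \<le> norm (b - g) * norm c" using norm_blinfun[of "b - g" c] by simp
      also have "\<dots> \<le> \<rho> * norm c" using that by (intro mult_right_mono) (auto simp: dist_norm)
      finally show ?thesis using \<rho>(3) bc by (simp add: blinfun.diff_left)
    qed
    moreover have "cball b \<rho> \<subseteq> cball a r"
    proof
      fix x assume "x \<in> cball b \<rho>"
      then show "x \<in> cball a r" using dist \<rho>(2) r dist_triangle[of a x b] by simp
    qed
    ultimately show ?thesis using \<rho> r c(1) by (intro exI[of _ "(b, \<rho>)"]) (auto simp: S_def s intro!: bexI[of _ c])
  qed
  obtain f g where f: "\<And>n. S n (f n) (f (Suc n))" "\<And>n. g \<in> cball (fst (f n)) (snd (f n))"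
  proof (rule nested_cballs[of "\<lambda>s. 0 < snd s" "(0, 1)" snd S fst])
    show "0 < snd (0 :: 'a \<Rightarrow>\<^sub>L real, 1 :: real)" by simp
  qed (use step in blast)+
  have ex: "\<exists>c\<in>C. real n \<le> \<bar>blinfun_apply g c\<bar>" for n
    using f(1)[of n] f(2)[of "Suc n"] unfolding S_def by blast
  have ab: "\<bar>blinfun_apply g c\<bar> \<le> \<bar>support_fun g C\<bar> + \<bar>support_fun (- g) C\<bar>" if "c \<in> C" for c
    using support_fun_upper[OF C that, of g] support_fun_upper[OF C that, of "- g"]
    by (simp add: blinfun.minus_left)
  obtain n where "\<bar>support_fun g C\<bar> + \<bar>support_fun (- g) C\<bar> < real n" using reals_Archimedean2 by blast
  then show False using ex[of n] ab by fastforce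
qed

section \<open>Strongly exposed points and the Orlicz--Pettis theorem\<close>

definition face :: "'a::real_normed_vector set \<Rightarrow> ('a \<Rightarrow>\<^sub>L real) \<Rightarrow> 'a set" where
  "face C f = {c \<in> C. blinfun_apply f c = support_fun f C}"

lemma face_nonempty: "C \<in> cwk \<Longrightarrow> \<exists>c. c \<in> face C f"
  using support_fun_attained[of C f] by (auto simp: face_def)

lemma face_iff:
  assumes C: "C \<in> cwk"
  shows "c \<in> face C f \<longleftrightarrow> c \<in> C \<and> (\<forall>d\<in>C. blinfun_apply f d \<le> blinfun_apply f c)"
proof -
  have "blinfun_apply f c = support_fun f C"
    if c: "c \<in> C" "\<forall>d\<in>C. blinfun_apply f d \<le> blinfun_apply f c"
    using that support_fun_upper[OF C c(1), of f] cwkD(1)[OF C]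
    by (intro antisym support_fun_least) auto
  then show ?thesis using support_fun_upper[OF C, of _ f] by (auto simp: face_def)
qed

text \<open>A maximiser \<open>y\<close> of \<open>w\<close> is no better than \<open>c\<close> for
  \<open>v\<close>, and the error \<open>w - (v + \<tau> *\<^sub>R h)\<close> can favour it by at
  most \<open>2 * \<rho> * M\<close>; hence \<open>h\<close> must be nearly as large at
  \<open>y\<close> as at \<open>c\<close>.\<close>

lemma face_perturb:
  fixes C :: "'a::banach set"
  assumes C: "C \<in> cwk" and M: "\<And>c. c \<in> C \<Longrightarrow> norm c \<le> M"
    and c: "c \<in> face C v" and \<tau>: "0 < \<tau>"
    and w: "norm (w - (v + \<tau> *\<^sub>R h)) \<le> \<rho>" and \<rho>: "2 * \<rho> * M < \<tau> * (blinfun_apply h c - e)"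
    and y: "y \<in> face C w"
  shows "e < blinfun_apply h y"
proof -
  let ?u = "w - (v + \<tau> *\<^sub>R h)"
  have C': "c \<in> C" "y \<in> C" using c y by (auto simp: face_def)
  have bound: "\<bar>blinfun_apply ?u x\<bar> \<le> \<rho> * M" if "x \<in> C" for x
  proof -
    have "\<bar>blinfun_apply ?u x\<bar> \<le> norm ?u * norm x" using norm_blinfun[of ?u x] by simp
    also have "\<dots> \<le> \<rho> * M" using w M[OF that] by (intro mult_mono) (auto intro: order_trans[OF norm_ge_zero])
    finally show ?thesis .
  qed
  have split: "blinfun_apply w x = blinfun_apply ?u x + blinfun_apply v x + \<tau> * blinfun_apply h x" for x
    by (simp add: blinfun.diff_left blinfun.add_left blinfun.scaleR_left)
  have "blinfun_apply v y \<le> blinfun_apply v c" "blinfun_apply w c \<le> blinfun_apply w y"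
    using c y C' by (auto simp: face_iff[OF C])
  then have "\<tau> * (blinfun_apply h c - e) - 2 * (\<rho> * M) \<le> \<tau> * (blinfun_apply h y - e)"
    using bound[OF C'(1)] bound[OF C'(2)] unfolding split[of c] split[of y] right_diff_distrib
    by linarith
  then have "0 < \<tau> * (blinfun_apply h y - e)" using \<rho> by (simp only: mult.assoc; linarith)
  then show ?thesis using \<tau> by (simp add: zero_less_mult_iff)
qed

text \<open>Mazur's theorem for a point known only through half-spaces: \<open>cl\<close> puts
  \<open>c\<close> into every closed half-space containing all \<open>P n\<close>. The union of the
  hulls is convex because the \<open>P n\<close> increase, and separating \<open>c\<close> from it
  shows that the distance vanishes.\<close>

lemma mazur_increasing_hulls:
  fixes P :: "nat \<Rightarrow> 'a::real_normed_vector set"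
  assumes mono: "\<And>n. P n \<subseteq> P (Suc n)" and ne: "P 0 \<noteq> {}"
    and cl: "\<And>(f :: 'a \<Rightarrow>\<^sub>L real) a. (\<And>n x. x \<in> P n \<Longrightarrow> blinfun_apply f x \<le> a) \<Longrightarrow> blinfun_apply f c \<le> a"
    and \<epsilon>: "0 < \<epsilon>"
  obtains n x where "x \<in> convex hull (P n)" "norm (c - x) < \<epsilon>"
proof -
  define K where "K = (\<Union>n. convex hull (P n))"
  have mono': "P m \<subseteq> P n" if "m \<le> n" for m n using lift_Suc_mono_le[of P] mono that by blast
  have sub: "P n \<subseteq> K" for n by (auto simp: K_def intro: hull_inc)
  have "convex K"
  proof (rule convexI)
    fix x y and u v :: real assume "x \<in> K" "y \<in> K" and uv: "0 \<le> u" "0 \<le> v" "u + v = 1"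
    then obtain m n where "x \<in> convex hull (P m)" "y \<in> convex hull (P n)" by (auto simp: K_def)
    then have "x \<in> convex hull (P (max m n))" "y \<in> convex hull (P (max m n))"
      using hull_mono[OF mono'[of m "max m n"]] hull_mono[OF mono'[of n "max m n"]] by auto
    then have "u *\<^sub>R x + v *\<^sub>R y \<in> convex hull (P (max m n))"
      using convexD[OF convex_convex_hull _ _ uv] by blast
    then show "u *\<^sub>R x + v *\<^sub>R y \<in> K" by (auto simp: K_def)
  qed
  have K: "K \<noteq> {}" using sub[of 0] ne by auto
  obtain f :: "'a \<Rightarrow>\<^sub>L real" where f: "\<And>x. x \<in> K \<Longrightarrow> blinfun_apply f x + infdist c K \<le> blinfun_apply f c"
    using separation_infdist[OF \<open>convex K\<close> K] by metis
  have "blinfun_apply f c \<le> blinfun_apply f c - infdist c K"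
  proof (rule cl)
    fix n x assume "x \<in> P n"
    then show "blinfun_apply f x \<le> blinfun_apply f c - infdist c K" using f[of x] sub[of n] by auto
  qed
  then have "(INF x\<in>K. dist c x) < \<epsilon>" using \<epsilon> K by (simp add: infdist_def)
  then obtain x where "x \<in> K" "dist c x < \<epsilon>"
    using cINF_less_iff[of K "dist c" \<epsilon>] K by (auto intro: bdd_belowI2[of _ 0])
  then show ?thesis using that by (auto simp: K_def dist_norm)
qed

text \<open>Keeping a distance from a whole hull reduces to keeping twice that distance from the
  finitely many points of a net whose mesh is the distance.\<close>

lemma convex_hull_finite_net:
  fixes P :: "'a::real_normed_vector set"
  assumes "finite P" "0 < \<epsilon>"
  obtains N where "finite N" "\<And>x. x \<in> convex hull P \<Longrightarrow> \<exists>k\<in>N. norm (x - k) < \<epsilon>"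
proof -
  have "compact (convex hull P)" by (rule finite_imp_compact_convex_hull[OF assms(1)])
  then obtain N where "finite N" "convex hull P \<subseteq> (\<Union>k\<in>N. ball k \<epsilon>)"
    using assms(2) unfolding compact_eq_totally_bounded by blast
  then show ?thesis using that[of N] by (fastforce simp: dist_norm norm_minus_commute)
qed

text \<open>The new centre is \<open>v\<close> plus a multiple of a functional \<open>h\<close> that
  norms \<open>c - k\<close>. By \<open>face_perturb\<close>, on all faces over a small ball around
  it \<open>h\<close> exceeds its value at \<open>k\<close> by more than \<open>\<eta>\<close>. The
  three displacements \<open>r / 2\<close>, \<open>r / 4\<close> and \<open>r / 4\<close> add up to
  \<open>r\<close>.\<close>

lemma face_avoid_point:
  fixes C :: "'a::banach set"
  assumes C: "C \<in> cwk" and M: "0 < M" "\<And>c. c \<in> C \<Longrightarrow> norm c \<le> M" and r: "0 < r"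
    and v: "v \<in> cball a (r / 2)" and c: "c \<in> face C v" "\<eta> < norm (c - k)"
  obtains b \<rho> where "0 < \<rho>" "cball b \<rho> \<subseteq> cball a r"
    "\<And>w y. w \<in> cball b \<rho> \<Longrightarrow> y \<in> face C w \<Longrightarrow> \<eta> < norm (y - k)"
proof -
  obtain h :: "'a \<Rightarrow>\<^sub>L real" where h: "norm h \<le> 1" "blinfun_apply h (c - k) = norm (c - k)"
    by (rule norming_functional)
  define e where "e = blinfun_apply h k + \<eta>"
  have e: "0 < blinfun_apply h c - e" using h(2) c(2) by (simp add: e_def blinfun.diff_right)
  \<comment> \<open>The second entry makes \<open>4 * M * \<rho>\<close> at most the gain, so the
    strict inequality for \<open>2 * \<rho> * M\<close> in \<open>face_perturb\<close> holds with
    room to spare.\<close>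
  define \<rho> where "\<rho> = min (r / 4) (r / 4 * (blinfun_apply h c - e) / (4 * M))"
  have \<rho>: "0 < \<rho>" "\<rho> \<le> r / 4" using r M(1) e by (auto simp: \<rho>_def)
  have "4 * M * \<rho> \<le> r / 4 * (blinfun_apply h c - e)"
  proof -
    have "4 * M * \<rho> \<le> 4 * M * (r / 4 * (blinfun_apply h c - e) / (4 * M))"
      using M(1) by (intro mult_left_mono) (auto simp: \<rho>_def)
    then show ?thesis using M(1) by simp
  qed
  moreover have "0 < M * \<rho>" using M(1) \<rho>(1) by simp
  ultimately have \<rho>M: "2 * \<rho> * M < r / 4 * (blinfun_apply h c - e)"
    by (simp only: mult.assoc mult.commute[of M \<rho>]; linarith)
  define b where "b = v + (r / 4) *\<^sub>R h"
  show ?thesis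
  proof (rule that[OF \<rho>(1)])
    show "cball b \<rho> \<subseteq> cball a r"
    proof
      fix x assume "x \<in> cball b \<rho>"
      moreover have "dist v b \<le> r / 4" using h(1) r by (simp add: b_def dist_norm mult_left_le)
      ultimately show "x \<in> cball a r"
        using v \<rho>(2) dist_triangle[of a x v] dist_triangle[of v x b] by simp
    qed
    fix w y assume w: "w \<in> cball b \<rho>" and y: "y \<in> face C w"
    have "norm (w - b) \<le> \<rho>" using w by (simp add: dist_norm norm_minus_commute)
    then have "e < blinfun_apply h y"
      using r unfolding b_def by (intro face_perturb[OF C M(2) c(1) _ _ \<rho>M y]) auto
    then have "\<eta> < blinfun_apply h (y - k)" by (simp add: e_def blinfun.diff_right)
    also have "\<dots> \<le> norm (y - k)" using blinfun_apply_le_norm[OF h(1), of "y - k"] by simp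
    finally show "\<eta> < norm (y - k)" .
  qed
qed

\<comment> \<open>If the faces over every small ball had large diameter, one could keep the faces away from the
  convex hulls of previously chosen face points; a weak cluster point of these points would then be
  a face point of the limit functional, against Mazur's theorem.\<close>
lemma face_diameter_small:
  fixes C :: "'a::banach set"
  assumes C: "C \<in> cwk" and r0: "0 < r0" and \<epsilon>: "0 < \<epsilon>"
  shows "\<exists>b \<rho>. 0 < \<rho> \<and> cball b \<rho> \<subseteq> cball a0 r0 \<and>
    (\<forall>v\<in>cball b \<rho>. \<forall>w\<in>cball b \<rho>. \<forall>c\<in>face C v. \<forall>d\<in>face C w. norm (c - d) \<le> \<epsilon>)"
proof (rule ccontr)
  assume neg: "\<not> ?thesis"
  have bad: "\<exists>v\<in>cball b \<rho>. \<exists>w\<in>cball b \<rho>. \<exists>c\<in>face C v. \<exists>d\<in>face C w. \<epsilon> < norm (c - d)"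
    if "0 < \<rho>" "cball b \<rho> \<subseteq> cball a0 r0" for b \<rho>
  proof (rule ccontr)
    assume "\<not> ?thesis"
    then have "\<forall>v\<in>cball b \<rho>. \<forall>w\<in>cball b \<rho>. \<forall>c\<in>face C v. \<forall>d\<in>face C w. norm (c - d) \<le> \<epsilon>"
      by (simp add: not_less)
    with that neg show False by blast
  qed
  obtain M where M: "0 < M" "\<And>c. c \<in> C \<Longrightarrow> norm c \<le> M" using cwk_bounded[OF C] by blast
  have avoid1: "\<exists>b \<rho>. 0 < \<rho> \<and> cball b \<rho> \<subseteq> cball a r \<and> (\<forall>v\<in>cball b \<rho>. \<forall>y\<in>face C v. \<epsilon> / 3 < norm (y - k))"
    if r: "0 < r" and sub: "cball a r \<subseteq> cball a0 r0" for a r k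
  proof -
    have "cball a (r / 2) \<subseteq> cball a r" using r by (intro subset_cball) simp
    with sub have "cball a (r / 2) \<subseteq> cball a0 r0" by (rule order_trans[rotated])
    then obtain v w c d where vw: "v \<in> cball a (r / 2)" "w \<in> cball a (r / 2)" "c \<in> face C v" "d \<in> face C w"
        "\<epsilon> < norm (c - d)"
      using bad[of "r / 2" a] r by auto
    \<comment> \<open>Two face points more than \<open>\<epsilon>\<close> apart cannot both be
      within \<open>\<epsilon> / 3\<close> of \<open>k\<close>. They are taken over the ball of half
      the radius, as \<open>face_avoid_point\<close> requires.\<close>
    have "norm (c - d) \<le> norm (c - k) + norm (d - k)"
      using norm_triangle_ineq4[of "c - k" "d - k"] by simp
    then have "\<epsilon> / 3 < norm (c - k) \<or> \<epsilon> / 3 < norm (d - k)" using vw(5) \<epsilon> by linarith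
    then obtain v' c' where v': "v' \<in> cball a (r / 2)" "c' \<in> face C v'" "\<epsilon> / 3 < norm (c' - k)"
      using vw by blast
    show ?thesis
      using face_avoid_point[OF C M r v'] by metis
  qed
  have avoid: "\<exists>b \<rho>. 0 < \<rho> \<and> cball b \<rho> \<subseteq> cball a r \<and> (\<forall>v\<in>cball b \<rho>. \<forall>y\<in>face C v. \<forall>k\<in>N. \<epsilon> / 3 < norm (y - k))"
    if fin: "finite N" and r: "0 < r" and asub: "cball a r \<subseteq> cball a0 r0" for a r N
    using fin
  proof (induction N)
    case empty
    then show ?case using r by blast
  next
    case (insert k N)
    then obtain b \<rho> where b: "0 < \<rho>" "cball b \<rho> \<subseteq> cball a r"
      "\<And>v y k. v \<in> cball b \<rho> \<Longrightarrow> y \<in> face C v \<Longrightarrow> k \<in> N \<Longrightarrow> \<epsilon> / 3 < norm (y - k)" by blast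
    obtain b' \<rho>' where b': "0 < \<rho>'" "cball b' \<rho>' \<subseteq> cball b \<rho>"
      "\<And>v y. v \<in> cball b' \<rho>' \<Longrightarrow> y \<in> face C v \<Longrightarrow> \<epsilon> / 3 < norm (y - k)"
      using avoid1[OF b(1) order_trans[OF b(2) asub], of k] by blast
    show ?case
    proof (intro exI conjI ballI)
      show "0 < \<rho>'" by (rule b'(1))
      show "cball b' \<rho>' \<subseteq> cball a r" using b'(2) b(2) by (rule order_trans)
      fix v y k' assume v: "v \<in> cball b' \<rho>'" and y: "y \<in> face C v" and k': "k' \<in> insert k N"
      have "v \<in> cball b \<rho>" using v b'(2) by (rule rev_subsetD)
      then show "\<epsilon> / 3 < norm (y - k')" using k' b(3)[OF _ y] b'(3)[OF v y] by auto
    qed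
  qed
  define ctr where "ctr = (\<lambda>s :: ('a \<Rightarrow>\<^sub>L real) \<times> real \<times> 'a set. fst s)"
  define rad where "rad = (\<lambda>s :: ('a \<Rightarrow>\<^sub>L real) \<times> real \<times> 'a set. fst (snd s))"
  define pts where "pts = (\<lambda>s :: ('a \<Rightarrow>\<^sub>L real) \<times> real \<times> 'a set. snd (snd s))"
  note sel = ctr_def rad_def pts_def
  define I where "I s \<longleftrightarrow> 0 < rad s \<and> cball (ctr s) (rad s) \<subseteq> cball a0 r0 \<and> finite (pts s) \<and> pts s \<noteq> {}" for s
  \<comment> \<open>The hull avoided at a stage is generated by the earlier points only; the new
    point joins the hull for the next stage. The distance \<open>\<epsilon> / 6\<close> is
    \<open>\<epsilon> / 3\<close> minus the mesh of the net.\<close>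
  define S where "S n s s' \<longleftrightarrow> (\<exists>c\<in>face C (ctr s'). pts s' = insert c (pts s)) \<and>
      (\<forall>v\<in>cball (ctr s') (rad s'). \<forall>y\<in>face C v. \<forall>x\<in>convex hull (pts s). \<epsilon> / 6 < norm (y - x))"
    for n :: nat and s s'
  have step: "\<exists>s'. I s' \<and> S n s s' \<and> cball (ctr s') (rad s') \<subseteq> cball (ctr s) (rad s) \<and> rad s' \<le> rad s / 2"
    if I: "I s" for n s
  proof -
    obtain N where N: "finite N" "\<And>x. x \<in> convex hull (pts s) \<Longrightarrow> \<exists>k\<in>N. norm (x - k) < \<epsilon> / 6"
      using convex_hull_finite_net[of "pts s" "\<epsilon> / 6"] I \<epsilon> by (auto simp: I_def)
    obtain b \<rho> where b: "0 < \<rho>" "cball b \<rho> \<subseteq> cball (ctr s) (rad s)"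
      "\<And>v y k. v \<in> cball b \<rho> \<Longrightarrow> y \<in> face C v \<Longrightarrow> k \<in> N \<Longrightarrow> \<epsilon> / 3 < norm (y - k)"
      using avoid[OF N(1), of "rad s" "ctr s"] I unfolding I_def by blast
    obtain c where c: "c \<in> face C b" using face_nonempty[OF C] by blast
    define s' where "s' = (b, min \<rho> (rad s / 2), insert c (pts s))"
    have sub: "cball (ctr s') (rad s') \<subseteq> cball b \<rho>" by (auto simp: s'_def sel)
    have "\<epsilon> / 6 < norm (y - x)" if vv: "v \<in> cball (ctr s') (rad s')" and yy: "y \<in> face C v" and xx: "x \<in> convex hull (pts s)" for v y x
    proof -
      obtain k where k: "k \<in> N" "norm (x - k) < \<epsilon> / 6" using N(2)[OF xx] by blast
      have "\<epsilon> / 3 < norm (y - k)" using b(3)[OF _ yy k(1)] sub vv by blast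
      moreover have "norm (y - k) \<le> norm (y - x) + norm (x - k)"
        using norm_triangle_ineq[of "y - x" "x - k"] by simp
      ultimately show ?thesis using k(2) by linarith
    qed
    moreover have "0 < rad s'" "finite (pts s')" "pts s' \<noteq> {}" "rad s' \<le> rad s / 2" "ctr s' = b" "pts s' = insert c (pts s)"
      using b(1) I by (auto simp: s'_def sel I_def)
    moreover have "cball (ctr s') (rad s') \<subseteq> cball a0 r0" using sub b(2) I by (auto simp: I_def)
    ultimately show ?thesis using c sub b(2) unfolding I_def S_def by (intro exI[of _ s']) auto
  qed
  obtain c0 where c0: "c0 \<in> C" using cwkD(1)[OF C] by blast
  obtain f v where f0: "f 0 = (a0, r0, {c0})" and fS: "\<And>n. S n (f n) (f (Suc n))"
    and v: "\<And>n. v \<in> cball (ctr (f n)) (rad (f n))" and lim: "(\<lambda>n. rad (f n)) \<longlonglongrightarrow> 0"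
  proof (rule nested_cballs[of I "(a0, r0, {c0})" rad S ctr])
    show "I (a0, r0, {c0})" using r0 by (simp add: I_def sel)
  qed (use step in \<open>auto simp: I_def\<close>)
  have "\<forall>n. \<exists>c. c \<in> face C (ctr (f (Suc n))) \<and> pts (f (Suc n)) = insert c (pts (f n))"
    using fS unfolding S_def by blast
  then obtain p where p: "\<And>n. p n \<in> face C (ctr (f (Suc n)))" "\<And>n. pts (f (Suc n)) = insert (p n) (pts (f n))"
    by metis
  have pC: "p n \<in> C" for n using p(1)[of n] by (simp add: face_def)
  obtain c where c: "c \<in> C"
    "\<And>(g :: 'a \<Rightarrow>\<^sub>L real) a N. (\<And>n. N \<le> n \<Longrightarrow> blinfun_apply g (p n) \<le> a) \<Longrightarrow> blinfun_apply g c \<le> a"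
    using cwk_cluster_point[OF C, of p, OF pC] by blast
  \<comment> \<open>\<open>p n\<close> maximises the centre of its stage, and eventually that centre
    differs from \<open>v\<close> by at most \<open>\<delta> / 2\<close> on \<open>C\<close>. So
    \<open>v\<close> at \<open>p n\<close> is at least its value at \<open>d\<close> minus
    \<open>\<delta>\<close>, a half-space condition that passes to the cluster point.\<close>
  have "blinfun_apply v d \<le> blinfun_apply v c" if d: "d \<in> C" for d
  proof (rule field_le_epsilon)
    fix \<delta> :: real assume "0 < \<delta>"
    then have "\<forall>\<^sub>F n in sequentially. rad (f n) < \<delta> / (2 * M)"
      using M(1) by (intro order_tendstoD(2)[OF lim]) auto
    then obtain N where N: "\<And>n. N \<le> n \<Longrightarrow> rad (f n) < \<delta> / (2 * M)" by (auto simp: eventually_sequentially)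
    have "blinfun_apply (- v) (p n) \<le> - blinfun_apply v d + \<delta>" if "N \<le> n" for n
    proof -
      let ?a = "ctr (f (Suc n))"
      have close: "\<bar>blinfun_apply v x - blinfun_apply ?a x\<bar> \<le> \<delta> / 2" if "x \<in> C" for x
      proof -
        have "norm (v - ?a) \<le> \<delta> / (2 * M)"
          using v[of "Suc n"] N[of "Suc n"] \<open>N \<le> n\<close> by (simp add: dist_norm norm_minus_commute)
        then have "norm (v - ?a) * norm x \<le> \<delta> / (2 * M) * M"
          using M(2)[OF that] \<open>0 < \<delta>\<close> M(1) by (intro mult_mono) auto
        then show ?thesis using norm_blinfun[of "v - ?a" x] M(1) by (simp add: blinfun.diff_left)
      qed
      have "blinfun_apply ?a d \<le> blinfun_apply ?a (p n)" using p(1)[of n] d by (simp add: face_iff[OF C])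
      then show ?thesis using close[OF d] close[OF pC[of n]] unfolding blinfun.minus_left by linarith
    qed
    then have "blinfun_apply (- v) c \<le> - blinfun_apply v d + \<delta>" by (rule c(2))
    then show "blinfun_apply v d \<le> blinfun_apply v c + \<delta>" by (simp add: blinfun.minus_left)
  qed
  then have cv: "c \<in> face C v" using c(1) by (simp add: face_iff[OF C])
  \<comment> \<open>\<open>c\<close> lies in every closed half-space containing all chosen points,
    so some hull of finitely many of them comes within \<open>\<epsilon> / 6\<close>; as a face
    point of \<open>v\<close> it is farther away.\<close>
  obtain n x where "x \<in> convex hull (pts (f n))" "norm (c - x) < \<epsilon> / 6"
  proof (rule mazur_increasing_hulls[of "\<lambda>n. pts (f n)" c "\<epsilon> / 6"])
    show "pts (f n) \<subseteq> pts (f (Suc n))" for n using p(2) by auto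
    show "pts (f 0) \<noteq> {}" by (simp add: f0 sel)
    fix g :: "'a \<Rightarrow>\<^sub>L real" and a assume "\<And>n x. x \<in> pts (f n) \<Longrightarrow> blinfun_apply g x \<le> a"
    then show "blinfun_apply g c \<le> a" using p(2) by (intro c(2)[of 0]) auto
  qed (use \<epsilon> in auto)
  moreover have "\<epsilon> / 6 < norm (c - x)" if "x \<in> convex hull (pts (f n))" for n x
    using fS[of n] v[of "Suc n"] cv that unfolding S_def by blast
  ultimately show False by fastforce
qed

text \<open>In the spirit of Smulian's criterion, faces shrinking near \<open>v\<close> give strong
  exposure. If \<open>v\<close> is nearly maximal at \<open>c\<close>, tilt it by
  \<open>r *\<^sub>R h\<close> with \<open>h\<close> norming \<open>c - x\<close>: a face point
  \<open>y\<close> of the tilted functional is close to \<open>x\<close>, and its maximality against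
  \<open>c\<close> bounds \<open>norm (c - x)\<close>.\<close>

theorem cwk_strongly_exposed_point:
  fixes C :: "'a::banach set"
  assumes C: "C \<in> cwk"
  obtains v x where "x \<in> C"
    "\<And>\<epsilon>. 0 < \<epsilon> \<Longrightarrow> \<exists>\<beta>>0. \<forall>c\<in>C. support_fun v C - \<beta> < blinfun_apply v c \<longrightarrow> norm (c - x) \<le> \<epsilon>"
proof -
  \<comment> \<open>Smallness is required on the ball of twice the radius, so that functionals
    within the radius of the limit \<open>v\<close> are still covered.\<close>
  define S where "S n s s' \<longleftrightarrow> (\<forall>v\<in>cball (fst s') (2 * snd s'). \<forall>w\<in>cball (fst s') (2 * snd s').
      \<forall>c\<in>face C v. \<forall>d\<in>face C w. norm (c - d) \<le> 1 / real (Suc n))"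
    for n and s s' :: "('a \<Rightarrow>\<^sub>L real) \<times> real"
  have step: "\<exists>s'. 0 < snd s' \<and> S n s s' \<and> cball (fst s') (snd s') \<subseteq> cball (fst s) (snd s) \<and> snd s' \<le> snd s / 2"
    if s: "0 < snd s" for n and s :: "('a \<Rightarrow>\<^sub>L real) \<times> real"
  proof -
    obtain b \<rho> where b: "0 < \<rho>" "cball b \<rho> \<subseteq> cball (fst s) (snd s)"
      "\<forall>v\<in>cball b \<rho>. \<forall>w\<in>cball b \<rho>. \<forall>c\<in>face C v. \<forall>d\<in>face C w. norm (c - d) \<le> 1 / real (Suc n)"
      using face_diameter_small[OF C s, of "1 / real (Suc n)" "fst s"] by auto
    define r where "r = min (\<rho> / 2) (snd s / 2)"
    have r: "0 < r" "2 * r \<le> \<rho>" "r \<le> snd s / 2" using b(1) s by (auto simp: r_def)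
    have sub: "cball b r \<subseteq> cball b \<rho>" and "cball b (2 * r) \<subseteq> cball b \<rho>" using r by auto
    have "S n s (b, r)" unfolding S_def fst_conv snd_conv
      using b(3) \<open>cball b (2 * r) \<subseteq> cball b \<rho>\<close> by (meson subsetD)
    moreover have "cball b r \<subseteq> cball (fst s) (snd s)" using sub b(2) by (rule order_trans)
    ultimately show ?thesis using r by (intro exI[of _ "(b, r)"]) simp
  qed
  obtain f v where fI: "\<And>n. 0 < snd (f n)" and fS: "\<And>n. S n (f n) (f (Suc n))"
    and v: "\<And>n. v \<in> cball (fst (f n)) (snd (f n))"
  proof (rule nested_cballs[of "\<lambda>s. 0 < snd s" "(0, 1)" snd S fst])
    show "0 < snd (0 :: 'a \<Rightarrow>\<^sub>L real, 1 :: real)" by simp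
  qed (use step in blast)+
  obtain x where x: "x \<in> face C v" using face_nonempty[OF C] by blast
  have "\<exists>\<beta>>0. \<forall>c\<in>C. support_fun v C - \<beta> < blinfun_apply v c \<longrightarrow> norm (c - x) \<le> \<epsilon>"
    if \<epsilon>: "0 < \<epsilon>" for \<epsilon>
  proof -
    obtain n where n: "1 / real (Suc n) < \<epsilon> / 2" using \<epsilon> nat_approx_posE[of "\<epsilon> / 2"] by auto
    define r where "r = snd (f (Suc n))"
    have r: "0 < r" using fI by (simp add: r_def)
    have near: "norm (c - d) \<le> \<epsilon> / 2" if "dist v w \<le> r" "c \<in> face C v" "d \<in> face C w" for w c d
    proof -
      have vd: "dist (fst (f (Suc n))) v \<le> r" using v[of "Suc n"] by (simp add: r_def)
      then have "w \<in> cball (fst (f (Suc n))) (2 * r)" "v \<in> cball (fst (f (Suc n))) (2 * r)"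
        using dist_triangle[of "fst (f (Suc n))" w v] that(1) r by auto
      then have "norm (c - d) \<le> 1 / real (Suc n)"
        using fS[of n] that(2,3) unfolding S_def r_def by blast
      with n show ?thesis by simp
    qed
    have "norm (c - x) \<le> \<epsilon>" if c: "c \<in> C" "support_fun v C - r * \<epsilon> / 2 < blinfun_apply v c" for c
    proof -
      obtain h :: "'a \<Rightarrow>\<^sub>L real" where h: "norm h \<le> 1" "blinfun_apply h (c - x) = norm (c - x)"
        by (rule norming_functional)
      define w where "w = v + r *\<^sub>R h"
      obtain y where y: "y \<in> face C w" using face_nonempty[OF C] by blast
      have yC: "y \<in> C" using y by (simp add: face_def)
      have "dist v w \<le> r" using h(1) r by (simp add: w_def dist_norm mult_left_le)
      then have xy: "norm (x - y) \<le> \<epsilon> / 2" using near x y by blast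
      have "blinfun_apply w c \<le> blinfun_apply w y" using y c(1) by (simp add: face_iff[OF C])
      moreover have "blinfun_apply v y \<le> support_fun v C" by (rule support_fun_upper[OF C yC])
      ultimately have "r * blinfun_apply h c \<le> r * \<epsilon> / 2 + r * blinfun_apply h y"
        using c(2) by (simp add: w_def blinfun.add_left blinfun.scaleR_left)
      then have "r * blinfun_apply h c \<le> r * (\<epsilon> / 2 + blinfun_apply h y)" by (simp add: distrib_left)
      then have "blinfun_apply h c \<le> \<epsilon> / 2 + blinfun_apply h y" using r by (simp only: mult_le_cancel_left_pos)
      then have "norm (c - x) \<le> \<epsilon> / 2 + blinfun_apply h (y - x)"
        using h(2) by (simp add: blinfun.diff_right)
      moreover have "blinfun_apply h (y - x) \<le> norm (x - y)"
        using blinfun_apply_le_norm[OF h(1), of "y - x"] by (simp add: norm_minus_commute)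
      ultimately show ?thesis using xy by linarith
    qed
    then show ?thesis using r \<epsilon> by (intro exI[of _ "r * \<epsilon> / 2"]) auto
  qed
  moreover have "x \<in> C" using x by (simp add: face_def)
  ultimately show ?thesis using that[of x v] by blast
qed

section \<open>The Orlicz-Pettis theorem\<close>

text \<open>Including or omitting one large term \<open>w m\<close> gives two partial sums at least
  \<open>\<epsilon>\<close> apart, one of which is at least \<open>\<epsilon> / 2\<close> from
  \<open>k\<close>. The functional norming its difference to \<open>k\<close> has an absolutely
  convergent series, so once membership below \<open>N'\<close> is fixed, later choices change its
  value by less than \<open>\<epsilon> / 4\<close>.\<close>

lemma subseries_avoid_point:
  fixes w :: "nat \<Rightarrow> 'a::banach"
  assumes u: "\<And>S (f :: 'a \<Rightarrow>\<^sub>L real). summable (\<lambda>k. \<bar>blinfun_apply f (w k)\<bar>) \<and>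
      blinfun_apply f (u S) = (\<Sum>k. if k \<in> S then blinfun_apply f (w k) else 0)"
    and inf: "\<exists>m\<ge>N. \<epsilon> \<le> norm (w m)" and \<epsilon>: "0 < \<epsilon>" and F: "F \<subseteq> {..<N}"
  shows "\<exists>N' F'. N < N' \<and> F' \<subseteq> {..<N'} \<and> F' \<inter> {..<N} = F \<and>
    (\<forall>S. S \<inter> {..<N'} = F' \<longrightarrow> \<epsilon> / 4 \<le> norm (u S - k))"
proof -
  obtain m where m: "N \<le> m" "\<epsilon> \<le> norm (w m)" using inf by blast
  have "finite F" using F finite_subset by blast
  have mF: "m \<notin> F" using F m by auto
  have "(\<Sum>j\<in>insert m F. w j) - k - ((\<Sum>j\<in>F. w j) - k) = w m" using \<open>finite F\<close> mF by simp
  then have "norm (w m) \<le> norm ((\<Sum>j\<in>insert m F. w j) - k) + norm ((\<Sum>j\<in>F. w j) - k)"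
    by (metis norm_triangle_ineq4)
  then have "\<epsilon> / 2 \<le> norm ((\<Sum>j\<in>insert m F. w j) - k) \<or> \<epsilon> / 2 \<le> norm ((\<Sum>j\<in>F. w j) - k)"
    using m(2) by linarith
  then obtain G where G: "G = insert m F \<or> G = F" "\<epsilon> / 2 \<le> norm ((\<Sum>j\<in>G. w j) - k)" by blast
  have fG: "finite G" "G \<inter> {..<N} = F" "G \<subseteq> {..<Suc m}" using G(1) F m(1) \<open>finite F\<close> by auto
  obtain h :: "'a \<Rightarrow>\<^sub>L real" where h: "norm h \<le> 1" "blinfun_apply h ((\<Sum>j\<in>G. w j) - k) = norm ((\<Sum>j\<in>G. w j) - k)"
    by (rule norming_functional)
  have summ: "summable (\<lambda>k. \<bar>blinfun_apply h (w k)\<bar>)" using u by blast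
  obtain N0 where N0: "\<And>n. N0 \<le> n \<Longrightarrow> norm (\<Sum>i. \<bar>blinfun_apply h (w (i + n))\<bar>) < \<epsilon> / 4"
    using suminf_exist_split[OF _ summ, of "\<epsilon> / 4"] \<epsilon> by auto
  define N' where "N' = max N0 (Suc m)"
  have N': "N < N'" "G \<subseteq> {..<N'}" "N0 \<le> N'" using m(1) fG(3) by (auto simp: N'_def)
  have "\<epsilon> / 4 \<le> norm (u S - k)" if S: "S \<inter> {..<N'} = G" for S
  proof -
    define a where "a j = (if j \<in> S then blinfun_apply h (w j) else 0)" for j
    have sa: "summable a" 
      by (rule summable_comparison_test'[OF summ, of 0]) (simp add: a_def)
    have "blinfun_apply h (u S) = (\<Sum>j. a (j + N')) + (\<Sum>j<N'. a j)"
    proof -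
      have "a = (\<lambda>k. if k \<in> S then blinfun_apply h (w k) else 0)" by (rule ext) (simp add: a_def)
      then have "blinfun_apply h (u S) = suminf a" using u[of h S] by (simp only:)
      then show ?thesis using suminf_split_initial_segment[OF sa, of N'] by (simp only:)
    qed
    moreover have "(\<Sum>j<N'. a j) = (\<Sum>j\<in>G. blinfun_apply h (w j))"
      unfolding a_def S[symmetric] by (subst sum.inter_restrict[symmetric]) (auto simp: Int_commute)
    moreover have "\<bar>\<Sum>j. a (j + N')\<bar> \<le> (\<Sum>j. \<bar>blinfun_apply h (w (j + N'))\<bar>)"
    proof -
      have s1: "summable (\<lambda>j. \<bar>blinfun_apply h (w (j + N'))\<bar>)" using summable_ignore_initial_segment[OF summ, of N'] .
      have s2: "summable (\<lambda>j. \<bar>a (j + N')\<bar>)"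
        by (rule summable_comparison_test'[OF s1, of 0]) (simp add: a_def)
      have "\<bar>\<Sum>j. a (j + N')\<bar> \<le> (\<Sum>j. \<bar>a (j + N')\<bar>)" by (rule summable_rabs[OF s2])
      also have "\<dots> \<le> (\<Sum>j. \<bar>blinfun_apply h (w (j + N'))\<bar>)"
        by (rule suminf_le[OF _ s2 s1]) (simp add: a_def)
      finally show ?thesis .
    qed
    ultimately have "\<bar>blinfun_apply h (u S) - (\<Sum>j\<in>G. blinfun_apply h (w j))\<bar> < \<epsilon> / 4"
      using N0[OF N'(3)] by simp
    moreover have "blinfun_apply h (u S - k) = blinfun_apply h (u S) - (\<Sum>j\<in>G. blinfun_apply h (w j))
        + norm ((\<Sum>j\<in>G. w j) - k)"
      using h(2) by (simp add: blinfun.diff_right blinfun.sum_right)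
    ultimately have "\<epsilon> / 4 \<le> blinfun_apply h (u S - k)" using G(2) by linarith
    then show ?thesis using blinfun_apply_le_norm[OF h(1), of "u S - k"] by linarith
  qed
  then show ?thesis using N' fG by blast
qed

\<comment> \<open>The argument is the one of \<open>face_diameter_small\<close>: a subset \<open>S\<close> is built in blocks so
  that the sum over \<open>S\<close> stays away from the convex hulls of its own partial sums.\<close>
theorem orlicz_pettis:
  fixes w :: "nat \<Rightarrow> 'a::banach"
  assumes sub: "\<And>S. \<exists>u. \<forall>f :: 'a \<Rightarrow>\<^sub>L real. summable (\<lambda>k. \<bar>blinfun_apply f (w k)\<bar>) \<and>
      blinfun_apply f u = (\<Sum>k. if k \<in> S then blinfun_apply f (w k) else 0)"
  shows "w \<longlonglongrightarrow> 0"
proof (rule ccontr)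
  assume "\<not> w \<longlonglongrightarrow> 0"
  then obtain \<epsilon> where \<epsilon>: "0 < \<epsilon>" "\<And>N. \<exists>m\<ge>N. \<epsilon> \<le> norm (w m)"
    by (auto simp: LIMSEQ_iff not_less)
  obtain u where u: "\<And>S (f :: 'a \<Rightarrow>\<^sub>L real). summable (\<lambda>k. \<bar>blinfun_apply f (w k)\<bar>) \<and>
      blinfun_apply f (u S) = (\<Sum>k. if k \<in> S then blinfun_apply f (w k) else 0)"
    using sub by metis
  \<comment> \<open>Avoidance of one point is iterated over a finite set; earlier guarantees persist
    because they depend only on an initial segment of \<open>S\<close>.\<close>
  have avoid: "\<exists>N' F'. N < N' \<and> F' \<subseteq> {..<N'} \<and> F' \<inter> {..<N} = F \<and>
      (\<forall>S. S \<inter> {..<N'} = F' \<longrightarrow> (\<forall>k\<in>K. \<epsilon> / 4 \<le> norm (u S - k)))"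
    if fin: "finite K" and F: "F \<subseteq> {..<N}" for K N F
    using fin
  proof (induction K)
    case empty
    have "F \<subseteq> {..<Suc N}" "F \<inter> {..<N} = F" using F by auto
    then show ?case by blast
  next
    case (insert k K)
    then obtain N1 F1 where 1: "N < N1" "F1 \<subseteq> {..<N1}" "F1 \<inter> {..<N} = F"
      "\<And>S k. S \<inter> {..<N1} = F1 \<Longrightarrow> k \<in> K \<Longrightarrow> \<epsilon> / 4 \<le> norm (u S - k)" by blast
    obtain N2 F2 where 2: "N1 < N2" "F2 \<subseteq> {..<N2}" "F2 \<inter> {..<N1} = F1"
      "\<And>S. S \<inter> {..<N2} = F2 \<Longrightarrow> \<epsilon> / 4 \<le> norm (u S - k)"
      using subseries_avoid_point[OF u \<epsilon>(2) \<epsilon>(1) 1(2), of k] by blast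
    show ?case
    proof (intro exI conjI allI impI ballI)
      show "N < N2" using 1 2 by simp
      show "F2 \<subseteq> {..<N2}" by fact
      have sub: "{..<N} = {..<N1} \<inter> {..<N}" "{..<N1} = {..<N2} \<inter> {..<N1}" using 1(1) 2(1) by auto
      show "F2 \<inter> {..<N} = F" using 1(3) 2(3) sub by (metis inf_assoc)
      fix S k' assume S: "S \<inter> {..<N2} = F2" and k': "k' \<in> insert k K"
      have "S \<inter> {..<N1} = F1" using S 2(3) sub by (metis inf_assoc)
      then show "\<epsilon> / 4 \<le> norm (u S - k')" using k' 1(4) 2(4)[OF S] by auto
    qed
  qed
  \<comment> \<open>All partial sums over subsets of \<open>{..<N}\<close> are avoided, not just
    those of the set under construction, so the hull is known as soon as \<open>N\<close>
    is.\<close>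
  define P where "P N = (\<lambda>G. \<Sum>j\<in>G. w j) ` Pow {..<N}" for N :: nat
  define R where "R s s' \<longleftrightarrow> fst s < fst s' \<and> snd s' \<inter> {..<fst s} = snd s \<and>
      (\<forall>S. S \<inter> {..<fst s'} = snd s' \<longrightarrow> (\<forall>x\<in>convex hull (P (fst s)). \<epsilon> / 8 \<le> norm (u S - x)))"
    for s s' :: "nat \<times> nat set"
  have step: "\<exists>s'. snd s' \<subseteq> {..<fst s'} \<and> R s s'" if s: "snd s \<subseteq> {..<fst s}" for s :: "nat \<times> nat set"
  proof -
    have "finite (P (fst s))" by (simp add: P_def)
    then obtain K where K: "finite K" "\<And>x. x \<in> convex hull (P (fst s)) \<Longrightarrow> \<exists>k\<in>K. norm (x - k) < \<epsilon> / 8"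
      using convex_hull_finite_net[of "P (fst s)" "\<epsilon> / 8"] \<epsilon>(1) by auto
    from avoid[OF K(1) s] obtain N' F' where N': "fst s < N'" "F' \<subseteq> {..<N'}" "F' \<inter> {..<fst s} = snd s"
      and far: "\<forall>S. S \<inter> {..<N'} = F' \<longrightarrow> (\<forall>k\<in>K. \<epsilon> / 4 \<le> norm (u S - k))"
      by (elim exE conjE) (rule that)
    have "\<epsilon> / 8 \<le> norm (u S - x)" if S: "S \<inter> {..<N'} = F'" and x: "x \<in> convex hull (P (fst s))" for S x
    proof -
      obtain k where k: "k \<in> K" "norm (x - k) < \<epsilon> / 8" using K(2)[OF x] by blast
      have "\<epsilon> / 4 \<le> norm (u S - k)" using far S k(1) by blast
      then show ?thesis using k(2) norm_triangle_ineq[of "u S - x" "x - k"] by simp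
    qed
    then show ?thesis using N' by (intro exI[of _ "(N', F')"]) (simp add: R_def)
  qed
  have "\<exists>s. \<forall>n. snd (s n) \<subseteq> {..<fst (s n)} \<and> R (s n) (s (Suc n))"
    by (rule dependent_nat_choice[of "\<lambda>_ s. snd s \<subseteq> {..<fst s}" "\<lambda>_. R"])
      (use step in \<open>auto intro!: exI[of _ 0] exI[of _ "{}"]\<close>)
  then obtain s where s: "\<And>n. snd (s n) \<subseteq> {..<fst (s n)}" "\<And>n. R (s n) (s (Suc n))" by blast
  define S where "S = (\<Union>n. snd (s n))"
  have less: "fst (s n) < fst (s (Suc n))" for n using s(2)[of n] by (simp add: R_def)
  have ge: "n \<le> fst (s n)" for n using less by (intro strict_mono_imp_increasing) (simp add: strict_mono_Suc_iff)
  have coh: "snd (s (n + k)) \<inter> {..<fst (s n)} = snd (s n)" for n k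
  proof (induction k)
    case 0
    then show ?case using s(1)[of n] by auto
  next
    case (Suc k)
    have "fst (s n) \<le> fst (s (n + k))"
      using lift_Suc_mono_le[of "\<lambda>n. fst (s n)" n "n + k"] less by (simp add: less_imp_le)
    then have "{..<fst (s n)} = {..<fst (s (n + k))} \<inter> {..<fst (s n)}" by auto
    moreover have "snd (s (Suc (n + k))) \<inter> {..<fst (s (n + k))} = snd (s (n + k))"
      using s(2)[of "n + k"] by (simp add: R_def)
    ultimately show ?case using Suc by (metis add_Suc_right inf_assoc)
  qed
  \<comment> \<open>By coherence \<open>S\<close> has the prescribed trace on each initial segment
    and inherits every guarantee recorded in \<open>R\<close>.\<close>
  have SF: "S \<inter> {..<fst (s n)} = snd (s n)" for n
  proof
    show "snd (s n) \<subseteq> S \<inter> {..<fst (s n)}" using s(1)[of n] by (auto simp: S_def)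
    show "S \<inter> {..<fst (s n)} \<subseteq> snd (s n)"
    proof
      fix x assume "x \<in> S \<inter> {..<fst (s n)}"
      then obtain m where m: "x \<in> snd (s m)" "x < fst (s n)" by (auto simp: S_def)
      then have "x \<in> snd (s (n + m))" using coh[of m n] by (auto simp: add.commute)
      then show "x \<in> snd (s n)" using coh[of n m] m(2) by auto
    qed
  qed
  obtain n x where "x \<in> convex hull (P (fst (s n)))" "norm (u S - x) < \<epsilon> / 8"
  proof (rule mazur_increasing_hulls[of "\<lambda>n. P (fst (s n))" "u S" "\<epsilon> / 8"])
    have "{..<fst (s n)} \<subseteq> {..<fst (s (Suc n))}" for n using less[of n] by auto
    then show "P (fst (s n)) \<subseteq> P (fst (s (Suc n)))" for n unfolding P_def by (intro image_mono Pow_mono)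
    show "P (fst (s 0)) \<noteq> {}" by (auto simp: P_def)
    fix f :: "'a \<Rightarrow>\<^sub>L real" and a assume le: "\<And>n x. x \<in> P (fst (s n)) \<Longrightarrow> blinfun_apply f x \<le> a"
    \<comment> \<open>A half-space containing all finite partial sums contains \<open>u S\<close>,
      since the scalar partial sums along \<open>S\<close> converge to the value there.\<close>
    have "summable (\<lambda>k. \<bar>blinfun_apply f (w k)\<bar>)" using u by blast
    then have "summable (\<lambda>k. if k \<in> S then blinfun_apply f (w k) else 0)"
      by (rule summable_comparison_test'[where N = 0]) simp
    then have "(\<lambda>n. \<Sum>k<n. if k \<in> S then blinfun_apply f (w k) else 0) \<longlonglongrightarrow> blinfun_apply f (u S)"
      using conjunct2[OF u[of f S]] by (simp only: summable_LIMSEQ)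
    moreover have "(\<Sum>k<n. if k \<in> S then blinfun_apply f (w k) else 0) \<le> a" for n
    proof -
      have "(\<Sum>k<n. if k \<in> S then blinfun_apply f (w k) else 0) = blinfun_apply f (\<Sum>k\<in>{..<n} \<inter> S. w k)"
        by (subst blinfun.sum_right) (simp only: sum.inter_restrict[OF finite_lessThan])
      also have "\<dots> \<le> a"
        using ge[of n] by (intro le[of _ n]) (auto simp: P_def)
      finally show ?thesis .
    qed
    ultimately show "blinfun_apply f (u S) \<le> a" by (intro LIMSEQ_le_const2) auto
  qed (use \<epsilon> in auto)
  moreover have "\<epsilon> / 8 \<le> norm (u S - x)" if "x \<in> convex hull (P (fst (s n)))" for n x
    using s(2)[of n] SF[of "Suc n"] that unfolding R_def by blast
  ultimately show False by fastforce
qed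

section \<open>Henstock and McShane sums\<close>

abbreviation len :: "real set \<Rightarrow> real" where "len \<equiv> measure lborel"

text \<open>Indexed rather than a set of pairs, so that tags or intervals can be replaced without
  merging members; the intervals need not cover \<open>{0..1}\<close>.\<close>

definition free_family :: "'i set \<Rightarrow> ('i \<Rightarrow> real) \<Rightarrow> ('i \<Rightarrow> real set) \<Rightarrow> bool" where
  "free_family A t I \<longleftrightarrow> finite A \<and>
    (\<forall>j\<in>A. t j \<in> {0..1} \<and> I j \<subseteq> {0..1} \<and> (\<exists>a b. a \<le> b \<and> I j = {a..b})) \<and>
    (\<forall>i\<in>A. \<forall>j\<in>A. i \<noteq> j \<longrightarrow> interior (I i) \<inter> interior (I j) = {})"

definition fine_family :: "(real \<Rightarrow> real) \<Rightarrow> 'i set \<Rightarrow> ('i \<Rightarrow> real) \<Rightarrow> ('i \<Rightarrow> real set) \<Rightarrow> bool" where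
  "fine_family \<delta> A t I \<longleftrightarrow> (\<forall>j\<in>A. I j \<subseteq> {t j - \<delta> (t j) <..< t j + \<delta> (t j)})"

lemma free_familyD:
  assumes "free_family A t I"
  shows "finite A" "\<And>j. j \<in> A \<Longrightarrow> t j \<in> {0..1}" "\<And>j. j \<in> A \<Longrightarrow> I j \<subseteq> {0..1}"
    "\<And>j. j \<in> A \<Longrightarrow> \<exists>a b. a \<le> b \<and> I j = {a..b}"
    "\<And>i j. i \<in> A \<Longrightarrow> j \<in> A \<Longrightarrow> i \<noteq> j \<Longrightarrow> interior (I i) \<inter> interior (I j) = {}"
  using assms unfolding free_family_def by blast+

lemma free_familyI:
  assumes "finite A" "\<And>j. j \<in> A \<Longrightarrow> t j \<in> {0..1}" "\<And>j. j \<in> A \<Longrightarrow> I j \<subseteq> {0..1}"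
    "\<And>j. j \<in> A \<Longrightarrow> \<exists>a b. a \<le> b \<and> I j = {a..b}"
    "\<And>i j. i \<in> A \<Longrightarrow> j \<in> A \<Longrightarrow> i \<noteq> j \<Longrightarrow> interior (I i) \<inter> interior (I j) = {}"
  shows "free_family A t I"
  unfolding free_family_def by (intro conjI ballI impI assms)

lemma free_family_subset:
  assumes "free_family A t I" "B \<subseteq> A"
  shows "free_family B t I"
proof (rule free_familyI)
  note F = free_familyD[OF assms(1)]
  show "finite B" using assms(2) F(1) by (rule finite_subset)
  fix j assume "j \<in> B"
  then have j: "j \<in> A" using assms(2) by blast
  show "t j \<in> {0..1}" "I j \<subseteq> {0..1}" "\<exists>a b. a \<le> b \<and> I j = {a..b}" by (rule F(2-4)[OF j])+
  fix i assume "i \<in> B" "i \<noteq> j"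
  then show "interior (I i) \<inter> interior (I j) = {}" using F(5) j assms(2) by blast
qed

lemma free_partitionD:
  assumes "free_partition p"
  shows "finite p" "\<And>j. j \<in> p \<Longrightarrow> fst j \<in> {0..1}" "\<And>j. j \<in> p \<Longrightarrow> \<exists>a b. a \<le> b \<and> snd j = {a..b}"
    "\<And>i j. i \<in> p \<Longrightarrow> j \<in> p \<Longrightarrow> i \<noteq> j \<Longrightarrow> interior (snd i) \<inter> interior (snd j) = {}"
    "\<Union>(snd ` p) = {0..1}"
proof -
  have P': "finite p \<and> (\<forall>j\<in>p. fst j \<in> {0..1} \<and> (\<exists>a b. a \<le> b \<and> snd j = {a..b})) \<and>
      (\<forall>i\<in>p. \<forall>j\<in>p. i \<noteq> j \<longrightarrow> interior (snd i) \<inter> interior (snd j) = {}) \<and> \<Union>(snd ` p) = {0..1}"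
    using assms unfolding free_partition_def case_prod_unfold prod.collapse .
  note P = P'[THEN conjunct1] P'[THEN conjunct2, THEN conjunct1]
    P'[THEN conjunct2, THEN conjunct2, THEN conjunct1] P'[THEN conjunct2, THEN conjunct2, THEN conjunct2]
  show "finite p" by (rule P(1))
  show "fst j \<in> {0..1}" "\<exists>a b. a \<le> b \<and> snd j = {a..b}" if "j \<in> p" for j
    using bspec[OF P(2) that] by (rule conjunct1, rule conjunct2)
  show "interior (snd i) \<inter> interior (snd j) = {}" if "i \<in> p" "j \<in> p" "i \<noteq> j" for i j
    using bspec[OF bspec[OF P(3) that(1)] that(2)] that(3) by (rule mp)
  show "\<Union>(snd ` p) = {0..1}" by (rule P(4))
qed

lemma free_partition_family:
  assumes "free_partition p"
  shows "free_family p fst snd"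
proof (rule free_familyI)
  note F = free_partitionD[OF assms]
  show "finite p" by (rule F(1))
  fix j assume j: "j \<in> p"
  show "fst j \<in> {0..1}" "\<exists>a b. a \<le> b \<and> snd j = {a..b}" by (rule F(2,3)[OF j])+
  have "snd j \<subseteq> \<Union>(snd ` p)" using j by blast
  then show "snd j \<subseteq> {0..1}" unfolding F(5) .
  fix i assume "i \<in> p" "i \<noteq> j"
  then show "interior (snd i) \<inter> interior (snd j) = {}" using F(4) j by blast
qed

lemma delta_fine_family: "delta_fine \<delta> p \<Longrightarrow> fine_family \<delta> p fst snd"
  unfolding delta_fine_def fine_def fine_family_def case_prod_unfold by blast

lemma interval_interior_empty:
  fixes h :: "real \<Rightarrow> 'b::banach"
  assumes "interior {a..b::real} = {}"
  shows "len {a..b} = 0" "integral {a..b} h = 0"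
proof -
  show c: "len {a..b} = 0" using assms content_eq_0_interior[of a b] by (simp add: cbox_interval)
  show "integral {a..b} h = 0" using integral_null[of a b h] c by (simp add: cbox_interval)
qed

text \<open>Distinct indices have intervals with disjoint interiors, so a repeated interval is
  degenerate and contributes nothing. This justifies passing from indexed families to sets of
  intervals or pairs.\<close>

lemma free_family_same_interval:
  fixes h :: "real \<Rightarrow> 'b::banach"
  assumes "free_family A t I" "i \<in> A" "j \<in> A" "i \<noteq> j" "I i = I j"
  shows "len (I i) = 0" "integral (I i) h = 0"
proof -
  have "interior (I i) = {}" using free_familyD(5)[OF assms(1-4)] assms(5) by simp
  then show "len (I i) = 0" "integral (I i) h = 0"
    using free_familyD(4)[OF assms(1,2)] interval_interior_empty by metis+
qed

lemma free_family_division: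
  assumes "free_family A t I"
  shows "I ` A division_of \<Union>(I ` A)"
proof (rule division_ofI)
  show "finite (I ` A)" using free_familyD(1)[OF assms] by simp
  fix K assume "K \<in> I ` A"
  then obtain j where j: "j \<in> A" "K = I j" by blast
  then show "K \<subseteq> \<Union>(I ` A)" by blast
  show "K \<noteq> {}" "\<exists>a b. K = cbox a b" using free_familyD(4)[OF assms j(1)] j(2) by fastforce+
  fix L assume "L \<in> I ` A" "K \<noteq> L"
  then show "interior K \<inter> interior L = {}" using free_familyD(5)[OF assms] j by blast
qed simp

lemma sum_free_family_content:
  assumes "free_family A t I"
  shows "(\<Sum>j\<in>A. len (I j)) = sum len (I ` A)"
  using free_family_same_interval(1)[OF assms] free_familyD(1)[OF assms]
  by (subst sum.reindex_nontrivial) auto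

lemma sum_free_family_integral:
  fixes h :: "real \<Rightarrow> 'b::banach"
  assumes "free_family A t I"
  shows "(\<Sum>j\<in>A. integral (I j) h) = (\<Sum>K\<in>I ` A. integral K h)"
  using free_family_same_interval(2)[OF assms] free_familyD(1)[OF assms]
  by (subst sum.reindex_nontrivial) auto

lemma free_family_content_le:
  assumes "free_family A t I" "\<And>j. j \<in> A \<Longrightarrow> I j \<subseteq> {a..b}"
  shows "(\<Sum>j\<in>A. len (I j)) \<le> len {a..b}"
proof -
  have "\<Union>(I ` A) \<subseteq> cbox a b" using assms(2) unfolding cbox_interval by (rule UN_least)
  then show ?thesis
    unfolding sum_free_family_content[OF assms(1)]
    using subadditive_content_division[OF free_family_division[OF assms(1)]] unfolding cbox_interval by blast
qed

lemma free_partition_integral: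
  fixes h :: "real \<Rightarrow> 'b::banach"
  assumes p: "free_partition p" and h: "h integrable_on {0..1}"
  shows "(\<Sum>(t, I)\<in>p. integral I h) = integral {0..1} h"
proof -
  have U: "\<Union>(snd ` p) = {0..1}" by (rule free_partitionD(5)[OF p])
  have "integral {0..1} h = (\<Sum>K\<in>snd ` p. integral K h)"
    using free_family_division[OF free_partition_family[OF p]] U
    by (intro integral_combine_division_topdown[OF h]) simp
  also have "\<dots> = (\<Sum>j\<in>p. integral (snd j) h)"
    by (rule sum_free_family_integral[OF free_partition_family[OF p], symmetric])
  finally show ?thesis by (simp add: case_prod_unfold)
qed

lemma unit_gauge_gauge:
  assumes "unit_gauge \<delta>"
  shows "gauge (\<lambda>t. if t \<in> {0..1} then {t - \<delta> t <..< t + \<delta> t} else UNIV)"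
  using assms by (auto simp: gauge_def unit_gauge_def)

lemma delta_fine_iff_fine:
  assumes "\<And>t I. (t, I) \<in> p \<Longrightarrow> t \<in> {0..1}"
  shows "delta_fine \<delta> p \<longleftrightarrow> (\<lambda>t. if t \<in> {0..1} then {t - \<delta> t <..< t + \<delta> t} else UNIV) fine p"
proof -
  have "(\<lambda>t. {t - \<delta> t <..< t + \<delta> t}) x = (if x \<in> {0..1} then {x - \<delta> x <..< x + \<delta> x} else UNIV)"
    if "(x, K) \<in> p" for x K using assms[OF that] by simp
  then show ?thesis unfolding delta_fine_def fine_def by (intro ball_cong) auto
qed

section \<open>Saks-Henstock lemmas for Perron and for free families\<close>

lemma saks_henstock_family:
  fixes h :: "real \<Rightarrow> real"
  assumes h: "h integrable_on {0..1}" and \<delta>: "unit_gauge \<delta>" and e: "0 < e"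
    and close: "\<And>p. p tagged_division_of {0..1} \<Longrightarrow> delta_fine \<delta> p \<Longrightarrow>
      \<bar>(\<Sum>(t, I)\<in>p. len I * h t) - integral {0..1} h\<bar> < e"
    and fam: "free_family A t I" and fine: "fine_family \<delta> A t I" and tag: "\<And>j. j \<in> A \<Longrightarrow> t j \<in> I j"
  shows "\<bar>\<Sum>j\<in>A. len (I j) * h (t j) - integral (I j) h\<bar> \<le> e"
proof -
  let ?\<gamma> = "\<lambda>t. if t \<in> {0..1} then {t - \<delta> t <..< t + \<delta> t} else UNIV"
  let ?g = "\<lambda>(t, K). len K * h t - integral K h"
  define q where "q = (\<lambda>j. (t j, I j)) ` A"
  note F = free_familyD[OF fam]
  have "(\<Sum>j\<in>A. len (I j) * h (t j) - integral (I j) h) = sum ?g q"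
    unfolding q_def using free_family_same_interval[OF fam] F(1)
    by (subst sum.reindex_nontrivial) auto
  moreover have "norm (\<Sum>(t, K)\<in>q. len K *\<^sub>R h t - integral K h) \<le> e"
  proof (rule Henstock_lemma_part1[of h 0 1 e ?\<gamma>])
    show "h integrable_on cbox 0 1" using h by (simp add: cbox_interval)
    show "gauge ?\<gamma>" by (rule unit_gauge_gauge[OF \<delta>])
    show "q tagged_partial_division_of cbox 0 1"
      unfolding tagged_partial_division_of_def
    proof (intro conjI allI impI)
      show "finite q" using F(1) by (simp add: q_def)
      fix x K assume "(x, K) \<in> q"
      then obtain j where j: "j \<in> A" "x = t j" "K = I j" by (auto simp: q_def)
      show "x \<in> K" "K \<subseteq> cbox 0 1" "\<exists>a b. K = cbox a b"
        using tag[OF j(1)] F(3)[OF j(1)] F(4)[OF j(1)] j by (auto simp: cbox_interval)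
    next
      fix x K y L assume "(x, K) \<in> q \<and> (y, L) \<in> q \<and> (x, K) \<noteq> (y, L)"
      then obtain i j where ij: "i \<in> A" "x = t i" "K = I i" "j \<in> A" "y = t j" "L = I j" "i \<noteq> j"
        by (auto simp: q_def)
      then show "interior K \<inter> interior L = {}" using F(5) by blast
    qed
    show "?\<gamma> fine q" using fine by (auto simp: fine_def q_def fine_family_def)
    fix p assume p: "p tagged_division_of cbox 0 1" "?\<gamma> fine p"
    have "t \<in> {0..1}" if "(t, K) \<in> p" for t K
      using tagged_division_ofD(2,3)[OF p(1) that] by (auto simp: cbox_interval)
    then have "delta_fine \<delta> p" using p(2) by (subst delta_fine_iff_fine)
    then show "norm ((\<Sum>(t, K)\<in>p. len K *\<^sub>R h t) - integral (cbox 0 1) h) < e"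
      using close p(1) by (simp add: cbox_interval)
  qed (rule e)
  ultimately show ?thesis by simp
qed

text \<open>The family is completed to a free partition by Perron divisions of the remaining
  intervals, together \<open>R\<close>, on which the Henstock error is at most an arbitrary
  \<open>k\<close>. So the error of the family differs from that of a full partition by at most
  \<open>k\<close>.\<close>

lemma saks_mcshane_family:
  fixes h :: "real \<Rightarrow> real"
  assumes h: "h integrable_on {0..1}" and \<delta>: "unit_gauge \<delta>"
    and close: "\<And>p. free_partition p \<Longrightarrow> delta_fine \<delta> p \<Longrightarrow>
      \<bar>(\<Sum>(t, I)\<in>p. len I * h t) - integral {0..1} h\<bar> < e"
    and fam: "free_family A t I" and fine: "fine_family \<delta> A t I"
  shows "\<bar>\<Sum>j\<in>A. len (I j) * h (t j) - integral (I j) h\<bar> \<le> e"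
proof (rule field_le_epsilon)
  fix k :: real assume k: "0 < k"
  let ?\<gamma> = "\<lambda>t. if t \<in> {0..1} then {t - \<delta> t <..< t + \<delta> t} else UNIV"
  let ?g = "\<lambda>(t, K). len K * h t - integral K h"
  note F = free_familyD[OF fam]
  define q where "q = (\<lambda>j. (t j, I j)) ` A"
  have sumq: "(\<Sum>j\<in>A. len (I j) * h (t j) - integral (I j) h) = sum ?g q"
    unfolding q_def using free_family_same_interval[OF fam] F(1)
    by (subst sum.reindex_nontrivial) auto
  have div: "I ` A division_of \<Union>(I ` A)" "\<Union>(I ` A) \<subseteq> cbox 0 1"
    using free_family_division[OF fam] F(3) by (auto simp: cbox_interval)
  obtain Q where Q: "I ` A \<subseteq> Q" "Q division_of cbox 0 1"
    using partial_division_extend_interval[OF div] by blast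
  note Q' = division_ofD[OF Q(2)]
  define r where "r = Q - I ` A"
  have fr: "finite r" using Q'(1) by (simp add: r_def)
  have hi: "(h has_integral integral (cbox 0 1) h) (cbox 0 1)"
    using integrable_integral[OF h] by (simp only: cbox_interval)
  obtain \<gamma>0 where \<gamma>0: "gauge \<gamma>0" "\<And>p. p tagged_division_of cbox 0 1 \<Longrightarrow> \<gamma>0 fine p \<Longrightarrow>
      norm ((\<Sum>(t, K)\<in>p. len K *\<^sub>R h t) - integral (cbox 0 1) h) < k"
    by (rule has_integralD[OF hi k], rule that, assumption) blast
  \<comment> \<open>One gauge for two purposes: fineness for \<open>\<delta>\<close> keeps the
    completed partition admissible, fineness for \<open>\<gamma>0\<close> bounds the error on
    \<open>R\<close>.\<close>
  define \<gamma> where "\<gamma> = (\<lambda>t. ?\<gamma> t \<inter> \<gamma>0 t)"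
  have ga: "gauge \<gamma>" unfolding \<gamma>_def by (rule gauge_Int[OF unit_gauge_gauge[OF \<delta>] \<gamma>0(1)])
  have \<gamma>sub: "\<gamma> x \<subseteq> \<gamma>0 x" "x \<in> {0..1} \<Longrightarrow> \<gamma> x \<subseteq> {x - \<delta> x <..< x + \<delta> x}" for x
    by (simp_all add: \<gamma>_def)
  have "\<exists>p. p tagged_division_of i \<and> \<gamma> fine p" if i: "i \<in> r" for i
  proof -
    obtain u v where uv: "i = cbox u v" using Q'(4)[of i] i by (auto simp: r_def)
    obtain p where "p tagged_division_of cbox u v" "\<gamma> fine p"
      by (rule fine_division_exists[OF ga])
    then show ?thesis unfolding uv by (intro exI conjI)
  qed
  then obtain P where P: "\<And>i. i \<in> r \<Longrightarrow> P i tagged_division_of i"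
      "\<And>i. i \<in> r \<Longrightarrow> \<gamma> fine P i" by metis
  define R where "R = \<Union>(P ` r)"
  have R: "R tagged_division_of \<Union>r" unfolding R_def
    by (rule tagged_division_Union[OF fr P(1)]) (use Q'(5) in \<open>auto simp: r_def\<close>)
  have rsub: "\<Union>r \<subseteq> cbox 0 1" using Q'(2) by (auto simp: r_def)
  note R' = tagged_division_ofD[OF R]
  have Rin: "x \<in> {0..1}" "K \<subseteq> {0..1}" if "(x, K) \<in> R" for x K
    using R'(2,3)[OF that] rsub unfolding cbox_interval by (meson subsetD order_trans)+
  have fineR: "\<gamma> fine R" unfolding R_def by (intro fine_Union) (use P in auto)
  have "norm (\<Sum>(t, K)\<in>R. len K *\<^sub>R h t - integral K h) \<le> k"
  proof (rule Henstock_lemma_part1[of h 0 1 k \<gamma>0])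
    show "h integrable_on cbox 0 1" using h by (simp add: cbox_interval)
    show "R tagged_partial_division_of cbox 0 1"
      using R rsub unfolding tagged_division_of_def tagged_partial_division_of_def by blast
    show "\<gamma>0 fine R" using fineD[OF fineR] \<gamma>sub(1) by (intro fineI) (rule order_trans)
  qed (use k \<gamma>0 in auto)
  then have Rk: "\<bar>sum ?g R\<bar> \<le> k" by simp
  have inner: "interior K \<inter> interior (I j) = {}" if "(x, K) \<in> R" "j \<in> A" for x K j
  proof -
    obtain i where i: "i \<in> r" "(x, K) \<in> P i" using \<open>(x, K) \<in> R\<close> by (auto simp: R_def)
    have "interior K \<subseteq> interior i" using tagged_division_ofD(3)[OF P(1)[OF i(1)] i(2)] by (rule interior_mono)
    moreover have "interior i \<inter> interior (I j) = {}"
      using Q'(5)[of i "I j"] i(1) Q(1) that(2) by (auto simp: r_def)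
    ultimately show ?thesis by blast
  qed
  have int: "\<exists>a b. a \<le> b \<and> K = {a..b}" if "(x, K) \<in> q \<union> R" for x K
  proof (cases "(x, K) \<in> q")
    case True
    then show ?thesis using F(4) by (auto simp: q_def)
  next
    case False
    then have "(x, K) \<in> R" using that by blast
    then show ?thesis using R'(2,4)[of x K] by (force simp: cbox_interval)
  qed
  have fp: "free_partition (q \<union> R)" unfolding free_partition_def
  proof (intro conjI)
    show "finite (q \<union> R)" using F(1) R'(1) by (simp add: q_def)
    show "\<forall>(t, I)\<in>q \<union> R. t \<in> {0..1} \<and> (\<exists>a b. a \<le> b \<and> I = {a..b})"
    proof (intro ballI, clarify)
      fix x K assume xK: "(x, K) \<in> q \<union> R"
      have "x \<in> {0..1}" using xK Rin(1) F(2) by (auto simp: q_def)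
      then show "x \<in> {0..1} \<and> (\<exists>a b. a \<le> b \<and> K = {a..b})" using int[OF xK] by blast
    qed
    show "\<forall>(t, I)\<in>q \<union> R. \<forall>(u, J)\<in>q \<union> R. (t, I) \<noteq> (u, J) \<longrightarrow> interior I \<inter> interior J = {}"
      unfolding case_prod_unfold prod.collapse
    proof (intro ballI impI, rule ccontr)
      fix i j assume ij: "i \<in> q \<union> R" "j \<in> q \<union> R" "i \<noteq> j" and ne: "interior (snd i) \<inter> interior (snd j) \<noteq> {}"
      obtain x K y L where xK: "i = (x, K)" "j = (y, L)" by fastforce
      have ne: "interior K \<inter> interior L \<noteq> {}" using ne by (simp add: xK)
      have "\<not> (i \<in> R \<and> j \<in> R)" using R'(5)[of x K y L] ij(3) ne by (auto simp: xK)
      moreover have "\<not> (i \<in> R \<and> j \<in> q)" using inner[of x K] ne by (auto simp: xK q_def)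
      moreover have "\<not> (i \<in> q \<and> j \<in> R)" using inner[of y L] ne by (auto simp: xK q_def Int_commute)
      moreover have "\<not> (i \<in> q \<and> j \<in> q)" using F(5) ij(3) ne by (auto simp: xK q_def)
      ultimately show False using ij(1,2) by blast
    qed
    have "\<Union>(snd ` q) = \<Union>(I ` A)" by (auto simp: q_def)
    moreover have "\<Union>(snd ` R) = \<Union>r"
    proof -
      have "snd ` R = {K. \<exists>x. (x, K) \<in> R}" by force
      then show ?thesis using R'(6) by (simp only:)
    qed
    moreover have "\<Union>(I ` A) \<union> \<Union>r = {0..1}" 
    proof -
      have "Q = I ` A \<union> r" using Q(1) by (auto simp: r_def)
      then show ?thesis using Q'(6) by (simp only: Union_Un_distrib cbox_interval)
    qed
    ultimately show "(\<Union>(t, I)\<in>q \<union> R. I) = {0..1}"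
      by (simp only: case_prod_unfold image_Un Union_Un_distrib)
  qed
  have df: "delta_fine \<delta> (q \<union> R)"
    unfolding delta_fine_def
  proof (rule fineI)
    fix x K assume "(x, K) \<in> q \<union> R"
    then consider "(x, K) \<in> q" | "(x, K) \<in> R" by blast
    then show "K \<subseteq> {x - \<delta> x<..<x + \<delta> x}"
    proof cases
      case 1
      then show ?thesis using fine by (auto simp: q_def fine_family_def)
    next
      case 2
      then have "K \<subseteq> \<gamma> x" by (rule fineD[OF fineR])
      also have "\<dots> \<subseteq> {x - \<delta> x<..<x + \<delta> x}" by (rule \<gamma>sub(2)[OF Rin(1)[OF 2]])
      finally show ?thesis .
    qed
  qed
  have "(\<Sum>(t, I)\<in>q \<union> R. len I * h t) - integral {0..1} h = sum ?g (q \<union> R)"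
    unfolding free_partition_integral[OF fp h, symmetric] sum_subtractf[symmetric]
    by (simp add: case_prod_unfold)
  then have "\<bar>sum ?g (q \<union> R)\<bar> < e" using close[OF fp df] by simp
  moreover have "sum ?g (q \<union> R) + sum ?g (q \<inter> R) = sum ?g q + sum ?g R"
    using F(1) R'(1) by (intro sum.union_inter) (simp_all add: q_def)
  \<comment> \<open>A pair common to \<open>q\<close> and \<open>R\<close> occurs once in the union
    but in both sums; its interval has empty interior, so the discrepancy is zero.\<close>
  moreover have "sum ?g (q \<inter> R) = 0"
  proof (rule sum.neutral, clarify)
    fix x K assume xK: "(x, K) \<in> q" "(x, K) \<in> R"
    then have "interior K = {}" using inner[of x K] by (auto simp: q_def)
    then show "len K * h x - integral K h = 0"
      using int[of x K] xK(1) by (auto simp: interval_interior_empty)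
  qed
  ultimately show "\<bar>\<Sum>j\<in>A. len (I j) * h (t j) - integral (I j) h\<bar> \<le> e + k"
    unfolding sumq using Rk by linarith
qed

section \<open>Equi-integrability and equi-absolute continuity\<close>

definition equi_henstock :: "('z \<Rightarrow> real \<Rightarrow> real) \<Rightarrow> 'z set \<Rightarrow> bool" where
  "equi_henstock h Z \<longleftrightarrow> (\<forall>z\<in>Z. h z integrable_on {0..1}) \<and>
    (\<forall>e>0. \<exists>\<delta>. unit_gauge \<delta> \<and> (\<forall>p. p tagged_division_of {0..1} \<and> delta_fine \<delta> p \<longrightarrow>
      (\<forall>z\<in>Z. \<bar>(\<Sum>(t, I)\<in>p. len I * h z t) - integral {0..1} (h z)\<bar> < e)))"

definition equi_mcshane :: "('z \<Rightarrow> real \<Rightarrow> real) \<Rightarrow> 'z set \<Rightarrow> bool" where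
  "equi_mcshane h Z \<longleftrightarrow> (\<forall>z\<in>Z. h z integrable_on {0..1}) \<and>
    (\<forall>e>0. \<exists>\<delta>. unit_gauge \<delta> \<and> (\<forall>p. free_partition p \<and> delta_fine \<delta> p \<longrightarrow>
      (\<forall>z\<in>Z. \<bar>(\<Sum>(t, I)\<in>p. len I * h z t) - integral {0..1} (h z)\<bar> < e)))"

text \<open>Finite divisions and the gauge integral make sense for members that are only Henstock
  integrable. The sum stands inside the absolute value; as subsets of a division are again
  divisions, separating signs recovers the sum of absolute values up to a factor 2.\<close>

definition equi_absolutely_continuous :: "('z \<Rightarrow> real \<Rightarrow> real) \<Rightarrow> 'z set \<Rightarrow> bool" where
  "equi_absolutely_continuous h Z \<longleftrightarrow>
    (\<forall>e>0. \<exists>\<eta>>0. \<forall>\<D>. \<D> division_of \<Union>\<D> \<and> \<Union>\<D> \<subseteq> {0..1} \<and> sum len \<D> < \<eta> \<longrightarrow>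
      (\<forall>z\<in>Z. \<bar>\<Sum>K\<in>\<D>. integral K (h z)\<bar> \<le> e))"

lemma fine_tagged_division_exists:
  assumes "unit_gauge \<delta>"
  obtains p where "p tagged_division_of {0..1}" "delta_fine \<delta> p"
proof -
  obtain p where p: "p tagged_division_of {0..1}"
      "(\<lambda>t. if t \<in> {0..1} then {t - \<delta> t <..< t + \<delta> t} else UNIV) fine p"
    by (rule fine_division_exists_real[OF unit_gauge_gauge[OF assms]])
  have "t \<in> {0..1}" if "(t, K) \<in> p" for t K
    using tagged_division_ofD(3)[OF p(1) that] tagged_division_ofD(2)[OF p(1) that] by (rule subsetD)
  then show ?thesis using that[OF p(1)] p(2) delta_fine_iff_fine[of p \<delta>] by (simp only:)
qed

lemma tagged_division_free: "p tagged_division_of {0..1} \<Longrightarrow> free_partition p"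
  by (simp only: tagged_division_of_unit_iff)

lemma free_partition_integral_Int:
  fixes h :: "real \<Rightarrow> real"
  assumes p: "free_partition p" and h: "h integrable_on {0..1}" and K: "{c..d} \<subseteq> {0..1}"
  shows "(\<Sum>j\<in>p. integral (snd j \<inter> {c..d}) h) = integral {c..d} h"
proof -
  define g where "g = (\<lambda>x. if x \<in> {c..d} then h x else 0)"
  have "g integrable_on {0..1}" unfolding g_def integrable_restrict_Int Int_absorb2[OF K]
    by (rule integrable_on_subinterval[OF h K])
  from free_partition_integral[OF p this]
  have "(\<Sum>j\<in>p. integral (snd j) g) = integral {0..1} g" by (simp add: case_prod_unfold)
  then show ?thesis
    unfolding g_def Henstock_Kurzweil_Integration.integral_restrict_Int Int_absorb2[OF K]
    by (simp add: Int_commute)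
qed

lemma integral_one_interval: "integral {a..b} (\<lambda>_. 1) = len {a..b}" for a b :: real
  using integral_const_real[of "1::real" a b] by simp

lemma Int_intervals:
  assumes "\<exists>a b. K = {a..b::real}" "\<exists>a b. L = {a..b}"
  shows "\<exists>a b. K \<inter> L = {a..b}"
proof -
  obtain a b c d where "K = {a..b}" "L = {c..d}" using assms by blast
  then have "K \<inter> L = {max a c..min b d}" by (simp add: Int_atLeastAtMost)
  then show ?thesis by blast
qed

text \<open>A fixed fine partition \<open>p\<close> is cut along \<open>\<D>\<close>. Each piece
  keeps the tag of the interval it comes from, even when that tag lies outside the piece, so
  fineness survives and only the finitely many tags of \<open>p\<close> occur. The Riemann sum over
  the pieces is then at most \<open>M\<close> times their total length, and
  \<open>saks_mcshane_family\<close> compares it with the integrals.\<close>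

lemma mcshane_division_bound:
  fixes h :: "real \<Rightarrow> real"
  assumes h: "h integrable_on {0..1}" and \<delta>: "unit_gauge \<delta>"
    and close: "\<And>p. free_partition p \<Longrightarrow> delta_fine \<delta> p \<Longrightarrow>
      \<bar>(\<Sum>(t, I)\<in>p. len I * h t) - integral {0..1} h\<bar> < e"
    and p: "free_partition p" "delta_fine \<delta> p" and M: "\<And>j. j \<in> p \<Longrightarrow> \<bar>h (fst j)\<bar> \<le> M"
    and D: "\<D> division_of \<Union>\<D>" "\<Union>\<D> \<subseteq> {0..1}"
  shows "\<bar>\<Sum>K\<in>\<D>. integral K h\<bar> \<le> e + M * sum len \<D>"
proof -
  note D' = division_ofD[OF D(1)]
  note p' = free_partitionD[OF p(1)]
  note pf = free_familyD[OF free_partition_family[OF p(1)]]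
  have DI: "\<exists>c d. K = {c..d}" "K \<subseteq> {0..1}" if "K \<in> \<D>" for K
  proof -
    show "\<exists>c d. K = {c..d}" using D'(4)[OF that] by (simp add: cbox_interval)
    show "K \<subseteq> {0..1}" using that D(2) by blast
  qed
  \<comment> \<open>Empty intersections are dropped because members of a free family are nonempty
    intervals.\<close>
  define A where "A = {x \<in> p \<times> \<D>. snd (fst x) \<inter> snd x \<noteq> {}}"
  define t where "t = (\<lambda>x :: (real \<times> real set) \<times> real set. fst (fst x))"
  define I where "I = (\<lambda>x :: (real \<times> real set) \<times> real set. snd (fst x) \<inter> snd x)"
  have fpD: "finite (p \<times> \<D>)" using p'(1) D'(1) by simp
  have fam: "free_family A t I"
  proof (rule free_familyI)
    show "finite A" using fpD by (simp add: A_def)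
    fix x assume "x \<in> A"
    then have x: "fst x \<in> p" "snd x \<in> \<D>" "I x \<noteq> {}" by (auto simp: A_def I_def)
    show "t x \<in> {0..1}" unfolding t_def by (rule p'(2)[OF x(1)])
    show "I x \<subseteq> {0..1}" using DI(2)[OF x(2)] by (auto simp: I_def)
    have "\<exists>a b. snd (fst x) = {a..b}" using p'(3)[OF x(1)] by blast
    then have "\<exists>a b. I x = {a..b}" unfolding I_def using DI(1)[OF x(2)] by (rule Int_intervals)
    then show "\<exists>a b. a \<le> b \<and> I x = {a..b}" using x(3) by force
    fix y assume "y \<in> A" "y \<noteq> x"
    then have y: "fst y \<in> p" "snd y \<in> \<D>" "fst y \<noteq> fst x \<or> snd y \<noteq> snd x"
      by (auto simp: A_def prod_eq_iff)
    from y(3) show "interior (I y) \<inter> interior (I x) = {}"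
    proof
      assume "fst y \<noteq> fst x"
      then show ?thesis using p'(4)[OF y(1) x(1)] by (auto simp: I_def)
    next
      assume "snd y \<noteq> snd x"
      then show ?thesis using D'(5)[OF y(2) x(2)] by (auto simp: I_def)
    qed
  qed
  have fine: "fine_family \<delta> A t I"
    unfolding fine_family_def
  proof
    fix x assume "x \<in> A"
    then have "fst x \<in> p" by (auto simp: A_def)
    then have "snd (fst x) \<subseteq> {t x - \<delta> (t x) <..< t x + \<delta> (t x)}"
      using delta_fine_family[OF p(2)] unfolding fine_family_def t_def by blast
    then show "I x \<subseteq> {t x - \<delta> (t x) <..< t x + \<delta> (t x)}" by (auto simp: I_def)
  qed
  have sumA: "(\<Sum>x\<in>A. f (I x)) = (\<Sum>K\<in>\<D>. \<Sum>j\<in>p. f (snd j \<inter> K))" if f: "f {} = 0" for f :: "real set \<Rightarrow> real"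
  proof -
    have "(\<Sum>x\<in>A. f (I x)) = (\<Sum>x\<in>p \<times> \<D>. f (I x))"
      by (rule sum.mono_neutral_left[OF fpD]) (auto simp: A_def I_def f)
    also have "\<dots> = (\<Sum>j\<in>p. \<Sum>K\<in>\<D>. f (snd j \<inter> K))"
      by (simp add: sum.cartesian_product I_def case_prod_unfold)
    also have "\<dots> = (\<Sum>K\<in>\<D>. \<Sum>j\<in>p. f (snd j \<inter> K))" by (rule sum.swap)
    finally show ?thesis .
  qed
  have part: "(\<Sum>j\<in>p. integral (snd j \<inter> K) g) = integral K g"
    if "K \<in> \<D>" "g integrable_on {0..1}" for K and g :: "real \<Rightarrow> real"
    using DI[OF that(1)] free_partition_integral_Int[OF p(1) that(2)] by auto
  have int: "(\<Sum>x\<in>A. integral (I x) h) = (\<Sum>K\<in>\<D>. integral K h)"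
    using sumA[of "\<lambda>K. integral K h"] part[OF _ h] by simp
  have "integral (I x) (\<lambda>_. 1) = len (I x)" if "x \<in> A" for x
    using free_familyD(4)[OF fam that] integral_one_interval by force
  then have "(\<Sum>x\<in>A. len (I x)) = (\<Sum>x\<in>A. integral (I x) (\<lambda>_. 1))" by simp
  also have "\<dots> = (\<Sum>K\<in>\<D>. integral K (\<lambda>_. 1))"
    using sumA[of "\<lambda>K. integral K (\<lambda>_. 1)"] part[of _ "\<lambda>_. 1"] by (simp add: integrable_const_ivl)
  also have "\<dots> = sum len \<D>"
    using DI(1) integral_one_interval by (intro sum.cong) force+
  finally have len: "(\<Sum>x\<in>A. len (I x)) = sum len \<D>" .
  have "\<bar>\<Sum>x\<in>A. len (I x) * h (t x)\<bar> \<le> (\<Sum>x\<in>A. len (I x) * M)"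
    by (rule order_trans[OF sum_abs sum_mono]) (auto simp: abs_mult A_def t_def intro!: mult_left_mono M)
  also have "\<dots> = M * sum len \<D>" by (simp add: len[symmetric] sum_distrib_left mult.commute)
  finally have 1: "\<bar>\<Sum>x\<in>A. len (I x) * h (t x)\<bar> \<le> M * sum len \<D>" .
  have 2: "\<bar>\<Sum>x\<in>A. len (I x) * h (t x) - integral (I x) h\<bar> \<le> e"
    by (rule saks_mcshane_family[OF h \<delta> close fam fine])
  show ?thesis using 1 2 by (simp only: sum_subtractf int; linarith)
qed

lemma equi_mcshaneD:
  assumes "equi_mcshane h Z" "0 < e"
  obtains \<delta> where "unit_gauge \<delta>" "\<And>p z. free_partition p \<Longrightarrow> delta_fine \<delta> p \<Longrightarrow> z \<in> Z \<Longrightarrow>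
      \<bar>(\<Sum>(t, I)\<in>p. len I * h z t) - integral {0..1} (h z)\<bar> < e"
  using assms unfolding equi_mcshane_def by metis

lemma equi_henstockD:
  assumes "equi_henstock h Z" "0 < e"
  obtains \<delta> where "unit_gauge \<delta>" "\<And>p z. p tagged_division_of {0..1} \<Longrightarrow> delta_fine \<delta> p \<Longrightarrow> z \<in> Z \<Longrightarrow>
      \<bar>(\<Sum>(t, I)\<in>p. len I * h z t) - integral {0..1} (h z)\<bar> < e"
  using assms unfolding equi_henstock_def by metis

lemma equi_mcshane_integrable: "equi_mcshane h Z \<Longrightarrow> z \<in> Z \<Longrightarrow> h z integrable_on {0..1}"
  by (simp add: equi_mcshane_def)

lemma equi_henstock_integrable: "equi_henstock h Z \<Longrightarrow> z \<in> Z \<Longrightarrow> h z integrable_on {0..1}"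
  by (simp add: equi_henstock_def)

text \<open>The partition \<open>p\<close> is chosen before \<open>z\<close> and has finitely many
  tags, so pointwise boundedness at these tags produces one constant for the whole family.\<close>

lemma equi_mcshane_division_bound:
  assumes M: "equi_mcshane h Z" and bdd: "\<And>t. t \<in> {0..1} \<Longrightarrow> \<exists>b. \<forall>z\<in>Z. \<bar>h z t\<bar> \<le> b" and e: "0 < e"
  obtains B where "0 \<le> B" "\<And>\<D> z. \<D> division_of \<Union>\<D> \<Longrightarrow> \<Union>\<D> \<subseteq> {0..1} \<Longrightarrow> z \<in> Z \<Longrightarrow>
    \<bar>\<Sum>K\<in>\<D>. integral K (h z)\<bar> \<le> e + B * sum len \<D>"
proof -
  obtain \<delta> where \<delta>: "unit_gauge \<delta>" and close: "\<And>p z. free_partition p \<Longrightarrow> delta_fine \<delta> p \<Longrightarrow> z \<in> Z \<Longrightarrow>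
      \<bar>(\<Sum>(t, I)\<in>p. len I * h z t) - integral {0..1} (h z)\<bar> < e"
    using equi_mcshaneD[OF M e] by metis
  obtain p where p: "p tagged_division_of {0..1}" "delta_fine \<delta> p"
    by (rule fine_tagged_division_exists[OF \<delta>])
  note fp = tagged_division_free[OF p(1)]
  obtain b where b: "\<And>t z. t \<in> {0..1} \<Longrightarrow> z \<in> Z \<Longrightarrow> \<bar>h z t\<bar> \<le> b t" using bdd by metis
  define B where "B = (\<Sum>j\<in>p. \<bar>b (fst j)\<bar>)"
  have B: "\<bar>h z (fst j)\<bar> \<le> B" if "z \<in> Z" "j \<in> p" for z j
  proof -
    have "\<bar>h z (fst j)\<bar> \<le> \<bar>b (fst j)\<bar>" using b[OF free_partitionD(2)[OF fp that(2)] that(1)] by simp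
    also have "\<dots> \<le> B" unfolding B_def using that(2) free_partitionD(1)[OF fp] by (intro member_le_sum) auto
    finally show ?thesis .
  qed
  show ?thesis
  proof (rule that)
    show "0 \<le> B" by (simp add: B_def sum_nonneg)
    fix \<D> :: "real set set" and z assume D: "\<D> division_of \<Union>\<D>" "\<Union>\<D> \<subseteq> {0..1}" and z: "z \<in> Z"
    show "\<bar>\<Sum>K\<in>\<D>. integral K (h z)\<bar> \<le> e + B * sum len \<D>"
      by (rule mcshane_division_bound[OF equi_mcshane_integrable[OF M z] \<delta> close[OF _ _ z] fp p(2) B[OF z] D])
  qed
qed

lemma equi_mcshane_imp_absolutely_continuous:
  assumes M: "equi_mcshane h Z" and bdd: "\<And>t. t \<in> {0..1} \<Longrightarrow> \<exists>b. \<forall>z\<in>Z. \<bar>h z t\<bar> \<le> b"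
  shows "equi_absolutely_continuous h Z"
  unfolding equi_absolutely_continuous_def
proof (intro allI impI)
  fix e :: real assume e: "0 < e"
  obtain B where B: "0 \<le> B" "\<And>(\<D> :: real set set) z. \<D> division_of \<Union>\<D> \<Longrightarrow> \<Union>\<D> \<subseteq> {0..1} \<Longrightarrow> z \<in> Z \<Longrightarrow>
      \<bar>\<Sum>K\<in>\<D>. integral K (h z)\<bar> \<le> e / 2 + B * sum len \<D>"
    using equi_mcshane_division_bound[OF M bdd, of "e / 2"] e by (metis half_gt_zero)
  define \<eta> where "\<eta> = e / (2 * (B + 1))"
  have \<eta>: "0 < \<eta>" "B * \<eta> \<le> e / 2" using e B(1) by (auto simp: \<eta>_def field_simps)
  show "\<exists>\<eta>>0. \<forall>\<D> :: real set set. \<D> division_of \<Union>\<D> \<and> \<Union>\<D> \<subseteq> {0..1} \<and> sum len \<D> < \<eta> \<longrightarrow>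
      (\<forall>z\<in>Z. \<bar>\<Sum>K\<in>\<D>. integral K (h z)\<bar> \<le> e)"
  proof (intro exI conjI allI impI ballI)
    fix \<D> :: "real set set" and z assume D: "\<D> division_of \<Union>\<D> \<and> \<Union>\<D> \<subseteq> {0..1} \<and> sum len \<D> < \<eta>" and z: "z \<in> Z"
    have "\<bar>\<Sum>K\<in>\<D>. integral K (h z)\<bar> \<le> e / 2 + B * sum len \<D>" using D by (intro B(2) z) auto
    also have "B * sum len \<D> \<le> B * \<eta>" using D B(1) by (intro mult_left_mono) auto
    finally show "\<bar>\<Sum>K\<in>\<D>. integral K (h z)\<bar> \<le> e" using \<eta>(2) by linarith
  qed (rule \<eta>(1))
qed

text \<open>The bound on sums of integrals also covers subsets of a division. Separating the members
  with nonnegative and with negative integral turns it into a bound on the variation of the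
  indefinite integral.\<close>

lemma equi_mcshane_absolutely_integrable:
  assumes M: "equi_mcshane h Z" and bdd: "\<And>t. t \<in> {0..1} \<Longrightarrow> \<exists>b. \<forall>z\<in>Z. \<bar>h z t\<bar> \<le> b" and z: "z \<in> Z"
  shows "h z absolutely_integrable_on {0..1}"
proof -
  obtain B where B: "0 \<le> B" "\<And>\<D> z. \<D> division_of \<Union>\<D> \<Longrightarrow> \<Union>\<D> \<subseteq> {0..1} \<Longrightarrow> z \<in> Z \<Longrightarrow>
      \<bar>\<Sum>K\<in>\<D>. integral K (h z)\<bar> \<le> 1 + B * sum len \<D>"
    using equi_mcshane_division_bound[OF M bdd, of 1] by (metis zero_less_one)
  have sub: "\<bar>\<Sum>K\<in>\<D>'. integral K (h z)\<bar> \<le> 1 + B" if d: "\<D> division_of cbox 0 1" and sub: "\<D>' \<subseteq> \<D>" for \<D> \<D>'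
  proof -
    have D: "\<D>' division_of \<Union>\<D>'" by (rule division_of_subset[OF division_of_union_self[OF d] sub])
    have U: "\<Union>\<D>' \<subseteq> cbox 0 1" using sub division_ofD(6)[OF d] by blast
    have "\<bar>\<Sum>K\<in>\<D>'. integral K (h z)\<bar> \<le> 1 + B * sum len \<D>'"
      using U by (intro B(2)[OF D _ z]) (simp add: cbox_interval)
    also have "B * sum len \<D>' \<le> B * 1"
      using subadditive_content_division[OF D U] B(1) by (intro mult_left_mono) auto
    finally show ?thesis by simp
  qed
  have "h z absolutely_integrable_on cbox 0 1"
  proof (rule bounded_variation_absolutely_integrable_interval)
    show "h z integrable_on cbox 0 1" using equi_mcshane_integrable[OF M z] by (simp add: cbox_interval)
    fix \<D> assume d: "\<D> division_of cbox (0::real) 1"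
    let ?P = "{K \<in> \<D>. 0 \<le> integral K (h z)}"
    have "(\<Sum>K\<in>\<D>. norm (integral K (h z))) = (\<Sum>K\<in>?P. norm (integral K (h z))) + (\<Sum>K\<in>\<D> - ?P. norm (integral K (h z)))"
      using division_of_finite[OF d] by (subst add.commute, intro sum.subset_diff) auto
    also have "(\<Sum>K\<in>?P. norm (integral K (h z))) = (\<Sum>K\<in>?P. integral K (h z))" by (intro sum.cong) auto
    also have "(\<Sum>K\<in>\<D> - ?P. norm (integral K (h z))) = - (\<Sum>K\<in>\<D> - ?P. integral K (h z))"
      unfolding sum_negf[symmetric] by (intro sum.cong) auto
    also have "(\<Sum>K\<in>?P. integral K (h z)) + - (\<Sum>K\<in>\<D> - ?P. integral K (h z)) \<le> 2 * (1 + B)"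
      using sub[OF d, of ?P] sub[OF d Diff_subset, of ?P] by auto
    finally show "(\<Sum>K\<in>\<D>. norm (integral K (h z))) \<le> 2 * (1 + B)" .
  qed
  then show ?thesis by (simp add: cbox_interval)
qed

section \<open>From Henstock to McShane under absolute continuity\<close>

\<comment> \<open>\<open>D\<close> need not be measurable: \<open>G\<close> nearly attains the outer measure of \<open>D\<close>.\<close>
lemma outer_open_set:
  fixes D :: "real set"
  assumes D: "D \<subseteq> {0..1}" and \<sigma>: "0 < \<sigma>"
  obtains G where "open G" "D \<subseteq> G"
    "\<And>F. compact F \<Longrightarrow> F \<subseteq> G \<Longrightarrow> F \<inter> D = {} \<Longrightarrow> len F \<le> \<sigma>"
proof -
  \<comment> \<open>The bounded window around \<open>{0..1}\<close> gives all competitors finite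
    measure.\<close>
  define \<U> where "\<U> = {U. open U \<and> D \<subseteq> U \<and> U \<subseteq> {-1<..<2}}"
  have "{-1<..<2} \<in> \<U>" using D by (force simp: \<U>_def)
  then have ne: "\<U> \<noteq> {}" by blast
  have bdd: "bdd_below (len ` \<U>)" by (intro bdd_belowI2[of _ 0]) simp
  have "(INF U\<in>\<U>. len U) < (INF U\<in>\<U>. len U) + \<sigma>" using \<sigma> by simp
  then obtain G where G: "G \<in> \<U>" "len G < (INF U\<in>\<U>. len U) + \<sigma>"
    using cINF_less_iff[OF ne bdd] by blast
  have G': "open G" "D \<subseteq> G" "G \<subseteq> {-1<..<2}" using G(1) by (auto simp: \<U>_def)
  show ?thesis
  proof (rule that[OF G'(1,2)])
    fix F assume F: "compact F" "F \<subseteq> G" "F \<inter> D = {}"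
    \<comment> \<open>\<open>G - F\<close> is again a competitor, so by near minimality of
      \<open>G\<close> at most \<open>\<sigma>\<close> can have been removed.\<close>
    have "G - F \<in> \<U>" using G' F by (auto simp: \<U>_def intro: open_Diff compact_imp_closed)
    then have "(INF U\<in>\<U>. len U) \<le> len (G - F)" by (rule cINF_lower[OF bdd])
    also have "len (G - F) = len G - len F"
    proof (rule measure_Diff)
      have "bounded G" using bounded_subset[OF _ G'(3)] by simp
      then show "emeasure lborel G \<noteq> \<infinity>" using emeasure_bounded_finite[of G] by simp
    qed (use G'(1) F in \<open>auto intro: borel_open borel_closed compact_imp_closed\<close>)
    finally show "len F \<le> \<sigma>" using G(2) by simp
  qed
qed

lemma free_family_len_Union:
  assumes "free_family A t I"
  shows "(\<Sum>j\<in>A. len (I j)) = len (\<Union>(I ` A))"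
proof -
  have meas: "K \<in> sets borel" if "K \<in> I ` A" for K
    using free_familyD(4)[OF assms] that by (force intro: borel_closed)
  have "sum len (I ` A) = (\<Sum>K\<in>I ` A. measure lebesgue K)"
    by (rule sum.cong[OF refl], rule measure_completion[symmetric]) (use meas in auto)
  also have "\<dots> = measure lebesgue (\<Union>(I ` A))"
    by (rule content_division[OF free_family_division[OF assms]])
  also have "\<dots> = len (\<Union>(I ` A))"
    using meas free_familyD(1)[OF assms] by (intro measure_completion) (auto intro!: sets.finite_UN)
  finally show ?thesis by (simp add: sum_free_family_content[OF assms])
qed

\<comment> \<open>The slots \<open>[a j, a j + w j)\<close> stack the cells by level: cells that meet get disjoint slots.\<close>
lemma laminar_packing:
  fixes w :: "'i \<Rightarrow> real" and rk :: "'i \<Rightarrow> nat"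
  assumes "finite S" "\<And>j. j \<in> S \<Longrightarrow> 0 \<le> w j"
    and "\<And>i j. i \<in> S \<Longrightarrow> j \<in> S \<Longrightarrow> rk i \<le> rk j \<Longrightarrow> C i \<inter> C j \<noteq> {} \<Longrightarrow> C j \<subseteq> C i"
  shows "\<exists>a. (\<forall>j\<in>S. 0 \<le> a j \<and> a j + w j \<le> (\<Sum>i\<in>S. if C j \<subseteq> C i then w i else 0)) \<and>
    (\<forall>i\<in>S. \<forall>j\<in>S. i \<noteq> j \<and> C i \<inter> C j \<noteq> {} \<longrightarrow> a i + w i \<le> a j \<or> a j + w j \<le> a i)"
  using assms
\<comment> \<open>Cells are inserted by increasing \<open>rk\<close>, so an earlier cell that meets
  the new one contains it.\<close>
proof (induction S rule: finite_ranking_induct[where f = rk])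
  case empty
  then show ?case by simp
next
  case (insert x S)
  show ?case
  proof (cases "x \<in> S")
    case True
    then have "insert x S = S" by blast
    then show ?thesis using insert.IH insert.prems by (simp only: simp_thms)
  next
    case False
    have ex: "\<exists>a. (\<forall>j\<in>S. 0 \<le> a j \<and> a j + w j \<le> (\<Sum>i\<in>S. if C j \<subseteq> C i then w i else 0)) \<and>
      (\<forall>i\<in>S. \<forall>j\<in>S. i \<noteq> j \<and> C i \<inter> C j \<noteq> {} \<longrightarrow> a i + w i \<le> a j \<or> a j + w j \<le> a i)"
      by (rule insert.IH) (use insert.prems in blast)+
    then obtain a where a: "\<And>j. j \<in> S \<Longrightarrow> 0 \<le> a j \<and> a j + w j \<le> (\<Sum>i\<in>S. if C j \<subseteq> C i then w i else 0)"
      "\<And>i j. i \<in> S \<Longrightarrow> j \<in> S \<Longrightarrow> i \<noteq> j \<Longrightarrow> C i \<inter> C j \<noteq> {} \<Longrightarrow> a i + w i \<le> a j \<or> a j + w j \<le> a i"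
      by (elim exE conjE) blast
    have w: "0 \<le> w i" if "i \<in> insert x S" for i using insert.prems(1)[OF that] .
    have nest: "C x \<subseteq> C i" if "i \<in> S" "C i \<inter> C x \<noteq> {}" for i
      using insert.prems(2)[of i x] insert.hyps(2) that by blast
    \<comment> \<open>The new slot starts at the total weight of the earlier cells containing
      \<open>C x\<close>; every earlier slot whose cell meets \<open>C x\<close> ends at or below
      that height.\<close>
    define T where "T = (\<Sum>i\<in>S. if C x \<subseteq> C i then w i else 0)"
    have T: "0 \<le> T" unfolding T_def by (intro sum_nonneg) (use w in auto)
    define a' where "a' = a(x := T)"
    have a'x: "a' x = T" and a'S: "\<And>j. j \<in> S \<Longrightarrow> a' j = a j" using False by (auto simp: a'_def)
    have aT: "a j + w j \<le> T" if j: "j \<in> S" "C j \<inter> C x \<noteq> {}" for j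
    proof -
      have "a j + w j \<le> (\<Sum>i\<in>S. if C j \<subseteq> C i then w i else 0)" using a(1)[OF j(1)] by blast
      also have "\<dots> \<le> T" unfolding T_def
        using nest[OF j] w by (intro sum_mono) auto
      finally show ?thesis .
    qed
    have sum_ins: "(\<Sum>i\<in>insert x S. if C j \<subseteq> C i then w i else 0) =
        (if C j \<subseteq> C x then w x else 0) + (\<Sum>i\<in>S. if C j \<subseteq> C i then w i else 0)" for j
      using insert.hyps(1) False by (rule sum.insert)
    show ?thesis
    proof (rule exI[of _ a'], intro conjI ballI impI)
      fix j assume j: "j \<in> insert x S"
      show "0 \<le> a' j" using j a(1) T a'x a'S by (cases "j = x") auto
      show "a' j + w j \<le> (\<Sum>i\<in>insert x S. if C j \<subseteq> C i then w i else 0)"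
      proof (cases "j = x")
        case True
        then show ?thesis unfolding sum_ins True a'x T_def by simp
      next
        case False
        then have jS: "j \<in> S" using j by blast
        have "0 \<le> (if C j \<subseteq> C x then w x else 0)" using w[of x] by simp
        then show ?thesis unfolding sum_ins a'S[OF jS] using a(1)[OF jS] by linarith
      qed
    next
      fix i j assume ij: "i \<in> insert x S" "j \<in> insert x S" "i \<noteq> j \<and> C i \<inter> C j \<noteq> {}"
      consider "i = x" "j \<in> S" | "j = x" "i \<in> S" | "i \<in> S" "j \<in> S" using ij by blast
      then show "a' i + w i \<le> a' j \<or> a' j + w j \<le> a' i"
      proof cases
        case 1
        then have "a j + w j \<le> T" using ij(3) by (intro aT) (auto simp: Int_commute)
        then show ?thesis using 1 a'x a'S by auto
      next
        case 2
        then have "a i + w i \<le> T" using ij(3) by (intro aT) auto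
        then show ?thesis using 2 a'x a'S by auto
      next
        case 3
        then show ?thesis using a(2)[OF 3] ij(3) a'S by auto
      qed
    qed
  qed
qed

\<comment> \<open>The weighted sum is the integral over heights \<open>\<theta>\<close> of the sums over the \<open>j\<close> whose slot contains \<open>\<theta>\<close>.\<close>
lemma packing_average:
  fixes a w v :: "'i \<Rightarrow> real"
  assumes S: "finite S" and aw: "\<And>j. j \<in> S \<Longrightarrow> 0 \<le> a j \<and> 0 \<le> w j \<and> a j + w j \<le> K"
    and K: "0 \<le> K"
    and F: "\<And>F. F \<subseteq> S \<Longrightarrow> (\<And>i j. i \<in> F \<Longrightarrow> j \<in> F \<Longrightarrow> i \<noteq> j \<Longrightarrow> a j < a i + w i) \<Longrightarrow> \<bar>\<Sum>j\<in>F. v j\<bar> \<le> c"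
  shows "\<bar>\<Sum>j\<in>S. w j * v j\<bar> \<le> K * c"
proof -
  define g where "g = (\<lambda>\<theta>::real. \<Sum>j\<in>S. indicat_real {a j..<a j + w j} \<theta> * v j)"
  have ind: "integrable lborel (indicat_real {x..<y})" for x y :: real
  proof (rule integrable_real_indicator)
    have "bounded {x..<y}" by (rule bounded_subset[of "{x..y}"]) auto
    then show "emeasure lborel {x..<y} < \<infinity>" by (rule emeasure_bounded_finite)
  qed simp
  have int1: "integrable lborel (\<lambda>\<theta>. indicat_real {a j..<a j + w j} \<theta> * v j)" for j
    by (intro integrable_mult_left ind)
  have ig: "integrable lborel g" unfolding g_def by (intro Bochner_Integration.integrable_sum int1)
  have iv: "integral\<^sup>L lborel g = (\<Sum>j\<in>S. w j * v j)"
    unfolding g_def using int1 aw by (subst Bochner_Integration.integral_sum) (auto intro!: sum.cong)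
  have gb: "\<bar>g \<theta>\<bar> \<le> c * indicat_real {0..<K} \<theta>" for \<theta>
  proof -
    \<comment> \<open>All slots indexed by \<open>T\<close> contain \<open>\<theta>\<close>, hence
      overlap pairwise, so the hypothesis \<open>F\<close> bounds the sum over
      \<open>T\<close>.\<close>
    define T where "T = {j \<in> S. \<theta> \<in> {a j..<a j + w j}}"
    have "g \<theta> = (\<Sum>j\<in>S. if \<theta> \<in> {a j..<a j + w j} then v j else 0)"
      unfolding g_def by (intro sum.cong) (auto simp: indicator_def)
    also have "\<dots> = (\<Sum>j\<in>T. v j)" unfolding T_def using S by (simp add: sum.inter_filter)
    finally have gT: "g \<theta> = (\<Sum>j\<in>T. v j)" .
    show ?thesis
    proof (cases "\<theta> \<in> {0..<K}")
      case True
      have "\<bar>\<Sum>j\<in>T. v j\<bar> \<le> c" by (rule F) (auto simp: T_def)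
      then show ?thesis using True gT by simp
    next
      case False
      have "T = {}" using False aw by (fastforce simp: T_def)
      then show ?thesis using False gT by simp
    qed
  qed
  have "\<bar>integral\<^sup>L lborel g\<bar> \<le> (LINT \<theta>|lborel. \<bar>g \<theta>\<bar>)" by (rule integral_abs_bound)
  also have "\<dots> \<le> (LINT \<theta>|lborel. c * indicat_real {0..<K} \<theta>)"
    by (rule integral_mono) (use ig ind gb in auto)
  also have "\<dots> = K * c" using K by simp
  finally show ?thesis unfolding iv .
qed

section \<open>Dyadic cells and the averaging of Perron families\<close>

text \<open>The open dyadic interval of length \<open>(1/2) ^ n\<close> at \<open>t\<close>. If
  \<open>t * 2 ^ n\<close> is an integer, \<open>t\<close> is its left endpoint and not a member,
  which is why dyadic tags are treated separately.\<close>

definition dcell :: "nat \<Rightarrow> real \<Rightarrow> real set" where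
  "dcell n t = {of_int \<lfloor>t * 2 ^ n\<rfloor> / 2 ^ n <..< (of_int \<lfloor>t * 2 ^ n\<rfloor> + 1) / 2 ^ n}"

definition ccell :: "nat \<Rightarrow> real \<Rightarrow> real set" where
  "ccell n t = {of_int \<lfloor>t * 2 ^ n\<rfloor> / 2 ^ n .. (of_int \<lfloor>t * 2 ^ n\<rfloor> + 1) / 2 ^ n}"

lemma mem_dcell: "x \<in> dcell n t \<longleftrightarrow> of_int \<lfloor>t * 2 ^ n\<rfloor> < x * 2 ^ n \<and> x * 2 ^ n < of_int \<lfloor>t * 2 ^ n\<rfloor> + 1"
  by (simp add: dcell_def pos_divide_less_eq pos_less_divide_eq)

lemma interior_ccell: "interior (ccell n t) = dcell n t"
  by (simp add: ccell_def dcell_def)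

lemma len_ccell: "len (ccell n t) = (1/2) ^ n"
proof -
  have "len {r / 2 ^ n .. (r + 1) / 2 ^ n} = (1/2) ^ n" for r :: real
    by (simp add: divide_right_mono diff_divide_distrib[symmetric] power_one_over)
  then show ?thesis unfolding ccell_def .
qed

text \<open>In units of \<open>(1/2) ^ n\<close> both cells have integer endpoints, so the strict
  inequalities coming from a common point sharpen to the weak ones that express containment.\<close>

lemma dcell_nested:
  assumes "m \<le> n" "dcell m t \<inter> dcell n s \<noteq> {}"
  shows "dcell n s \<subseteq> dcell m t"
proof
  define p where "p = \<lfloor>s * 2 ^ n\<rfloor>"
  define q where "q = \<lfloor>t * 2 ^ m\<rfloor>"
  define r :: int where "r = 2 ^ (n - m)"
  have r: "(2::real) ^ n = 2 ^ m * of_int r" using assms(1) by (simp add: r_def flip: power_add)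
  have r0: "0 < (of_int r :: real)" by (simp add: r_def)
  obtain x where x: "x \<in> dcell m t" "x \<in> dcell n s" using assms(2) by blast
  have "of_int q * of_int r < x * 2 ^ n" "x * 2 ^ n < (of_int q + 1) * (of_int r :: real)"
    using x(1) r0 unfolding mem_dcell r q_def[symmetric] mult.assoc[symmetric] by (auto intro: mult_strict_right_mono)
  moreover have "of_int p < x * 2 ^ n" "x * 2 ^ n < of_int p + 1"
    using x(2) unfolding mem_dcell p_def by auto
  ultimately have "(of_int (q * r) :: real) < of_int (p + 1)" "(of_int p :: real) < of_int ((q + 1) * r)"
    by simp_all
  then have "q * r \<le> p" "p + 1 \<le> (q + 1) * r" by linarith+
  then have pq: "of_int q * of_int r \<le> (of_int p :: real)" "of_int p + 1 \<le> (of_int q + 1) * (of_int r :: real)"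
    by (metis of_int_le_iff of_int_mult, metis of_int_1 of_int_add of_int_le_iff of_int_mult)
  fix y assume "y \<in> dcell n s"
  then have "of_int p < y * 2 ^ n" "y * 2 ^ n < of_int p + 1" unfolding mem_dcell p_def by auto
  then have "of_int q * of_int r < y * 2 ^ m * of_int r" "y * 2 ^ m * of_int r < (of_int q + 1) * of_int r"
    using pq unfolding r by (simp_all add: mult.assoc)
  then show "y \<in> dcell m t" unfolding mem_dcell q_def[symmetric] using r0 by simp
qed

lemma nondyadic_cell:
  assumes "t \<in> {0..1}" "\<And>n. t * 2 ^ n \<notin> \<int>"
  shows "t \<in> dcell n t" "ccell n t \<subseteq> {0..1}"
proof -
  have fl: "of_int \<lfloor>t * 2 ^ n\<rfloor> \<noteq> t * 2 ^ n" using assms(2)[of n] by (metis Ints_of_int)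
  then show "t \<in> dcell n t" unfolding mem_dcell by linarith
  have "t \<noteq> 1" using assms(2)[of 0] by auto
  then have "t * 2 ^ n < 2 ^ n" using assms(1) by simp
  then have "\<lfloor>t * 2 ^ n\<rfloor> < 2 ^ n" by (simp add: floor_less_iff)
  then have "of_int (\<lfloor>t * 2 ^ n\<rfloor> + 1) \<le> (of_int (2 ^ n) :: real)" by (simp only: of_int_le_iff; linarith)
  moreover have "0 \<le> \<lfloor>t * 2 ^ n\<rfloor>" using assms(1) by simp
  ultimately show "ccell n t \<subseteq> {0..1}" by (auto simp: ccell_def field_simps intro: order_trans)
qed

lemma ccell_dist: "x \<in> ccell n t \<Longrightarrow> y \<in> ccell n t \<Longrightarrow> \<bar>x - y\<bar> \<le> (1/2) ^ n"
proof -
  have "\<bar>x - y\<bar> \<le> (r + 1) / 2 ^ n - r / 2 ^ n"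
    if "r / 2 ^ n \<le> x" "x \<le> (r + 1) / 2 ^ n" "r / 2 ^ n \<le> y" "y \<le> (r + 1) / 2 ^ n" for r :: real
    using that by linarith
  moreover have "(r + 1) / 2 ^ n - r / 2 ^ n = (1/2) ^ n" for r :: real
    by (simp add: diff_divide_distrib[symmetric] power_one_over)
  ultimately show "x \<in> ccell n t \<Longrightarrow> y \<in> ccell n t \<Longrightarrow> \<bar>x - y\<bar> \<le> (1/2) ^ n"
    unfolding ccell_def atLeastAtMost_iff by metis
qed

text \<open>Any point of the cell whose gauge exceeds the cell length may serve as tag, so
  \<open>t\<close> and another point \<open>s\<close> can both be Perron tags of one and the same
  cell.\<close>

lemma ccell_fine:
  assumes "s \<in> dcell n t" "(1/2) ^ n < \<delta> s"
  shows "ccell n t \<subseteq> {s - \<delta> s <..< s + \<delta> s}"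
proof
  fix x assume "x \<in> ccell n t"
  moreover have "s \<in> ccell n t" using assms(1) interior_subset[of "ccell n t"] unfolding interior_ccell by blast
  ultimately have "\<bar>x - s\<bar> < \<delta> s" using ccell_dist[of x n t s] assms(2) by linarith
  then show "x \<in> {s - \<delta> s <..< s + \<delta> s}" unfolding greaterThanLessThan_iff by linarith
qed

text \<open>Let \<open>C j\<close> be the cell of \<open>t j\<close> and \<open>w j\<close> the
  ratio of the lengths of \<open>I j\<close> and \<open>C j\<close>. The error at \<open>t j\<close>
  is \<open>w j\<close> times the difference of the values at \<open>t j\<close> and
  \<open>s j\<close>, scaled by the length of \<open>C j\<close>, plus the error at
  \<open>s j\<close>, a Perron tag of \<open>I j\<close>. Packing writes the weighted sum as an
  integral over heights below \<open>K\<close> of sums over disjoint cells, each a difference of two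
  Perron errors; hence \<open>K * (2 * e) + e\<close>. The discarded set \<open>A2\<close> is fixed
  before \<open>h\<close> and \<open>e\<close>, which makes the bound uniform over a family.\<close>

lemma dyadic_core:
  fixes t s :: "'i \<Rightarrow> real" and n :: "'i \<Rightarrow> nat"
  assumes fam: "free_family A t I"
    and cell: "\<And>j. j \<in> A \<Longrightarrow> I j \<subseteq> dcell (n j) (t j)" "\<And>j. j \<in> A \<Longrightarrow> t j \<in> dcell (n j) (t j)"
      "\<And>j. j \<in> A \<Longrightarrow> ccell (n j) (t j) \<subseteq> {0..1}"
    and s: "\<And>j. j \<in> A \<Longrightarrow> s j \<in> I j"
    and \<delta>: "\<And>j. j \<in> A \<Longrightarrow> (1/2) ^ n j < \<delta> (t j)" "\<And>j. j \<in> A \<Longrightarrow> (1/2) ^ n j < \<delta> (s j)"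
    and K: "0 < K"
  obtains A2 where "A2 \<subseteq> A" "K * (\<Sum>j\<in>A2. len (I j)) \<le> 1"
    "\<And>h e. (\<And>(B :: 'i set) t I. free_family B t I \<Longrightarrow> fine_family \<delta> B t I \<Longrightarrow> (\<And>j. j \<in> B \<Longrightarrow> t j \<in> I j) \<Longrightarrow>
        \<bar>\<Sum>j\<in>B. len (I j) * h (t j) - integral (I j) h\<bar> \<le> e) \<Longrightarrow>
      \<bar>\<Sum>j\<in>A - A2. len (I j) * h (t j) - integral (I j) h\<bar> \<le> K * (2 * e) + e"
proof -
  note F = free_familyD[OF fam]
  define C where "C j = dcell (n j) (t j)" for j
  define w where "w j = len (I j) * 2 ^ n j" for j
  have w0: "0 \<le> w j" for j by (simp add: w_def)
  have wlen: "w j * (1/2) ^ n j = len (I j)" for j by (simp add: w_def power_one_over)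
  have "\<exists>a. (\<forall>j\<in>A. 0 \<le> a j \<and> a j + w j \<le> (\<Sum>i\<in>A. if C j \<subseteq> C i then w i else 0)) \<and>
    (\<forall>i\<in>A. \<forall>j\<in>A. i \<noteq> j \<and> C i \<inter> C j \<noteq> {} \<longrightarrow> a i + w i \<le> a j \<or> a j + w j \<le> a i)"
    by (rule laminar_packing[where rk = n, OF F(1) w0]) (simp_all add: C_def dcell_nested)
  then obtain a where a: "\<And>j. j \<in> A \<Longrightarrow> 0 \<le> a j \<and> a j + w j \<le> (\<Sum>i\<in>A. if C j \<subseteq> C i then w i else 0)"
    and sep: "\<And>i j. i \<in> A \<Longrightarrow> j \<in> A \<Longrightarrow> i \<noteq> j \<Longrightarrow> C i \<inter> C j \<noteq> {} \<Longrightarrow> a i + w i \<le> a j \<or> a j + w j \<le> a i"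
    by (elim exE conjE) blast
  \<comment> \<open>The members whose slot rises above height \<open>K\<close>.\<close>
  define A2 where "A2 = {j \<in> A. K < a j + w j}"
  have A2: "A2 \<subseteq> A" by (auto simp: A2_def)
  have finA2: "finite A2" using A2 F(1) by (rule finite_subset)
  \<comment> \<open>Double counting: for \<open>j\<close> in \<open>A2\<close> the cells containing
    \<open>C j\<close> have total weight above \<open>K\<close>. After exchanging the sums, each
    \<open>i\<close> sees only intervals inside its own cell, of total length at most
    \<open>(1/2) ^ n i\<close>, and \<open>w i\<close> times this is
    \<open>len (I i)\<close>.\<close>
  have "K * (\<Sum>j\<in>A2. len (I j)) = (\<Sum>j\<in>A2. len (I j) * K)" by (simp add: sum_distrib_left mult.commute)
  also have "\<dots> \<le> (\<Sum>j\<in>A2. len (I j) * (\<Sum>i\<in>A. if C j \<subseteq> C i then w i else 0))"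
  proof (intro sum_mono mult_left_mono)
    fix j assume "j \<in> A2"
    then show "K \<le> (\<Sum>i\<in>A. if C j \<subseteq> C i then w i else 0)" using a[of j] by (auto simp: A2_def)
  qed simp
  also have "\<dots> = (\<Sum>i\<in>A. \<Sum>j\<in>A2. len (I j) * (if C j \<subseteq> C i then w i else 0))"
    by (simp only: sum_distrib_left) (rule sum.swap)
  also have "\<dots> = (\<Sum>i\<in>A. w i * (\<Sum>j\<in>{j \<in> A2. C j \<subseteq> C i}. len (I j)))"
  proof (rule sum.cong[OF refl])
    fix i
    have "w i * (\<Sum>j\<in>{j \<in> A2. C j \<subseteq> C i}. len (I j)) = w i * (\<Sum>j\<in>A2. if C j \<subseteq> C i then len (I j) else 0)"
      using finA2 by (simp only: sum.inter_filter)
    also have "\<dots> = (\<Sum>j\<in>A2. len (I j) * (if C j \<subseteq> C i then w i else 0))"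
      unfolding sum_distrib_left by (rule sum.cong) auto
    finally show "(\<Sum>j\<in>A2. len (I j) * (if C j \<subseteq> C i then w i else 0)) = w i * (\<Sum>j\<in>{j \<in> A2. C j \<subseteq> C i}. len (I j))"
      by (rule sym)
  qed
  also have "\<dots> \<le> (\<Sum>i\<in>A. w i * (1/2) ^ n i)"
  proof (intro sum_mono mult_left_mono w0)
    fix i assume "i \<in> A"
    have sub: "{j \<in> A2. C j \<subseteq> C i} \<subseteq> A" using A2 by blast
    have "I j \<subseteq> ccell (n i) (t i)" if "j \<in> {j \<in> A2. C j \<subseteq> C i}" for j
    proof -
      have "I j \<subseteq> C j" using that sub cell(1) unfolding C_def by blast
      also have "\<dots> \<subseteq> C i" using that by blast
      also have "\<dots> \<subseteq> ccell (n i) (t i)" unfolding C_def interior_ccell[symmetric] by (rule interior_subset)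
      finally show ?thesis .
    qed
    then show "(\<Sum>j\<in>{j \<in> A2. C j \<subseteq> C i}. len (I j)) \<le> (1/2) ^ n i"
      unfolding len_ccell[of "n i" "t i", symmetric] unfolding ccell_def
      by (rule free_family_content_le[OF free_family_subset[OF fam sub]])
  qed
  also have "\<dots> = (\<Sum>i\<in>A. len (I i))" by (simp only: wlen)
  also have "\<dots> \<le> 1" using free_family_content_le[OF fam, of 0 1] F(3) by simp
  finally have disc: "K * (\<Sum>j\<in>A2. len (I j)) \<le> 1" .
  have keep: "\<bar>\<Sum>j\<in>A - A2. len (I j) * h (t j) - integral (I j) h\<bar> \<le> K * (2 * e) + e"
    if SH: "\<And>(B :: 'i set) t I. free_family B t I \<Longrightarrow> fine_family \<delta> B t I \<Longrightarrow> (\<And>j. j \<in> B \<Longrightarrow> t j \<in> I j) \<Longrightarrow>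
        \<bar>\<Sum>j\<in>B. len (I j) * h (t j) - integral (I j) h\<bar> \<le> e" for h e
  proof -
    define S where "S = A - A2"
    have SA: "j \<in> A" if "j \<in> S" for j using that by (simp add: S_def)
    have scell: "s j \<in> dcell (n j) (t j)" if "j \<in> A" for j using s[OF that] cell(1)[OF that] by blast
    define J where "J j = ccell (n j) (t j)" for j
    define v where "v j = (1/2) ^ n j * (h (t j) - h (s j))" for j
    have s01: "s j \<in> {0..1}" if "j \<in> A" for j using s[OF that] F(3)[OF that] by blast
    have Jfam: "free_family B r J" if B: "B \<subseteq> A" "\<And>i j. i \<in> B \<Longrightarrow> j \<in> B \<Longrightarrow> i \<noteq> j \<Longrightarrow> C i \<inter> C j = {}"
      and r: "\<And>j. j \<in> B \<Longrightarrow> r j \<in> {0..1}" for B r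
    proof (rule free_familyI)
      show "finite B" using B(1) F(1) by (rule finite_subset)
      fix j assume j: "j \<in> B"
      show "r j \<in> {0..1}" by (rule r[OF j])
      show "J j \<subseteq> {0..1}" using j B(1) cell(3) unfolding J_def by blast
      show "\<exists>a b. a \<le> b \<and> J j = {a..b}" unfolding J_def ccell_def
        by (intro exI conjI) (auto simp: divide_right_mono)
      fix i assume "i \<in> B" "i \<noteq> j"
      then show "interior (J i) \<inter> interior (J j) = {}" using B(2)[of i j] j by (simp add: J_def interior_ccell C_def)
    qed
    have avg: "\<bar>\<Sum>j\<in>S. w j * v j\<bar> \<le> K * (2 * e)"
    proof (rule packing_average[where a = a])
      show "finite S" using F(1) by (simp add: S_def)
      show "0 \<le> a j \<and> 0 \<le> w j \<and> a j + w j \<le> K" if "j \<in> S" for j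
        using that a[of j] w0[of j] by (auto simp: S_def A2_def)
      show "0 \<le> K" using K by simp
      fix G assume G: "G \<subseteq> S" "\<And>i j. i \<in> G \<Longrightarrow> j \<in> G \<Longrightarrow> i \<noteq> j \<Longrightarrow> a j < a i + w i"
      have GA: "G \<subseteq> A" using G(1) by (auto simp: S_def)
      have dis: "C i \<inter> C j = {}" if "i \<in> G" "j \<in> G" "i \<noteq> j" for i j
      proof (rule ccontr)
        assume "C i \<inter> C j \<noteq> {}"
        then have "a i + w i \<le> a j \<or> a j + w j \<le> a i" using sep[of i j] that GA by blast
        moreover have "a j < a i + w i" "a i < a j + w j" using G(2) that by auto
        ultimately show False by linarith
      qed
      \<comment> \<open>The disjoint cells of \<open>G\<close> form a Perron family with the tags
        \<open>t\<close> and another one with the tags \<open>s\<close>; the integrals over the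
        cells cancel in the difference.\<close>
      have "\<bar>\<Sum>j\<in>G. len (J j) * h (t j) - integral (J j) h\<bar> \<le> e"
      proof (rule SH)
        show "free_family G t J" by (rule Jfam[OF GA dis F(2)]) (use GA in auto)
        show "fine_family \<delta> G t J" unfolding fine_family_def J_def
          using GA \<delta>(1) cell(2) by (intro ballI ccell_fine[where \<delta> = \<delta>]) auto
        show "t j \<in> J j" if "j \<in> G" for j
          using cell(2)[of j] that GA interior_subset[of "J j"] unfolding J_def interior_ccell by blast
      qed
      moreover have "\<bar>\<Sum>j\<in>G. len (J j) * h (s j) - integral (J j) h\<bar> \<le> e"
      proof (rule SH)
        show "free_family G s J" by (rule Jfam[OF GA dis s01]) (use GA in auto)
        show "fine_family \<delta> G s J" unfolding fine_family_def J_def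
          using GA \<delta>(2) scell by (intro ballI ccell_fine[where \<delta> = \<delta>]) auto
        show "s j \<in> J j" if "j \<in> G" for j
          using scell[of j] that GA interior_subset[of "J j"] unfolding J_def interior_ccell by blast
      qed
      moreover have "(\<Sum>j\<in>G. v j) = (\<Sum>j\<in>G. len (J j) * h (t j) - integral (J j) h)
          - (\<Sum>j\<in>G. len (J j) * h (s j) - integral (J j) h)"
        by (simp add: sum_subtractf v_def J_def len_ccell right_diff_distrib)
      ultimately show "\<bar>\<Sum>j\<in>G. v j\<bar> \<le> 2 * e" by linarith
    qed
    have "\<bar>\<Sum>j\<in>S. len (I j) * h (s j) - integral (I j) h\<bar> \<le> e"
    proof (rule SH)
      have "free_family S t I" by (rule free_family_subset[OF fam]) (simp add: S_def)
      note SF = free_familyD[OF this]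
      show "free_family S s I" by (rule free_familyI[OF SF(1) s01[OF SA] SF(3) SF(4) SF(5)])
      show "fine_family \<delta> S s I" unfolding fine_family_def
      proof
        fix j assume "j \<in> S"
        note j = SA[OF this]
        have "I j \<subseteq> ccell (n j) (t j)"
          using cell(1)[OF j] interior_subset[of "ccell (n j) (t j)"] unfolding interior_ccell by blast
        also have "\<dots> \<subseteq> {s j - \<delta> (s j) <..< s j + \<delta> (s j)}" by (rule ccell_fine[of "s j" "n j" "t j" \<delta>, OF scell[OF j] \<delta>(2)[OF j]])
        finally show "I j \<subseteq> {s j - \<delta> (s j) <..< s j + \<delta> (s j)}" .
      qed
      show "s j \<in> I j" if "j \<in> S" for j by (rule s[OF SA[OF that]])
    qed
    moreover have "(\<Sum>j\<in>S. len (I j) * h (t j) - integral (I j) h) =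
        (\<Sum>j\<in>S. w j * v j) + (\<Sum>j\<in>S. len (I j) * h (s j) - integral (I j) h)"
    proof -
      have "w j * v j = len (I j) * (h (t j) - h (s j))" for j
        unfolding v_def mult.assoc[symmetric] wlen ..
      then show ?thesis by (simp add: sum.distrib[symmetric] right_diff_distrib)
    qed
    ultimately show ?thesis using avg unfolding S_def by linarith
  qed
  show ?thesis
  proof (rule that[OF A2 disc])
    fix h :: "real \<Rightarrow> real" and e :: real
    assume H: "\<And>(B :: 'i set) t I. free_family B t I \<Longrightarrow> fine_family \<delta> B t I \<Longrightarrow> (\<And>j. j \<in> B \<Longrightarrow> t j \<in> I j) \<Longrightarrow>
        \<bar>\<Sum>j\<in>B. len (I j) * h (t j) - integral (I j) h\<bar> \<le> e"
    show "\<bar>\<Sum>j\<in>A - A2. len (I j) * h (t j) - integral (I j) h\<bar> \<le> K * (2 * e) + e"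
      by (rule keep) (rule H)
  qed
qed

lemma sum_half_powers_le:
  assumes "finite F"
  shows "(\<Sum>i\<in>F. (1/2::real) ^ Suc i) \<le> 1"
proof -
  have "(\<Sum>i\<in>F. (1/2::real) ^ Suc i) \<le> (\<Sum>i. (1/2::real) ^ Suc i)"
    by (rule sum_le_suminf[OF sums_summable[OF power_half_series] assms]) simp
  also have "\<dots> = 1" by (rule sums_unique[OF power_half_series, symmetric])
  finally show ?thesis .
qed

lemma equi_absolutely_continuous_family:
  fixes h :: "'z \<Rightarrow> real \<Rightarrow> real" and I :: "'i \<Rightarrow> real set"
  assumes "\<And>\<D>. \<D> division_of \<Union>\<D> \<and> \<Union>\<D> \<subseteq> {0..1} \<and> sum len \<D> < \<eta> \<longrightarrow> (\<forall>z\<in>Z. \<bar>\<Sum>K\<in>\<D>. integral K (h z)\<bar> \<le> e)"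
    and "free_family A t I" "(\<Sum>j\<in>A. len (I j)) < \<eta>" "z \<in> Z"
  shows "\<bar>\<Sum>j\<in>A. integral (I j) (h z)\<bar> \<le> e"
proof -
  have "I ` A division_of \<Union>(I ` A) \<and> \<Union>(I ` A) \<subseteq> {0..1} \<and> sum len (I ` A) < \<eta>"
    using free_family_division[OF assms(2)] free_familyD(3)[OF assms(2)] assms(3)
    unfolding sum_free_family_content[OF assms(2)] by (intro conjI UN_least)
  with assms(1)[of "I ` A"] have "\<forall>z\<in>Z. \<bar>\<Sum>K\<in>I ` A. integral K (h z)\<bar> \<le> e" by (rule mp)
  then have "\<bar>\<Sum>K\<in>I ` A. integral K (h z)\<bar> \<le> e" using assms(4) by (rule bspec)
  then show ?thesis using sum_free_family_integral[OF assms(2), of "h z"] by (simp only:)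
qed

text \<open>The groups are numbered injectively by \<open>c\<close>, so their allowances are
  distinct terms of a geometric series with total \<open>\<sigma>\<close>. The keys will be the
  dyadic tags in one use and the gauge levels in the other.\<close>

lemma sum_len_grouped:
  fixes g :: "'i \<Rightarrow> 'k" and c :: "'k \<Rightarrow> nat"
  assumes "finite A" "inj_on c (g ` A)" "0 \<le> \<sigma>"
    and "\<And>k. k \<in> g ` A \<Longrightarrow> (\<Sum>j\<in>{j \<in> A. g j = k}. f j) \<le> \<sigma> * (1/2) ^ Suc (c k)"
  shows "(\<Sum>j\<in>A. f j) \<le> (\<sigma>::real)"
proof -
  have "(\<Sum>j\<in>A. f j) = (\<Sum>k\<in>g ` A. \<Sum>j\<in>{j \<in> A. g j = k}. f j)"
    using assms(1) by (intro sum.group[symmetric]) auto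
  also have "\<dots> \<le> (\<Sum>k\<in>g ` A. \<sigma> * (1/2) ^ Suc (c k))" by (rule sum_mono[OF assms(4)])
  also have "\<dots> = \<sigma> * (\<Sum>i\<in>c ` g ` A. (1/2) ^ Suc i)"
    by (simp only: sum.reindex[OF assms(2)] sum_distrib_left o_def)
  also have "\<dots> \<le> \<sigma> * 1" using assms(1,3) by (intro mult_left_mono sum_half_powers_le) auto
  finally show ?thesis by simp
qed

lemma countable_dyadic: "countable {t :: real. \<exists>n. t * 2 ^ n \<in> \<int>}"
proof (rule countable_subset)
  show "{t :: real. \<exists>n. t * 2 ^ n \<in> \<int>} \<subseteq> (\<lambda>(n :: nat, i :: int). of_int i / 2 ^ n) ` UNIV"
  proof
    fix t :: real assume "t \<in> {t. \<exists>n. t * 2 ^ n \<in> \<int>}"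
    then obtain n i where "t * 2 ^ n = of_int i" by (auto elim!: Ints_cases)
    then have "t = of_int i / 2 ^ n" by (simp add: field_simps)
    then show "t \<in> (\<lambda>(n :: nat, i :: int). of_int i / 2 ^ n) ` UNIV" by (intro image_eqI[of _ _ "(n, i)"]) auto
  qed
qed simp

text \<open>For small total length the Riemann sum and the integrals are small separately: the
  former by the bound \<open>k\<close> on the values at the tags, the latter by equi-absolute
  continuity.\<close>

lemma small_family_bound:
  fixes h :: "'z \<Rightarrow> real \<Rightarrow> real" and I :: "'i \<Rightarrow> real set"
  assumes ac: "\<And>\<D>. \<D> division_of \<Union>\<D> \<and> \<Union>\<D> \<subseteq> {0..1} \<and> sum len \<D> < \<eta> \<longrightarrow> (\<forall>z\<in>Z. \<bar>\<Sum>K\<in>\<D>. integral K (h z)\<bar> \<le> e)"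
    and fam: "free_family A t I" and small: "(\<Sum>j\<in>A. len (I j)) \<le> \<mu>" "\<mu> < \<eta>" and z: "z \<in> Z"
    and k: "\<And>j. j \<in> A \<Longrightarrow> \<bar>h z (t j)\<bar> \<le> k" "0 \<le> k"
  shows "\<bar>\<Sum>j\<in>A. len (I j) * h z (t j) - integral (I j) (h z)\<bar> \<le> k * \<mu> + e"
proof -
  have "\<bar>\<Sum>j\<in>A. len (I j) * h z (t j)\<bar> \<le> (\<Sum>j\<in>A. len (I j) * k)"
    by (rule order_trans[OF sum_abs sum_mono]) (auto simp: abs_mult intro!: mult_left_mono k)
  also have "\<dots> = k * (\<Sum>j\<in>A. len (I j))" by (simp add: sum_distrib_left mult.commute)
  also have "\<dots> \<le> k * \<mu>" using small(1) k(2) by (rule mult_left_mono)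
  finally have "\<bar>\<Sum>j\<in>A. len (I j) * h z (t j)\<bar> \<le> k * \<mu>" .
  moreover have "\<bar>\<Sum>j\<in>A. integral (I j) (h z)\<bar> \<le> e"
    by (rule equi_absolutely_continuous_family[OF ac fam _ z]) (use small in simp)
  ultimately show ?thesis unfolding sum_subtractf by linarith
qed

\<comment> \<open>Tags are replaced in two steps. A tag \<open>t\<close> whose interval \<open>I\<close> lies in the dyadic cell \<open>J\<close>
  of \<open>t\<close> enters with weight \<open>|I| / |J|\<close>; the part of the family where cells overlap more than \<open>K\<close>
  times has total length at most \<open>1 / K\<close>, and the rest is a \<open>K\<close>-fold average of Perron families.
  This compares \<open>t\<close> with a tag in \<open>I\<close> of the same level, for which \<open>I\<close> itself is a Perron interval.\<close>
lemma mcshane_gauge_bounded: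
  fixes h :: "'z \<Rightarrow> real \<Rightarrow> real"
  assumes H: "equi_henstock h Z" and AC: "equi_absolutely_continuous h Z"
    and E: "E \<subseteq> {0..1}" and k: "\<And>t z. t \<in> E \<Longrightarrow> z \<in> Z \<Longrightarrow> \<bar>h z t\<bar> \<le> k" "0 \<le> k" and \<eta>: "0 < \<eta>"
  shows "\<exists>\<delta>. unit_gauge \<delta> \<and> (\<forall>(A :: 'i set) t I. free_family A t I \<and> fine_family \<delta> A t I \<and> t ` A \<subseteq> E \<longrightarrow>
    (\<forall>z\<in>Z. \<bar>\<Sum>j\<in>A. len (I j) * h z (t j) - integral (I j) (h z)\<bar> \<le> \<eta>))"
proof -
  have "0 < \<eta> / 4" using \<eta> by simp
  with AC obtain \<eta>1 where \<eta>1: "0 < \<eta>1" and ac: "\<And>\<D>. \<D> division_of \<Union>\<D> \<and> \<Union>\<D> \<subseteq> {0..1} \<and> sum len \<D> < \<eta>1 \<longrightarrow>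
      (\<forall>z\<in>Z. \<bar>\<Sum>K\<in>\<D>. integral K (h z)\<bar> \<le> \<eta> / 4)"
    unfolding equi_absolutely_continuous_def by blast
  define \<mu> where "\<mu> = min (\<eta> / (4 * (k + 1))) (\<eta>1 / 2)"
  have \<mu>: "0 < \<mu>" "\<mu> < \<eta>1" using \<eta> \<eta>1 k(2) by (auto simp: \<mu>_def)
  have "k * \<mu> \<le> (k + 1) * (\<eta> / (4 * (k + 1)))" using \<mu>(1) k(2) by (intro mult_mono) (auto simp: \<mu>_def)
  also have "\<dots> = \<eta> / 4"
  proof -
    have "c * (\<eta> / (4 * c)) = \<eta> / 4" if "c \<noteq> 0" for c using that by simp
    from this[of "k + 1"] k(2) show ?thesis by linarith
  qed
  finally have k\<mu>: "k * \<mu> \<le> \<eta> / 4" .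
  \<comment> \<open>Budget of length for the exceptional intervals: \<open>\<sigma>\<close> for
    dyadic tags, \<open>\<sigma>\<close> for intervals containing no point of the level of their
    tag, and \<open>1 / K = \<mu> / 2\<close> for overcrowded cells, together \<open>\<mu>\<close>.
    The later constant \<open>e\<close> is a Henstock error that stays small after multiplication by
    \<open>K\<close>.\<close>
  define \<sigma> where "\<sigma> = \<mu> / 4"
  define K where "K = 2 / \<mu>"
  have K: "0 < K" and \<sigma>: "0 < \<sigma>" using \<mu>(1) by (auto simp: K_def \<sigma>_def)
  define e where "e = \<eta> / (8 * (K + 1))"
  have e: "0 < e" using \<eta> K by (simp add: e_def)
  have "K * (2 * e) + e \<le> 2 * (K + 1) * e" using e by (simp add: algebra_simps)
  also have "\<dots> = \<eta> / 4"
  proof -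
    have "2 * c * (\<eta> / (8 * c)) = \<eta> / 4" if "c \<noteq> 0" for c using that by simp
    from this[of "K + 1"] K show ?thesis unfolding e_def by linarith
  qed
  finally have Ke: "K * (2 * e) + e \<le> \<eta> / 4" .
  obtain \<delta> where \<delta>: "unit_gauge \<delta>" and close: "\<And>p z. p tagged_division_of {0..1} \<Longrightarrow> delta_fine \<delta> p \<Longrightarrow> z \<in> Z \<Longrightarrow>
      \<bar>(\<Sum>(t, I)\<in>p. len I * h z t) - integral {0..1} (h z)\<bar> < e"
    using equi_henstockD[OF H e] by metis
  \<comment> \<open>The level of \<open>t\<close>, with \<open>(1/2) ^ N t\<close> the first dyadic
    length below \<open>\<delta> t\<close>. Two points of one level that share a cell of that level
    can both serve as its tag.\<close>
  define N where "N t = (LEAST n. (1/2::real) ^ n < \<delta> t)" for t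
  have N: "(1/2) ^ N t < \<delta> t" if "t \<in> {0..1}" for t
  proof -
    have "0 < \<delta> t" using \<delta> that by (simp add: unit_gauge_def)
    then have "\<exists>n. (1/2::real) ^ n < \<delta> t" by (rule real_arch_pow_inv) simp
    then show ?thesis unfolding N_def by (rule LeastI_ex)
  qed
  define Q where "Q = {t :: real. \<exists>n. t * 2 ^ n \<in> \<int>}"
  have inj: "inj_on (to_nat_on Q) Q" unfolding Q_def by (rule inj_on_to_nat_on[OF countable_dyadic])
  have cell: "t \<in> dcell n t" "ccell n t \<subseteq> {0..1}" if "t \<in> {0..1}" "t \<notin> Q" for t n
  proof -
    have "t * 2 ^ n \<notin> \<int>" for n using that(2) by (auto simp: Q_def)
    then show "t \<in> dcell n t" "ccell n t \<subseteq> {0..1}" using nondyadic_cell[OF that(1)] by blast+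
  qed
  define D where "D n = {t \<in> E. t \<notin> Q \<and> N t = n}" for n
  have "\<exists>G. open G \<and> D n \<subseteq> G \<and> (\<forall>F. compact F \<and> F \<subseteq> G \<and> F \<inter> D n = {} \<longrightarrow> len F \<le> \<sigma> * (1/2) ^ Suc n)" for n
  proof -
    have "D n \<subseteq> {0..1}" "0 < \<sigma> * (1/2) ^ Suc n" using E \<sigma> by (auto simp: D_def)
    then obtain G where "open G" "D n \<subseteq> G"
      "\<And>F. compact F \<Longrightarrow> F \<subseteq> G \<Longrightarrow> F \<inter> D n = {} \<Longrightarrow> len F \<le> \<sigma> * (1/2) ^ Suc n"
      using outer_open_set by metis
    then show ?thesis by blast
  qed
  then obtain G where G: "\<And>n. open (G n)" "\<And>n. D n \<subseteq> G n"
    "\<And>n F. compact F \<Longrightarrow> F \<subseteq> G n \<Longrightarrow> F \<inter> D n = {} \<Longrightarrow> len F \<le> \<sigma> * (1/2) ^ Suc n"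
    by metis
  have "\<exists>r>0. {t - r <..< t + r} \<subseteq> G (N t) \<inter> dcell (N t) t" if "t \<in> E - Q" for t
  proof -
    have "open (G (N t) \<inter> dcell (N t) t)" using G(1) by (intro open_Int) (auto simp: dcell_def)
    moreover have "t \<in> G (N t) \<inter> dcell (N t) t"
      using that E cell(1)[of t "N t"] G(2)[of "N t"] by (auto simp: D_def)
    ultimately show ?thesis unfolding open_contains_ball ball_eq_greaterThanLessThan by blast
  qed
  then obtain r where r: "\<And>t. t \<in> E - Q \<Longrightarrow> 0 < r t"
    "\<And>t. t \<in> E - Q \<Longrightarrow> {t - r t <..< t + r t} \<subseteq> G (N t) \<inter> dcell (N t) t" by metis
  \<comment> \<open>At a dyadic tag the whole interval of radius \<open>\<delta>' t\<close> has the
    share of \<open>\<sigma>\<close> belonging to its number, whence the division by 2. At other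
    points of \<open>E\<close> fineness puts the interval inside \<open>G (N t)\<close> and inside
    the dyadic cell of \<open>t\<close>. The value 1 is a default outside \<open>E\<close> and
    \<open>Q\<close>.\<close>
  define \<delta>' where "\<delta>' t = (if t \<in> Q then \<sigma> * (1/2) ^ Suc (to_nat_on Q t) / 2 else if t \<in> E then r t else 1)" for t
  have "unit_gauge \<delta>'" using \<sigma> r(1) by (auto simp: unit_gauge_def \<delta>'_def)
  moreover have "\<bar>\<Sum>j\<in>A. len (I j) * h z (t j) - integral (I j) (h z)\<bar> \<le> \<eta>"
    if fam: "free_family A t I" and fine: "fine_family \<delta>' A t I" and tE: "t ` A \<subseteq> E" and z: "z \<in> Z"
    for A :: "'i set" and t I z
  proof -
    note F = free_familyD[OF fam]
    have fineI: "I j \<subseteq> {t j - \<delta>' (t j) <..< t j + \<delta>' (t j)}" if "j \<in> A" for j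
      using fine that unfolding fine_family_def by blast
    have inE: "t j \<in> E" if "j \<in> A" for j using tE that by blast
    \<comment> \<open>Three kinds of members: those with dyadic tags, those whose interval meets no
      point of the level of the tag, and those with such a point \<open>s j\<close>, to which
      \<open>dyadic_core\<close> applies.\<close>
    define A0 where "A0 = {j \<in> A. t j \<in> Q}"
    define A1 where "A1 = {j \<in> A. t j \<notin> Q \<and> I j \<inter> D (N (t j)) = {}}"
    define B where "B = {j \<in> A. t j \<notin> Q \<and> I j \<inter> D (N (t j)) \<noteq> {}}"
    have sub: "A0 \<subseteq> A" "A1 \<subseteq> A" "B \<subseteq> A" by (auto simp: A0_def A1_def B_def)
    have fin: "finite A0" "finite A1" "finite B" using sub F(1) finite_subset by blast+
    have inGC: "I j \<subseteq> G (N (t j)) \<inter> dcell (N (t j)) (t j)" if "j \<in> A" "t j \<notin> Q" for j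
      using fineI[OF that(1)] r(2)[of "t j"] that inE by (auto simp: \<delta>'_def)
    have len0: "(\<Sum>j\<in>A0. len (I j)) \<le> \<sigma>"
    proof (rule sum_len_grouped[where g = t and c = "to_nat_on Q"])
      show "finite A0" by fact
      show "inj_on (to_nat_on Q) (t ` A0)" by (rule inj_on_subset[OF inj]) (auto simp: A0_def)
      show "0 \<le> \<sigma>" using \<sigma> by simp
      fix q assume "q \<in> t ` A0"
      then have q: "q \<in> Q" by (auto simp: A0_def)
      have "(\<Sum>j\<in>{j \<in> A0. t j = q}. len (I j)) \<le> len {q - \<delta>' q .. q + \<delta>' q}"
      proof (rule free_family_content_le)
        show "free_family {j \<in> A0. t j = q} t I" by (rule free_family_subset[OF fam]) (use sub in auto)
        fix j assume "j \<in> {j \<in> A0. t j = q}"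
        then have "I j \<subseteq> {q - \<delta>' q <..< q + \<delta>' q}" using fineI[of j] sub(1) by blast
        then show "I j \<subseteq> {q - \<delta>' q .. q + \<delta>' q}" by (rule order_trans) (auto simp: less_imp_le)
      qed
      also have "\<dots> = \<sigma> * (1/2) ^ Suc (to_nat_on Q q)" using q \<sigma> by (simp add: \<delta>'_def)
      finally show "(\<Sum>j\<in>{j \<in> A0. t j = q}. len (I j)) \<le> \<sigma> * (1/2) ^ Suc (to_nat_on Q q)" .
    qed
    have len1: "(\<Sum>j\<in>A1. len (I j)) \<le> \<sigma>"
    proof (rule sum_len_grouped[where g = "\<lambda>j. N (t j)" and c = id])
      show "finite A1" by fact
      show "0 \<le> \<sigma>" using \<sigma> by simp
      fix n assume "n \<in> (\<lambda>j. N (t j)) ` A1"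
      define S where "S = {j \<in> A1. N (t j) = n}"
      have SA: "S \<subseteq> A" using sub by (auto simp: S_def)
      have "finite S" using SA F(1) by (rule finite_subset)
      \<comment> \<open>For one level the union is compact, contained in \<open>G n\<close> and
        disjoint from \<open>D n\<close>, exactly the situation bounded by the choice of
        \<open>G n\<close>.\<close>
      have "(\<Sum>j\<in>S. len (I j)) = len (\<Union>(I ` S))"
        by (rule free_family_len_Union[OF free_family_subset[OF fam SA]])
      also have "\<dots> \<le> \<sigma> * (1/2) ^ Suc n"
      proof (rule G(3))
        have "compact (I j)" if "j \<in> S" for j using F(4)[of j] SA that by (metis compact_Icc subsetD)
        then show "compact (\<Union>(I ` S))" using \<open>finite S\<close> by (intro compact_UN) auto
        have "I j \<subseteq> G n" if "j \<in> S" for j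
          using that inGC[of j] SA by (auto simp: S_def A1_def)
        then show "\<Union>(I ` S) \<subseteq> G n" by (rule UN_least)
        show "\<Union>(I ` S) \<inter> D n = {}" by (auto simp: S_def A1_def)
      qed
      finally show "(\<Sum>j\<in>{j \<in> A1. N (t j) = n}. len (I j)) \<le> \<sigma> * (1/2) ^ Suc (id n)" by (simp add: S_def)
    qed simp
    have "\<forall>j\<in>B. \<exists>s. s \<in> I j \<inter> D (N (t j))" by (auto simp: B_def)
    then obtain s where s: "\<And>j. j \<in> B \<Longrightarrow> s j \<in> I j \<inter> D (N (t j))" by metis
    have BA: "j \<in> A" "t j \<notin> Q" "t j \<in> {0..1}" if "j \<in> B" for j using that F(2)[of j] by (auto simp: B_def)
    obtain A2 where A2: "A2 \<subseteq> B" "K * (\<Sum>j\<in>A2. len (I j)) \<le> 1"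
      and core: "\<And>h e. (\<And>(B :: 'i set) t I. free_family B t I \<Longrightarrow> fine_family \<delta> B t I \<Longrightarrow> (\<And>j. j \<in> B \<Longrightarrow> t j \<in> I j) \<Longrightarrow>
        \<bar>\<Sum>j\<in>B. len (I j) * h (t j) - integral (I j) h\<bar> \<le> e) \<Longrightarrow>
      \<bar>\<Sum>j\<in>B - A2. len (I j) * h (t j) - integral (I j) h\<bar> \<le> K * (2 * e) + e"
    proof (rule dyadic_core[of B t I "\<lambda>j. N (t j)" s \<delta> K])
      show "free_family B t I" by (rule free_family_subset[OF fam sub(3)])
      fix j assume j: "j \<in> B"
      note jA = BA[OF j]
      show "I j \<subseteq> dcell (N (t j)) (t j)" using inGC[OF jA(1,2)] by blast
      show "t j \<in> dcell (N (t j)) (t j)" "ccell (N (t j)) (t j) \<subseteq> {0..1}" by (rule cell[OF jA(3,2)])+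
      show "s j \<in> I j" using s[OF j] by blast
      show "(1/2) ^ N (t j) < \<delta> (t j)" by (rule N[OF jA(3)])
      \<comment> \<open>\<open>s j\<close> has the level of \<open>t j\<close>, so the cell of
        \<open>t j\<close> is short enough for the gauge at \<open>s j\<close> as well.\<close>
      have "s j \<in> E" "N (s j) = N (t j)" using s[OF j] by (auto simp: D_def)
      then have "s j \<in> {0..1}" "N (s j) = N (t j)" using E by blast+
      then show "(1/2) ^ N (t j) < \<delta> (s j)" using N[of "s j"] by simp
    qed (use K in auto)
    have main: "\<bar>\<Sum>j\<in>B - A2. len (I j) * h z (t j) - integral (I j) (h z)\<bar> \<le> K * (2 * e) + e"
    proof (rule core)
      fix B :: "'i set" and t I
      assume fam: "free_family B t I" "fine_family \<delta> B t I" "\<And>j. j \<in> B \<Longrightarrow> t j \<in> I j"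
      show "\<bar>\<Sum>j\<in>B. len (I j) * h z (t j) - integral (I j) (h z)\<bar> \<le> e"
        by (rule saks_henstock_family[OF equi_henstock_integrable[OF H z] \<delta> e _ fam]) (rule close[OF _ _ z])
    qed
    define T where "T = A0 \<union> A1 \<union> A2"
    have T: "T \<subseteq> A" "A - T = B - A2" using sub A2(1) by (auto simp: T_def A0_def A1_def B_def)
    have finA2: "finite A2" using A2(1) fin(3) by (rule finite_subset)
    have "(\<Sum>j\<in>A2. len (I j)) \<le> 1 / K" using A2(2) K by (simp add: pos_le_divide_eq mult.commute)
    then have "(\<Sum>j\<in>A2. len (I j)) \<le> \<mu> / 2" by (simp add: K_def)
    moreover have "(\<Sum>j\<in>T. len (I j)) \<le> (\<Sum>j\<in>A0. len (I j)) + (\<Sum>j\<in>A1. len (I j)) + (\<Sum>j\<in>A2. len (I j))"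
    proof -
      have "(\<Sum>j\<in>X \<union> Y. len (I j)) \<le> (\<Sum>j\<in>X. len (I j)) + (\<Sum>j\<in>Y. len (I j))" if "finite X" "finite Y" for X Y
        using sum.union_inter[OF that, of "\<lambda>j. len (I j)"] sum_nonneg[of "X \<inter> Y" "\<lambda>j. len (I j)"] by simp
      from this[of "A0 \<union> A1" A2] this[of A0 A1] show ?thesis using fin finA2 unfolding T_def by simp
    qed
    ultimately have lenT: "(\<Sum>j\<in>T. len (I j)) \<le> \<mu>" using len0 len1 by (simp add: \<sigma>_def)
    have "\<bar>\<Sum>j\<in>T. len (I j) * h z (t j) - integral (I j) (h z)\<bar> \<le> k * \<mu> + \<eta> / 4"
      by (rule small_family_bound[OF ac free_family_subset[OF fam T(1)] lenT \<mu>(2) z])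
        (use k z inE T(1) in auto)
    moreover have "(\<Sum>j\<in>A. len (I j) * h z (t j) - integral (I j) (h z)) =
        (\<Sum>j\<in>A - T. len (I j) * h z (t j) - integral (I j) (h z)) + (\<Sum>j\<in>T. len (I j) * h z (t j) - integral (I j) (h z))"
      by (rule sum.subset_diff[OF T(1) F(1)])
    ultimately show ?thesis using main k\<mu> Ke \<eta> unfolding T(2) by linarith
  qed
  ultimately show ?thesis by blast
qed

text \<open>\<open>mcshane_gauge_bounded\<close> works with one bound for all tags. The points are
  sorted by an integer bound \<open>m t\<close>, the gauge at \<open>t\<close> is the one made for
  \<open>m t\<close>, and the errors \<open>(e / 2) * (1/2) ^ Suc k\<close> of the classes add up to
  at most \<open>e / 2\<close>.\<close>

theorem equi_henstock_imp_mcshane: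
  fixes h :: "'z \<Rightarrow> real \<Rightarrow> real"
  assumes H: "equi_henstock h Z" and AC: "equi_absolutely_continuous h Z"
    and bdd: "\<And>t. t \<in> {0..1} \<Longrightarrow> \<exists>b. \<forall>z\<in>Z. \<bar>h z t\<bar> \<le> b"
  shows "equi_mcshane h Z"
  unfolding equi_mcshane_def
proof (intro conjI allI impI)
  fix e :: real assume e: "0 < e"
  have "\<exists>m :: nat. \<forall>z\<in>Z. \<bar>h z t\<bar> \<le> real m" if t: "t \<in> {0..1}" for t
  proof -
    obtain b where b: "\<forall>z\<in>Z. \<bar>h z t\<bar> \<le> b" using bdd[OF t] by blast
    obtain m :: nat where "b \<le> real m" using real_arch_simple by blast
    with b show ?thesis by (intro exI[of _ m]) (auto intro: order_trans)
  qed
  then obtain m where m: "\<And>t z. t \<in> {0..1} \<Longrightarrow> z \<in> Z \<Longrightarrow> \<bar>h z t\<bar> \<le> real (m t)" by metis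
  define E where "E k = {t \<in> {0..1}. m t = k}" for k
  have "\<exists>\<delta>. unit_gauge \<delta> \<and> (\<forall>(A :: (real \<times> real set) set) t I. free_family A t I \<and> fine_family \<delta> A t I \<and> t ` A \<subseteq> E k \<longrightarrow>
    (\<forall>z\<in>Z. \<bar>\<Sum>j\<in>A. len (I j) * h z (t j) - integral (I j) (h z)\<bar> \<le> (e / 2) * (1/2) ^ Suc k))" for k
    by (rule mcshane_gauge_bounded[OF H AC, of _ "real k"]) (use m e in \<open>auto simp: E_def\<close>)
  then have "\<exists>\<delta>. \<forall>k. unit_gauge (\<delta> k) \<and> (\<forall>(A :: (real \<times> real set) set) t I.
      free_family A t I \<and> fine_family (\<delta> k) A t I \<and> t ` A \<subseteq> E k \<longrightarrow>
      (\<forall>z\<in>Z. \<bar>\<Sum>j\<in>A. len (I j) * h z (t j) - integral (I j) (h z)\<bar> \<le> (e / 2) * (1/2) ^ Suc k))"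
    by (intro choice allI)
  then obtain \<delta> where \<delta>b: "\<forall>k. unit_gauge (\<delta> k) \<and> (\<forall>(A :: (real \<times> real set) set) t I.
      free_family A t I \<and> fine_family (\<delta> k) A t I \<and> t ` A \<subseteq> E k \<longrightarrow>
      (\<forall>z\<in>Z. \<bar>\<Sum>j\<in>A. len (I j) * h z (t j) - integral (I j) (h z)\<bar> \<le> (e / 2) * (1/2) ^ Suc k))" ..
  have \<delta>: "unit_gauge (\<delta> k)" for k by (rule conjunct1[OF spec[OF \<delta>b]])
  have bound: "\<bar>\<Sum>j\<in>A. len (I j) * h z (t j) - integral (I j) (h z)\<bar> \<le> (e / 2) * (1/2) ^ Suc k"
    if a: "free_family A t I" "fine_family (\<delta> k) A t I" "t ` A \<subseteq> E k" "z \<in> Z"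
    for k and A :: "(real \<times> real set) set" and t I z
    using conjunct2[OF spec[OF \<delta>b, of k], rule_format, OF conjI[OF a(1) conjI[OF a(2,3)]] a(4)] .
  define \<Delta> where "\<Delta> t = \<delta> (m t) t" for t
  have "\<bar>(\<Sum>(t, I)\<in>p. len I * h z t) - integral {0..1} (h z)\<bar> < e"
    if p: "free_partition p" "delta_fine \<Delta> p" and z: "z \<in> Z" for p z
  proof -
    let ?g = "\<lambda>j. len (snd j) * h z (fst j) - integral (snd j) (h z)"
    note fam = free_partition_family[OF p(1)]
    note fine = delta_fine_family[OF p(2)]
    have finp: "finite p" by (rule free_partitionD(1)[OF p(1)])
    have "(\<Sum>(t, I)\<in>p. len I * h z t) - integral {0..1} (h z) = (\<Sum>j\<in>p. ?g j)"
      unfolding free_partition_integral[OF p(1) equi_henstock_integrable[OF H z], symmetric]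
      by (simp add: case_prod_unfold sum_subtractf)
    also have "\<bar>\<Sum>j\<in>p. ?g j\<bar> = \<bar>\<Sum>k\<in>(m \<circ> fst) ` p. \<Sum>j\<in>{j \<in> p. (m \<circ> fst) j = k}. ?g j\<bar>"
      using finp by (subst sum.group) auto
    also have "\<dots> \<le> (\<Sum>k\<in>(m \<circ> fst) ` p. (e / 2) * (1/2) ^ Suc k)"
    proof (rule order_trans[OF sum_abs sum_mono])
      fix k
      let ?A = "{j \<in> p. (m \<circ> fst) j = k}"
      show "\<bar>\<Sum>j\<in>?A. ?g j\<bar> \<le> (e / 2) * (1/2) ^ Suc k"
      proof (rule bound)
        show "free_family ?A fst snd" by (rule free_family_subset[OF fam]) blast
        show "fine_family (\<delta> k) ?A fst snd" unfolding fine_family_def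
        proof
          fix j assume "j \<in> ?A"
          then have j: "j \<in> p" "m (fst j) = k" by auto
          have "snd j \<subseteq> {fst j - \<Delta> (fst j) <..< fst j + \<Delta> (fst j)}"
            using fine j(1) unfolding fine_family_def by (rule bspec)
          then show "snd j \<subseteq> {fst j - \<delta> k (fst j) <..< fst j + \<delta> k (fst j)}"
            unfolding \<Delta>_def j(2) .
        qed
        show "fst ` ?A \<subseteq> E k" using free_partitionD(2)[OF p(1)] by (auto simp: E_def)
      qed (rule z)
    qed
    also have "\<dots> = (e / 2) * (\<Sum>k\<in>(m \<circ> fst) ` p. (1/2) ^ Suc k)" by (simp only: sum_distrib_left)
    also have "\<dots> \<le> (e / 2) * 1" using finp e by (intro mult_left_mono sum_half_powers_le) auto
    finally show ?thesis using e by simp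
  qed
  moreover have "unit_gauge \<Delta>" using \<delta> by (simp add: unit_gauge_def \<Delta>_def)
  ultimately show "\<exists>\<delta>. unit_gauge \<delta> \<and> (\<forall>p. free_partition p \<and> delta_fine \<delta> p \<longrightarrow>
      (\<forall>z\<in>Z. \<bar>(\<Sum>(t, I)\<in>p. len I * h z t) - integral {0..1} (h z)\<bar> < e))"
    by (intro exI[of _ \<Delta>]) simp
qed (use equi_henstock_integrable[OF H] in blast)

section \<open>Lebesgue integrals over measurable sets\<close>

abbreviation LI :: "real set \<Rightarrow> (real \<Rightarrow> real) \<Rightarrow> real" where
  "LI A h \<equiv> set_lebesgue_integral lebesgue A h"

lemma absolutely_integrable_subset01:
  assumes "h absolutely_integrable_on {0..1::real}" "A \<in> sets lebesgue" "A \<subseteq> {0..1}"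
  shows "h absolutely_integrable_on A"
  by (rule set_integrable_subset[OF assms])

lemma absolutely_integrable_abs01:
  fixes h :: "real \<Rightarrow> real"
  assumes "h absolutely_integrable_on A"
  shows "(\<lambda>x. \<bar>h x\<bar>) absolutely_integrable_on A"
  using set_integrable_norm[OF assms] by simp

text \<open>Truncation: by dominated convergence the excess of the absolute value of
  \<open>h\<close> over \<open>n\<close> has integral below \<open>\<epsilon> / 2\<close> for some
  \<open>n\<close>, and the rest contributes at most \<open>n\<close> times the measure of
  \<open>A\<close>.\<close>

lemma LI_abs_continuous:
  fixes h :: "real \<Rightarrow> real"
  assumes h: "h absolutely_integrable_on {0..1}" and \<epsilon>: "0 < \<epsilon>"
  obtains \<rho> where "0 < \<rho>" "\<And>A. A \<in> sets lebesgue \<Longrightarrow> A \<subseteq> {0..1} \<Longrightarrow> measure lebesgue A < \<rho> \<Longrightarrow> LI A (\<lambda>x. \<bar>h x\<bar>) \<le> \<epsilon>"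
proof -
  define f where "f x = indicat_real {0..1} x * \<bar>h x\<bar>" for x
  have f0: "0 \<le> f x" for x by (simp add: f_def)
  have fi: "integrable lebesgue f"
    using absolutely_integrable_abs01[OF h] unfolding set_integrable_def f_def by simp
  note [measurable] = borel_measurable_integrable[OF fi]
  have "(\<lambda>n. LINT x|lebesgue. max (f x - real n) 0) \<longlonglongrightarrow> (LINT x|(lebesgue :: real measure). 0)"
  proof (rule integral_dominated_convergence[where w = f and f = "\<lambda>_. 0" and s = "\<lambda>n x. max (f x - real n) 0"])
    show "AE x in lebesgue. (\<lambda>n. max (f x - real n) 0) \<longlonglongrightarrow> 0"
    proof (rule AE_I2)
      fix x
      obtain N :: nat where "f x \<le> real N" using real_arch_simple by blast
      then have "max (f x - real n) 0 = 0" if "N \<le> n" for n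
        using that by (simp add: max_def)
      then show "(\<lambda>n. max (f x - real n) 0) \<longlonglongrightarrow> 0"
        by (intro tendsto_eventually) (auto simp: eventually_sequentially)
    qed
    show "AE x in lebesgue. norm (max (f x - real n) 0) \<le> f x" for n
      using f0 by (intro AE_I2) (auto simp: max_def)
  qed (use fi in auto)
  then have "\<forall>\<^sub>F n in sequentially. (LINT x|lebesgue. max (f x - real n) 0) < \<epsilon> / 2"
    using \<epsilon> by (intro order_tendstoD(2)) auto
  then obtain n where n: "(LINT x|lebesgue. max (f x - real n) 0) < \<epsilon> / 2"
    by (auto simp: eventually_sequentially)
  have mi: "integrable lebesgue (\<lambda>x. max (f x - real n) 0)"
    by (rule Bochner_Integration.integrable_bound[OF fi]) (use f0 in \<open>auto simp: max_def\<close>)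
  define \<rho> where "\<rho> = \<epsilon> / (2 * (real n + 1))"
  have \<rho>: "0 < \<rho>" "real n * \<rho> \<le> \<epsilon> / 2" using \<epsilon> by (auto simp: \<rho>_def field_simps)
  show ?thesis
  proof (rule that[OF \<rho>(1)])
    fix A :: "real set" assume A: "A \<in> sets lebesgue" "A \<subseteq> {0..1}" "measure lebesgue A < \<rho>"
    have "bounded A" using bounded_subset[OF _ A(2)] by simp
    then have lm: "A \<in> lmeasurable" using A(1) by (rule bounded_set_imp_lmeasurable)
    have ii: "integrable lebesgue (\<lambda>x. real n * indicat_real A x)"
      by (intro integrable_mult_right integrable_real_indicator A(1)) (use lm in \<open>auto simp: fmeasurable_def\<close>)
    have "LI A (\<lambda>x. \<bar>h x\<bar>) \<le> (LINT x|lebesgue. max (f x - real n) 0 + real n * indicat_real A x)"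
      unfolding set_lebesgue_integral_def
    proof (rule integral_mono)
      show "integrable lebesgue (\<lambda>x. indicat_real A x *\<^sub>R \<bar>h x\<bar>)"
        using absolutely_integrable_subset01[OF absolutely_integrable_abs01[OF h] A(1,2)]
        unfolding set_integrable_def .
      show "integrable lebesgue (\<lambda>x. max (f x - real n) 0 + real n * indicat_real A x)"
        by (intro Bochner_Integration.integrable_add mi ii)
      fix x
      show "indicat_real A x *\<^sub>R \<bar>h x\<bar> \<le> max (f x - real n) 0 + real n * indicat_real A x"
        using A(2) by (cases "x \<in> A") (auto simp: f_def)
    qed
    also have "\<dots> = (LINT x|lebesgue. max (f x - real n) 0) + real n * measure lebesgue A"
      using mi ii A(1) by (subst Bochner_Integration.integral_add) auto
    also have "real n * measure lebesgue A \<le> real n * \<rho>" using A(3) by (intro mult_left_mono) auto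
    finally show "LI A (\<lambda>x. \<bar>h x\<bar>) \<le> \<epsilon>" using n \<rho>(2) by linarith
  qed
qed

lemma LI_diff_le:
  fixes h :: "real \<Rightarrow> real"
  assumes h: "h absolutely_integrable_on {0..1}" and A: "A \<in> sets lebesgue" "A \<subseteq> {0..1}"
    and E: "E \<in> sets lebesgue" "E \<subseteq> {0..1}"
  shows "\<bar>LI A h - LI E h\<bar> \<le> LI ((A - E) \<union> (E - A)) (\<lambda>x. \<bar>h x\<bar>)"
proof -
  have AE: "(A - E) \<union> (E - A) \<in> sets lebesgue" "(A - E) \<union> (E - A) \<subseteq> {0..1}" using A E by auto
  have ia: "integrable lebesgue (\<lambda>x. indicat_real A x *\<^sub>R h x)" "integrable lebesgue (\<lambda>x. indicat_real E x *\<^sub>R h x)"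
    using absolutely_integrable_subset01[OF h] A E unfolding set_integrable_def by blast+
  have "LI A h - LI E h = (LINT x|lebesgue. indicat_real A x *\<^sub>R h x - indicat_real E x *\<^sub>R h x)"
    unfolding set_lebesgue_integral_def by (rule Bochner_Integration.integral_diff[OF ia, symmetric])
  also have "\<bar>\<dots>\<bar> \<le> (LINT x|lebesgue. \<bar>indicat_real A x *\<^sub>R h x - indicat_real E x *\<^sub>R h x\<bar>)"
    by (rule integral_abs_bound)
  also have "(\<lambda>x. \<bar>indicat_real A x *\<^sub>R h x - indicat_real E x *\<^sub>R h x\<bar>) =
      (\<lambda>x. indicat_real ((A - E) \<union> (E - A)) x *\<^sub>R \<bar>h x\<bar>)"
    by (rule ext) (auto simp: indicator_def)
  finally show ?thesis unfolding set_lebesgue_integral_def .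
qed

lemma LI_division:
  fixes h :: "real \<Rightarrow> real"
  assumes h: "h absolutely_integrable_on {0..1}" and D: "\<D> division_of E" "E \<subseteq> {0..1}"
  shows "LI E h = (\<Sum>K\<in>\<D>. integral K h)"
proof -
  have E: "E \<in> sets lebesgue" using lmeasurable_division[OF D(1)] by (simp add: fmeasurable_def)
  note hE = absolutely_integrable_subset01[OF h E D(2)]
  show ?thesis
    unfolding set_lebesgue_integral_eq_integral(2)[OF hE]
    by (rule integral_combine_division_topdown[OF set_lebesgue_integral_eq_integral(1)[OF hE] D(1)])
qed

lemma sum_len_division: "\<D> division_of E \<Longrightarrow> sum len \<D> = measure lebesgue E"
proof -
  assume D: "\<D> division_of E"
  have "sum len \<D> = (\<Sum>K\<in>\<D>. measure lebesgue K)"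
  proof (rule sum.cong[OF refl], rule measure_completion[symmetric])
    fix K assume "K \<in> \<D>"
    then obtain a b where "K = cbox a b" using division_ofD(4)[OF D] by blast
    then show "K \<in> sets lborel" by simp
  qed
  then show ?thesis using content_division[OF D] by simp
qed

text \<open>Between a closed \<open>F\<close> inside \<open>A\<close> and an open \<open>T\<close>
  around \<open>A\<close>, both close to \<open>A\<close> in measure, compactness of
  \<open>F\<close> inserts a finite union of intervals; its symmetric difference with
  \<open>A\<close> lies in the two gaps.\<close>

lemma division_approximation:
  assumes A: "A \<in> sets lebesgue" "A \<subseteq> {0..1::real}" and \<rho>: "0 < \<rho>"
  obtains \<D> E where "\<D> division_of E" "E \<subseteq> {0..1}" "E \<in> sets lebesgue" "measure lebesgue ((A - E) \<union> (E - A)) < \<rho>"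
proof -
  have \<rho>2: "0 < \<rho> / 2" using \<rho> by simp
  obtain T where T: "open T" "A \<subseteq> T" "T - A \<in> lmeasurable" "emeasure lebesgue (T - A) < ennreal (\<rho> / 2)"
    by (rule sets_lebesgue_outer_open[OF A(1) \<rho>2])
  obtain F where F: "closed F" "F \<subseteq> A" "A - F \<in> lmeasurable" "emeasure lebesgue (A - F) < ennreal (\<rho> / 2)"
    by (rule sets_lebesgue_inner_closed[OF A(1) \<rho>2])
  have mT: "measure lebesgue (T - A) < \<rho> / 2" "measure lebesgue (A - F) < \<rho> / 2"
    using T(3,4) F(3,4) \<rho>2 by (simp_all add: emeasure_eq_measure2 ennreal_less_iff)
  have "bounded F" using bounded_subset[of "{0..1::real}" F] F(2) A(2) by auto
  then have cF: "compact F" using F(1) by (simp add: compact_eq_bounded_closed)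
  have "\<exists>r>0. cball x r \<subseteq> T" if "x \<in> F" for x
    using T(1,2) F(2) that open_contains_cball[of T] by blast
  then obtain r where r: "\<And>x. x \<in> F \<Longrightarrow> 0 < r x" "\<And>x. x \<in> F \<Longrightarrow> cball x (r x) \<subseteq> T" by metis
  have "F \<subseteq> (\<Union>x\<in>F. ball x (r x))" using r(1) by force
  then obtain X where X: "X \<subseteq> F" "finite X" "F \<subseteq> (\<Union>x\<in>X. ball x (r x))"
    using compactE_image[OF cF, of F "\<lambda>x. ball x (r x)"] by auto
  define \<F> where "\<F> = (\<lambda>x. cbox (max 0 (x - r x)) (min 1 (x + r x))) ` X"
  have eq: "cbox (max 0 (x - r x)) (min 1 (x + r x)) = cball x (r x) \<inter> {0..1}" for x
    by (auto simp: cbox_interval cball_eq_atLeastAtMost)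
  obtain \<D> where \<D>: "\<D> division_of \<Union>\<F>"
    by (rule elementary_unions_intervals[of \<F>]) (use X(2) in \<open>auto simp: \<F>_def\<close>)
  let ?E = "\<Union>\<F>"
  have E01: "?E \<subseteq> {0..1}" unfolding \<F>_def eq by blast
  have ET: "?E \<subseteq> T" unfolding \<F>_def eq using r(2) X(1) by blast
  have FE: "F \<subseteq> ?E"
  proof
    fix y assume y: "y \<in> F"
    then obtain x where "x \<in> X" "y \<in> ball x (r x)" using X(3) by blast
    moreover have "y \<in> {0..1}" using y F(2) A(2) by blast
    ultimately show "y \<in> ?E" unfolding \<F>_def eq using ball_subset_cball by blast
  qed
  have Es: "?E \<in> sets lebesgue" using lmeasurable_division[OF \<D>] by (simp add: fmeasurable_def)
  have "measure lebesgue ((A - ?E) \<union> (?E - A)) \<le> measure lebesgue ((T - A) \<union> (A - F))"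
    by (rule measure_mono_fmeasurable) (use FE ET A(1) Es T(3) F(3) in auto)
  also have "\<dots> \<le> measure lebesgue (T - A) + measure lebesgue (A - F)"
    using T(3) F(3) by (intro measure_Un_le) auto
  finally have "measure lebesgue ((A - ?E) \<union> (?E - A)) < \<rho>" using mT by linarith
  then show ?thesis using that[OF \<D> E01 Es] by blast
qed

lemma lmeasurable01: "B \<in> sets lebesgue \<Longrightarrow> B \<subseteq> {0..1} \<Longrightarrow> B \<in> lmeasurable" for B :: "real set"
  using bounded_subset[of "{0..1::real}" B] by (intro bounded_set_imp_lmeasurable) auto

text \<open>The modulus \<open>\<eta>\<close> comes from divisions and is common to the family. The
  approximation of \<open>A\<close> by intervals may depend on \<open>z\<close>, since its error is
  only the auxiliary \<open>\<kappa>\<close> that is sent to zero.\<close>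

lemma equi_absolutely_continuous_LI:
  fixes h :: "'z \<Rightarrow> real \<Rightarrow> real"
  assumes AC: "equi_absolutely_continuous h Z" and h: "\<And>z. z \<in> Z \<Longrightarrow> h z absolutely_integrable_on {0..1}"
    and e: "0 < e"
  obtains \<eta> where "0 < \<eta>" "\<And>A z. A \<in> sets lebesgue \<Longrightarrow> A \<subseteq> {0..1} \<Longrightarrow> measure lebesgue A < \<eta> \<Longrightarrow> z \<in> Z \<Longrightarrow> \<bar>LI A (h z)\<bar> \<le> e"
proof -
  obtain \<eta> where \<eta>: "0 < \<eta>" and ac: "\<And>\<D>. \<D> division_of \<Union>\<D> \<and> \<Union>\<D> \<subseteq> {0..1} \<and> sum len \<D> < \<eta> \<longrightarrow>
      (\<forall>z\<in>Z. \<bar>\<Sum>K\<in>\<D>. integral K (h z)\<bar> \<le> e)"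
    using AC e unfolding equi_absolutely_continuous_def by blast
  show ?thesis
  proof (rule that[OF \<eta>])
    fix A :: "real set" and z assume A: "A \<in> sets lebesgue" "A \<subseteq> {0..1}" "measure lebesgue A < \<eta>" and z: "z \<in> Z"
    show "\<bar>LI A (h z)\<bar> \<le> e"
    proof (rule field_le_epsilon)
      fix \<kappa> :: real assume "0 < \<kappa>"
      then obtain \<rho> where \<rho>: "0 < \<rho>" "\<And>B. B \<in> sets lebesgue \<Longrightarrow> B \<subseteq> {0..1} \<Longrightarrow> measure lebesgue B < \<rho> \<Longrightarrow>
          LI B (\<lambda>x. \<bar>h z x\<bar>) \<le> \<kappa>"
        using LI_abs_continuous[OF h[OF z]] by metis
      \<comment> \<open>The second entry keeps the measure of the approximating set below
        \<open>\<eta>\<close>, the first keeps the change of the integral below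
        \<open>\<kappa>\<close>.\<close>
      have "0 < min \<rho> (\<eta> - measure lebesgue A)" using \<rho>(1) A(3) by simp
      then obtain \<D> E where E: "\<D> division_of E" "E \<subseteq> {0..1}" "E \<in> sets lebesgue"
          "measure lebesgue ((A - E) \<union> (E - A)) < min \<rho> (\<eta> - measure lebesgue A)"
        by (rule division_approximation[OF A(1,2)])
      have SD: "(A - E) \<union> (E - A) \<in> sets lebesgue" "(A - E) \<union> (E - A) \<subseteq> {0..1}" using A E by auto
      have "measure lebesgue E \<le> measure lebesgue (A \<union> ((A - E) \<union> (E - A)))"
        by (rule measure_mono_fmeasurable) (use E A SD in \<open>auto intro!: lmeasurable01\<close>)
      also have "\<dots> \<le> measure lebesgue A + measure lebesgue ((A - E) \<union> (E - A))"
        using A SD by (intro measure_Un_le) auto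
      finally have "sum len \<D> < \<eta>" unfolding sum_len_division[OF E(1)] using E(4) by simp
      moreover have "\<D> division_of \<Union>\<D>" "\<Union>\<D> \<subseteq> {0..1}"
        using E(1,2) division_ofD(6)[OF E(1)] by auto
      ultimately have "\<bar>LI E (h z)\<bar> \<le> e" unfolding LI_division[OF h[OF z] E(1,2)] using ac z by blast
      moreover have "\<bar>LI A (h z) - LI E (h z)\<bar> \<le> \<kappa>"
        by (rule order_trans[OF LI_diff_le[OF h[OF z] A(1,2) E(3,2)] \<rho>(2)[OF SD]]) (use E(4) in simp)
      ultimately show "\<bar>LI A (h z)\<bar> \<le> e + \<kappa>" by linarith
    qed
  qed
qed

section \<open>Support functions and the Hausdorff distance\<close>

lemma bounded_bdd_above_blinfun:
  fixes f :: "'a::real_normed_vector \<Rightarrow>\<^sub>L real"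
  assumes "bounded C"
  shows "bdd_above (blinfun_apply f ` C)"
  by (intro bounded_imp_bdd_above bounded_linear_image assms blinfun.bounded_linear_right)

text \<open>Minkowski sums of values of \<open>\<Gamma>\<close> enter only as nonempty bounded
  convex sets, so the calculus of support functions is set up for bounded sets.\<close>

lemma support_fun_ge:
  assumes "bounded C" "c \<in> C"
  shows "blinfun_apply f c \<le> support_fun f C"
  unfolding support_fun_def by (rule cSUP_upper[OF assms(2) bounded_bdd_above_blinfun[OF assms(1)]])

lemma cwk_imp_bounded: "C \<in> cwk \<Longrightarrow> bounded C" for C :: "'a::banach set"
  using cwk_bounded[of C] by (metis boundedI)

lemma support_fun_image_scaleR:
  assumes "C \<noteq> {}" "bounded C" "0 \<le> a"
  shows "support_fun f ((\<lambda>x. a *\<^sub>R x) ` C) = a * support_fun f C"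
proof (cases "a = 0")
  case True
  have "(\<lambda>x. a *\<^sub>R x) ` C = {0}" using assms(1) True by auto
  then show ?thesis using True by (simp add: support_fun_def blinfun.zero_right)
next
  case False
  then have a: "0 < a" using assms(3) by simp
  have b: "bounded ((\<lambda>x. a *\<^sub>R x) ` C)" by (rule bounded_scaling[OF assms(2)])
  show ?thesis
  proof (rule antisym)
    show "support_fun f ((\<lambda>x. a *\<^sub>R x) ` C) \<le> a * support_fun f C"
      using assms support_fun_ge[OF assms(2), of _ f]
      by (intro support_fun_least) (auto simp: blinfun.scaleR_right intro!: mult_left_mono)
    have "support_fun f C \<le> support_fun f ((\<lambda>x. a *\<^sub>R x) ` C) / a"
    proof (rule support_fun_least[OF assms(1)])
      fix c assume "c \<in> C"
      then have "blinfun_apply f (a *\<^sub>R c) \<le> support_fun f ((\<lambda>x. a *\<^sub>R x) ` C)" by (intro support_fun_ge[OF b]) auto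
      then show "blinfun_apply f c \<le> support_fun f ((\<lambda>x. a *\<^sub>R x) ` C) / a"
        using a by (simp add: blinfun.scaleR_right pos_le_divide_eq mult.commute)
    qed
    then show "a * support_fun f C \<le> support_fun f ((\<lambda>x. a *\<^sub>R x) ` C)"
      using a by (simp add: pos_le_divide_eq mult.commute)
  qed
qed

lemma bounded_set_plus:
  fixes A B :: "'a::real_normed_vector set"
  assumes "bounded A" "bounded B"
  shows "bounded (A + B)"
  using bounded_plus[OF assms] by (simp add: set_plus_image)

lemma support_fun_set_plus:
  assumes A: "A \<noteq> {}" "bounded A" and B: "B \<noteq> {}" "bounded B"
  shows "support_fun f (A + B) = support_fun f A + support_fun f B"
proof (rule antisym)
  have ne: "A + B \<noteq> {}" using A(1) B(1) by (auto simp: set_plus_def)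
  show "support_fun f (A + B) \<le> support_fun f A + support_fun f B"
    using support_fun_ge[OF A(2), of _ f] support_fun_ge[OF B(2), of _ f]
    by (intro support_fun_least[OF ne]) (auto simp: set_plus_def blinfun.add_right intro!: add_mono)
  have "blinfun_apply f a + blinfun_apply f b \<le> support_fun f (A + B)" if "a \<in> A" "b \<in> B" for a b
    using support_fun_ge[OF bounded_set_plus[OF A(2) B(2)], of "a + b" f] set_plus_intro[OF that]
    by (simp add: blinfun.add_right)
  then have "support_fun f A \<le> support_fun f (A + B) - blinfun_apply f b" if "b \<in> B" for b
    using that by (intro support_fun_least[OF A(1)]) (simp add: le_diff_eq)
  then have "support_fun f B \<le> support_fun f (A + B) - support_fun f A"
    by (intro support_fun_least[OF B(1)]) (simp add: le_diff_eq add.commute)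
  then show "support_fun f A + support_fun f B \<le> support_fun f (A + B)" by simp
qed

lemma mf_riemann_sum_properties:
  fixes \<Gamma> :: "real \<Rightarrow> 'a::banach set"
  assumes "finite p" "\<And>j. j \<in> p \<Longrightarrow> \<Gamma> (fst j) \<in> cwk"
  shows "mf_riemann_sum \<Gamma> p \<noteq> {} \<and> bounded (mf_riemann_sum \<Gamma> p) \<and> convex (mf_riemann_sum \<Gamma> p) \<and>
    (\<forall>f. support_fun f (mf_riemann_sum \<Gamma> p) = (\<Sum>(t, I)\<in>p. len I * support_fun f (\<Gamma> t)))"
  using assms
proof (induction p rule: finite_induct)
  case empty
  show ?case by (simp add: mf_riemann_sum_def support_fun_def blinfun.zero_right)
next
  case (insert j p)
  obtain t I where j: "j = (t, I)" by fastforce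
  have C: "\<Gamma> t \<in> cwk" using insert.prems[of j] by (simp add: j)
  note C' = cwkD(1,2)[OF C] cwk_imp_bounded[OF C]
  let ?C = "(\<lambda>x. len I *\<^sub>R x) ` \<Gamma> t"
  have sum: "mf_riemann_sum \<Gamma> (insert j p) = ?C + mf_riemann_sum \<Gamma> p"
    unfolding mf_riemann_sum_def using insert.hyps by (simp add: j)
  have Cp: "?C \<noteq> {}" "bounded ?C" "convex ?C"
    using C' by (auto intro: bounded_scaling convex_scaling)
  have IH: "mf_riemann_sum \<Gamma> p \<noteq> {}" "bounded (mf_riemann_sum \<Gamma> p)" "convex (mf_riemann_sum \<Gamma> p)"
    "\<And>f. support_fun f (mf_riemann_sum \<Gamma> p) = (\<Sum>(t, I)\<in>p. len I * support_fun f (\<Gamma> t))"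
    using insert.IH insert.prems by auto
  have "support_fun f (?C + mf_riemann_sum \<Gamma> p) = (\<Sum>(t, I)\<in>insert j p. len I * support_fun f (\<Gamma> t))" for f
    using insert.hyps C'
    by (simp add: support_fun_set_plus[OF Cp(1,2) IH(1,2)] IH(4) support_fun_image_scaleR j)
  moreover have "?C + mf_riemann_sum \<Gamma> p \<noteq> {}" using Cp(1) IH(1) by (auto simp: set_plus_def)
  moreover have "bounded (?C + mf_riemann_sum \<Gamma> p)" by (rule bounded_set_plus[OF Cp(2) IH(2)])
  moreover have "convex (?C + mf_riemann_sum \<Gamma> p)" by (rule convex_set_plus[OF Cp(3) IH(3)])
  ultimately show ?case unfolding sum by blast
qed

lemma support_fun_le_infdist:
  fixes A B :: "'a::real_normed_vector set"
  assumes B: "B \<noteq> {}" "bounded B" and f: "norm f \<le> 1"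
  shows "blinfun_apply f a \<le> support_fun f B + infdist a B"
proof -
  have "blinfun_apply f a - support_fun f B \<le> dist a b" if "b \<in> B" for b
    using support_fun_ge[OF B(2) that, of f] blinfun_apply_le_norm[OF f, of "a - b"]
    by (simp add: blinfun.diff_right dist_norm)
  then have "blinfun_apply f a - support_fun f B \<le> infdist a B"
    unfolding infdist_notempty[OF B(1)] by (intro cINF_greatest[OF B(1)])
  then show ?thesis by simp
qed

lemma bdd_above_infdist:
  fixes A B :: "'a::real_normed_vector set"
  assumes "bounded A" "B \<noteq> {}"
  shows "bdd_above ((\<lambda>a. infdist a B) ` A)"
proof -
  obtain b where b: "b \<in> B" using assms(2) by blast
  obtain M where M: "\<And>a. a \<in> A \<Longrightarrow> dist b a \<le> M" using bounded_any_center[of A b] assms(1) by blast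
  show ?thesis
    using M infdist_le[OF b] by (intro bdd_aboveI2[of _ _ M]) (metis dist_commute order_trans)
qed

lemma support_fun_le_hausdorff:
  fixes A B :: "'a::real_normed_vector set"
  assumes A: "A \<noteq> {}" "bounded A" and B: "B \<noteq> {}" "bounded B" and f: "norm f \<le> 1"
  shows "support_fun f A \<le> support_fun f B + hausdorff_distance A B"
    "support_fun f B \<le> support_fun f A + hausdorff_distance A B"
proof -
  have "infdist a B \<le> hausdorff_distance A B" if "a \<in> A" for a
    unfolding hausdorff_distance_def
    by (rule order_trans[OF cSUP_upper[OF that bdd_above_infdist[OF A(2) B(1)]] max.cobounded1])
  then show "support_fun f A \<le> support_fun f B + hausdorff_distance A B"
    using support_fun_le_infdist[OF B f]
    by (intro support_fun_least[OF A(1)]) (meson add_left_mono order_trans)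
  have "infdist b A \<le> hausdorff_distance A B" if "b \<in> B" for b
    unfolding hausdorff_distance_def
    by (rule order_trans[OF cSUP_upper[OF that bdd_above_infdist[OF B(2) A(1)]] max.cobounded2])
  then show "support_fun f B \<le> support_fun f A + hausdorff_distance A B"
    using support_fun_le_infdist[OF A f]
    by (intro support_fun_least[OF B(1)]) (meson add_left_mono order_trans)
qed

lemma infdist_le_support_fun:
  fixes B :: "'a::real_normed_vector set"
  assumes B: "convex B" "B \<noteq> {}" and le: "\<And>f. norm f \<le> 1 \<Longrightarrow> blinfun_apply f a \<le> support_fun f B + e"
  shows "infdist a B \<le> e"
proof -
  obtain f :: "'a \<Rightarrow>\<^sub>L real" where f: "norm f \<le> 1" "\<And>b. b \<in> B \<Longrightarrow> blinfun_apply f b + infdist a B \<le> blinfun_apply f a"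
    using separation_infdist[OF B] by metis
  have "support_fun f B \<le> blinfun_apply f a - infdist a B"
    using f(2) by (intro support_fun_least[OF B(2)]) (simp add: le_diff_eq)
  with le[OF f(1)] show ?thesis by linarith
qed

text \<open>Separation with the distance as gap gives each half. Together with
  \<open>support_fun_le_hausdorff\<close> this is Hormander's formula: the Hausdorff distance of
  bounded convex sets is the uniform distance of their support functions on the dual unit
  ball.\<close>

lemma hausdorff_le_support_fun:
  fixes A B :: "'a::real_normed_vector set"
  assumes A: "A \<noteq> {}" "bounded A" "convex A" and B: "B \<noteq> {}" "bounded B" "convex B"
    and le: "\<And>f. norm f \<le> 1 \<Longrightarrow> \<bar>support_fun f A - support_fun f B\<bar> \<le> e"
  shows "hausdorff_distance A B \<le> e"
proof -
  have "infdist a B \<le> e" if a: "a \<in> A" for a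
  proof (rule infdist_le_support_fun[OF B(3,1)])
    fix f :: "'a \<Rightarrow>\<^sub>L real" assume "norm f \<le> 1"
    from le[OF this] show "blinfun_apply f a \<le> support_fun f B + e"
      using support_fun_ge[OF A(2) a, of f] by linarith
  qed
  moreover have "infdist b A \<le> e" if b: "b \<in> B" for b
  proof (rule infdist_le_support_fun[OF A(3,1)])
    fix f :: "'a \<Rightarrow>\<^sub>L real" assume "norm f \<le> 1"
    from le[OF this] show "blinfun_apply f b \<le> support_fun f A + e"
      using support_fun_ge[OF B(2) b, of f] by linarith
  qed
  ultimately show ?thesis
    unfolding hausdorff_distance_def using A(1) B(1) by (intro max.boundedI cSUP_least) auto
qed

section \<open>Integrability expressed through support functions\<close>

lemma equi_henstockI:
  fixes h :: "'z \<Rightarrow> real \<Rightarrow> real"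
  assumes "\<And>e. 0 < e \<Longrightarrow> \<exists>\<delta>. unit_gauge \<delta> \<and> (\<forall>p. p tagged_division_of {0..1} \<and> delta_fine \<delta> p \<longrightarrow>
      (\<forall>z\<in>Z. \<bar>(\<Sum>(t, I)\<in>p. len I * h z t) - J z\<bar> < e))"
  shows "equi_henstock h Z" "\<And>z. z \<in> Z \<Longrightarrow> integral {0..1} (h z) = J z"
proof -
  have hi: "(h z has_integral J z) {0..1}" if z: "z \<in> Z" for z
  proof -
    have "(h z has_integral J z) (cbox 0 1)"
      unfolding has_integral[of "h z" "J z"]
    proof (intro allI impI)
      fix e :: real assume "0 < e"
      then obtain \<delta> where \<delta>: "unit_gauge \<delta>" and close: "\<forall>p. p tagged_division_of {0..1} \<and> delta_fine \<delta> p \<longrightarrow>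
          (\<forall>z\<in>Z. \<bar>(\<Sum>(t, I)\<in>p. len I * h z t) - J z\<bar> < e)"
        using assms by blast
      show "\<exists>\<gamma>. gauge \<gamma> \<and> (\<forall>\<D>. \<D> tagged_division_of cbox 0 1 \<and> \<gamma> fine \<D> \<longrightarrow>
          norm ((\<Sum>(x, k)\<in>\<D>. len k *\<^sub>R h z x) - J z) < e)"
      proof (intro exI conjI allI impI)
        show "gauge (\<lambda>t. if t \<in> {0..1} then {t - \<delta> t <..< t + \<delta> t} else UNIV)" by (rule unit_gauge_gauge[OF \<delta>])
        fix p assume p: "p tagged_division_of cbox 0 1 \<and> (\<lambda>t. if t \<in> {0..1} then {t - \<delta> t <..< t + \<delta> t} else UNIV) fine p"
        then have p1: "p tagged_division_of {0..1}" by (simp add: cbox_interval)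
        have "t \<in> {0..1}" if "(t, K) \<in> p" for t K
          using tagged_division_ofD(3)[OF p1 that] tagged_division_ofD(2)[OF p1 that] by (rule subsetD)
        then have "delta_fine \<delta> p" using p delta_fine_iff_fine[of p \<delta>] by blast
        then show "norm ((\<Sum>(x, k)\<in>p. len k *\<^sub>R h z x) - J z) < e" using close p1 z by simp
      qed
    qed
    then show ?thesis by (simp add: cbox_interval)
  qed
  then show int: "integral {0..1} (h z) = J z" if "z \<in> Z" for z using that integral_unique by blast
  have "h z integrable_on {0..1}" if "z \<in> Z" for z using hi[OF that] by (rule has_integral_integrable)
  then show "equi_henstock h Z" unfolding equi_henstock_def using assms int by simp
qed

lemma equi_mcshaneI:
  fixes h :: "'z \<Rightarrow> real \<Rightarrow> real"
  assumes M: "\<And>e. 0 < e \<Longrightarrow> \<exists>\<delta>. unit_gauge \<delta> \<and> (\<forall>p. free_partition p \<and> delta_fine \<delta> p \<longrightarrow>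
      (\<forall>z\<in>Z. \<bar>(\<Sum>(t, I)\<in>p. len I * h z t) - J z\<bar> < e))"
  shows "equi_mcshane h Z" "\<And>z. z \<in> Z \<Longrightarrow> integral {0..1} (h z) = J z"
proof -
  have H: "\<exists>\<delta>. unit_gauge \<delta> \<and> (\<forall>p. p tagged_division_of {0..1} \<and> delta_fine \<delta> p \<longrightarrow>
      (\<forall>z\<in>Z. \<bar>(\<Sum>(t, I)\<in>p. len I * h z t) - J z\<bar> < e))" if "0 < e" for e
    using M[OF that] by (elim exE conjE) (use tagged_division_free in blast)
  show int: "integral {0..1} (h z) = J z" if "z \<in> Z" for z by (rule equi_henstockI(2)[OF H that])
  have "equi_henstock h Z" by (rule equi_henstockI(1)[OF H])
  then show "equi_mcshane h Z" unfolding equi_mcshane_def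
    using M int by (simp add: equi_henstock_integrable)
qed

abbreviation dual_ball :: "('a::real_normed_vector \<Rightarrow>\<^sub>L real) set" where
  "dual_ball \<equiv> {f. norm f \<le> 1}"

lemma support_fun_scaleR_left:
  assumes "C \<in> cwk" "0 \<le> c"
  shows "support_fun (c *\<^sub>R f) C = c * support_fun f C"
  by (rule sublinear_scale[OF sublinear_support_fun[OF assms(1)] assms(2)])

text \<open>The equi-integrability statements live on the dual unit ball; positive homogeneity
  carries their consequences to all functionals.\<close>

lemma scale_to_dual_ball:
  fixes f :: "'a::real_normed_vector \<Rightarrow>\<^sub>L real"
  obtains c g where "0 \<le> c" "norm g \<le> 1" "f = c *\<^sub>R g"
proof (cases "f = 0")
  case True
  then show ?thesis using that[of 0 0] by simp
next
  case False
  then show ?thesis using that[of "norm f" "(1 / norm f) *\<^sub>R f"] by simp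
qed

lemma support_fun_cwk_bounded:
  fixes C :: "'a::banach set"
  assumes C: "C \<in> cwk"
  shows "\<exists>b. \<forall>f\<in>dual_ball. \<bar>support_fun f C\<bar> \<le> b"
proof -
  obtain M where M: "0 < M" "\<And>c. c \<in> C \<Longrightarrow> norm c \<le> M" using cwk_bounded[OF C] by blast
  have "\<bar>support_fun f C\<bar> \<le> M" if f: "norm f \<le> 1" for f
  proof -
    obtain c where c: "c \<in> C" "blinfun_apply f c = support_fun f C" by (rule support_fun_attained[OF C])
    then show ?thesis using blinfun_apply_le_norm[OF f, of c] M(2)[OF c(1)] by simp
  qed
  then show ?thesis by blast
qed

context
  fixes \<Gamma> :: "real \<Rightarrow> 'a::banach set"
  assumes \<Gamma>: "\<forall>t\<in>{0..1}. \<Gamma> t \<in> cwk"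
begin

lemma riemann_sum_cwk:
  assumes "free_partition p"
  shows "mf_riemann_sum \<Gamma> p \<noteq> {}" "bounded (mf_riemann_sum \<Gamma> p)" "convex (mf_riemann_sum \<Gamma> p)"
    "support_fun f (mf_riemann_sum \<Gamma> p) = (\<Sum>(t, I)\<in>p. len I * support_fun f (\<Gamma> t))"
proof -
  have "\<Gamma> (fst j) \<in> cwk" if "j \<in> p" for j using free_partitionD(2)[OF assms that] \<Gamma> by blast
  from mf_riemann_sum_properties[of p \<Gamma>, OF free_partitionD(1)[OF assms] this]
  show "mf_riemann_sum \<Gamma> p \<noteq> {}" "bounded (mf_riemann_sum \<Gamma> p)" "convex (mf_riemann_sum \<Gamma> p)"
    "support_fun f (mf_riemann_sum \<Gamma> p) = (\<Sum>(t, I)\<in>p. len I * support_fun f (\<Gamma> t))" by blast+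
qed

lemma hausdorff_riemann_sum_less:
  assumes \<Phi>: "\<Phi> \<in> cwk" and p: "free_partition p" and d: "hausdorff_distance \<Phi> (mf_riemann_sum \<Gamma> p) < e"
    and f: "norm f \<le> 1"
  shows "\<bar>(\<Sum>(t, I)\<in>p. len I * support_fun f (\<Gamma> t)) - support_fun f \<Phi>\<bar> < e"
  using support_fun_le_hausdorff[OF cwkD(1)[OF \<Phi>] cwk_imp_bounded[OF \<Phi>] riemann_sum_cwk(1,2)[OF p] f] d
  unfolding riemann_sum_cwk(4)[OF p] by linarith

lemma hausdorff_riemann_sum_le:
  assumes \<Phi>: "\<Phi> \<in> cwk" and p: "free_partition p"
    and d: "\<And>f. norm f \<le> 1 \<Longrightarrow> \<bar>(\<Sum>(t, I)\<in>p. len I * support_fun f (\<Gamma> t)) - support_fun f \<Phi>\<bar> \<le> e"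
  shows "hausdorff_distance \<Phi> (mf_riemann_sum \<Gamma> p) \<le> e"
proof (rule hausdorff_le_support_fun[OF cwkD(1)[OF \<Phi>] cwk_imp_bounded[OF \<Phi>] cwkD(2)[OF \<Phi>] riemann_sum_cwk(1-3)[OF p]])
  fix f :: "'a \<Rightarrow>\<^sub>L real" assume "norm f \<le> 1"
  from d[OF this] show "\<bar>support_fun f \<Phi> - support_fun f (mf_riemann_sum \<Gamma> p)\<bar> \<le> e"
    unfolding riemann_sum_cwk(4)[OF p] by linarith
qed

lemma mf_henstockD:
  assumes "mf_henstock_integrable \<Gamma>"
  obtains \<Phi> where "\<Phi> \<in> cwk" "equi_henstock (\<lambda>f t. support_fun f (\<Gamma> t)) dual_ball"
    "\<And>f. norm f \<le> 1 \<Longrightarrow> integral {0..1} (\<lambda>t. support_fun f (\<Gamma> t)) = support_fun f \<Phi>"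
proof -
  obtain \<Phi> where \<Phi>: "\<Phi> \<in> cwk" and d: "\<And>e. 0 < e \<Longrightarrow> \<exists>\<delta>. unit_gauge \<delta> \<and>
      (\<forall>p. p tagged_division_of {0..1} \<and> delta_fine \<delta> p \<longrightarrow> hausdorff_distance \<Phi> (mf_riemann_sum \<Gamma> p) < e)"
    using assms unfolding mf_henstock_integrable_def by blast
  have "\<exists>\<delta>. unit_gauge \<delta> \<and> (\<forall>p. p tagged_division_of {0..1} \<and> delta_fine \<delta> p \<longrightarrow>
      (\<forall>f\<in>dual_ball. \<bar>(\<Sum>(t, I)\<in>p. len I * support_fun f (\<Gamma> t)) - support_fun f \<Phi>\<bar> < e))" if e: "0 < e" for e
  proof -
    obtain \<delta> where \<delta>: "unit_gauge \<delta>" and c: "\<forall>p. p tagged_division_of {0..1} \<and> delta_fine \<delta> p \<longrightarrow>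
        hausdorff_distance \<Phi> (mf_riemann_sum \<Gamma> p) < e" using d[OF e] by blast
    show ?thesis
    proof (intro exI conjI allI impI ballI)
      fix p and f :: "'a \<Rightarrow>\<^sub>L real" assume p: "p tagged_division_of {0..1} \<and> delta_fine \<delta> p" and f: "f \<in> dual_ball"
      show "\<bar>(\<Sum>(t, I)\<in>p. len I * support_fun f (\<Gamma> t)) - support_fun f \<Phi>\<bar> < e"
        by (rule hausdorff_riemann_sum_less[OF \<Phi>]) (use p f c tagged_division_free in auto)
    qed (rule \<delta>)
  qed
  from equi_henstockI[OF this] show ?thesis using that[OF \<Phi>] by simp
qed

lemma mf_mcshaneD:
  assumes "mf_mcshane_integrable \<Gamma>"
  shows "equi_mcshane (\<lambda>f t. support_fun f (\<Gamma> t)) dual_ball"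
proof -
  obtain \<Phi> where \<Phi>: "\<Phi> \<in> cwk" and d: "\<And>e. 0 < e \<Longrightarrow> \<exists>\<delta>. unit_gauge \<delta> \<and>
      (\<forall>p. free_partition p \<and> delta_fine \<delta> p \<longrightarrow> hausdorff_distance \<Phi> (mf_riemann_sum \<Gamma> p) < e)"
    using assms unfolding mf_mcshane_integrable_def by blast
  show ?thesis
  proof (rule equi_mcshaneI(1)[where J = "\<lambda>f. support_fun f \<Phi>"])
    fix e :: real assume e: "0 < e"
    obtain \<delta> where \<delta>: "unit_gauge \<delta>" and c: "\<forall>p. free_partition p \<and> delta_fine \<delta> p \<longrightarrow>
        hausdorff_distance \<Phi> (mf_riemann_sum \<Gamma> p) < e" using d[OF e] by blast
    show "\<exists>\<delta>. unit_gauge \<delta> \<and> (\<forall>p. free_partition p \<and> delta_fine \<delta> p \<longrightarrow>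
      (\<forall>f\<in>dual_ball. \<bar>(\<Sum>(t, I)\<in>p. len I * support_fun f (\<Gamma> t)) - support_fun f \<Phi>\<bar> < e))"
    proof (intro exI conjI allI impI ballI)
      fix p and f :: "'a \<Rightarrow>\<^sub>L real" assume p: "free_partition p \<and> delta_fine \<delta> p" and f: "f \<in> dual_ball"
      show "\<bar>(\<Sum>(t, I)\<in>p. len I * support_fun f (\<Gamma> t)) - support_fun f \<Phi>\<bar> < e"
        by (rule hausdorff_riemann_sum_less[OF \<Phi>]) (use p f c in auto)
    qed (rule \<delta>)
  qed
qed

lemma mf_mcshane_imp_henstock: "mf_mcshane_integrable \<Gamma> \<Longrightarrow> mf_henstock_integrable \<Gamma>"
  unfolding mf_mcshane_integrable_def mf_henstock_integrable_def
  using tagged_division_free by (metis (no_types, lifting))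

lemma mf_mcshaneI:
  assumes \<Phi>: "\<Phi> \<in> cwk" and M: "equi_mcshane (\<lambda>f t. support_fun f (\<Gamma> t)) dual_ball"
    and int: "\<And>f. norm f \<le> 1 \<Longrightarrow> integral {0..1} (\<lambda>t. support_fun f (\<Gamma> t)) = support_fun f \<Phi>"
  shows "mf_mcshane_integrable \<Gamma>"
  unfolding mf_mcshane_integrable_def
proof (intro bexI allI impI)
  fix e :: real assume "0 < e"
  then have "0 < e / 2" by simp
  from equi_mcshaneD[OF M this] obtain \<delta> where \<delta>: "unit_gauge \<delta>"
    and close: "\<And>p f. free_partition p \<Longrightarrow> delta_fine \<delta> p \<Longrightarrow> f \<in> dual_ball \<Longrightarrow>
      \<bar>(\<Sum>(t, I)\<in>p. len I * support_fun f (\<Gamma> t)) - integral {0..1} (\<lambda>t. support_fun f (\<Gamma> t))\<bar> < e / 2" by metis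
  show "\<exists>\<delta>. unit_gauge \<delta> \<and> (\<forall>p. free_partition p \<and> delta_fine \<delta> p \<longrightarrow> hausdorff_distance \<Phi> (mf_riemann_sum \<Gamma> p) < e)"
  proof (intro exI conjI allI impI)
    fix p assume p: "free_partition p \<and> delta_fine \<delta> p"
    have "hausdorff_distance \<Phi> (mf_riemann_sum \<Gamma> p) \<le> e / 2"
    proof (rule hausdorff_riemann_sum_le[OF \<Phi>])
      fix f :: "'a \<Rightarrow>\<^sub>L real" assume f: "norm f \<le> 1"
      have "\<bar>(\<Sum>(t, I)\<in>p. len I * support_fun f (\<Gamma> t)) - support_fun f \<Phi>\<bar> < e / 2"
        using close[of p f] p f unfolding int[OF f] by simp
      then show "\<bar>(\<Sum>(t, I)\<in>p. len I * support_fun f (\<Gamma> t)) - support_fun f \<Phi>\<bar> \<le> e / 2" by simp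
    qed (use p in simp)
    then show "hausdorff_distance \<Phi> (mf_riemann_sum \<Gamma> p) < e" using \<open>0 < e\<close> by simp
  qed (rule \<delta>)
qed (rule \<Phi>)

lemma support_fun_pointwise_bounded:
  "t \<in> {0..1} \<Longrightarrow> \<exists>b. \<forall>f\<in>dual_ball. \<bar>support_fun f (\<Gamma> t)\<bar> \<le> b"
  using \<Gamma> support_fun_cwk_bounded by blast

end

section \<open>Integrability of vector-valued functions through functionals\<close>

lemma blinfun_sum_scaleR:
  "blinfun_apply x (\<Sum>(t, I)\<in>p. len I *\<^sub>R f t) = (\<Sum>(t, I)\<in>p. len I * blinfun_apply x (f t))"
  for x :: "'a::real_normed_vector \<Rightarrow>\<^sub>L real"
  by (simp add: blinfun.sum_right case_prod_unfold blinfun.scaleR_right)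

lemma norm_le_dual_ball:
  fixes v :: "'a::real_normed_vector"
  assumes "\<And>x. x \<in> dual_ball \<Longrightarrow> blinfun_apply x v \<le> e"
  shows "norm v \<le> e"
proof -
  obtain x :: "'a \<Rightarrow>\<^sub>L real" where "norm x \<le> 1" "blinfun_apply x v = norm v" by (rule norming_functional)
  then show ?thesis using assms[of x] by simp
qed

lemma henstock_integrableD:
  fixes f :: "real \<Rightarrow> 'a::banach"
  assumes "henstock_integrable f"
  obtains w where "equi_henstock (\<lambda>x t. blinfun_apply x (f t)) dual_ball"
    "\<And>x :: 'a \<Rightarrow>\<^sub>L real. norm x \<le> 1 \<Longrightarrow> integral {0..1} (\<lambda>t. blinfun_apply x (f t)) = blinfun_apply x w"
proof -
  obtain w where d: "\<And>e. 0 < e \<Longrightarrow> \<exists>\<delta>. unit_gauge \<delta> \<and> (\<forall>p. p tagged_division_of {0..1} \<and> delta_fine \<delta> p \<longrightarrow>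
        norm (w - (\<Sum>(t, I)\<in>p. len I *\<^sub>R f t)) < e)"
    using assms unfolding henstock_integrable_def by blast
  have "\<exists>\<delta>. unit_gauge \<delta> \<and> (\<forall>p. p tagged_division_of {0..1} \<and> delta_fine \<delta> p \<longrightarrow>
      (\<forall>x\<in>dual_ball. \<bar>(\<Sum>(t, I)\<in>p. len I * blinfun_apply x (f t)) - blinfun_apply x w\<bar> < e))" if e: "0 < e" for e
  proof -
    obtain \<delta> where \<delta>: "unit_gauge \<delta>" and c: "\<forall>p. p tagged_division_of {0..1} \<and> delta_fine \<delta> p \<longrightarrow>
        norm (w - (\<Sum>(t, I)\<in>p. len I *\<^sub>R f t)) < e" using d[OF e] by blast
    show ?thesis
    proof (intro exI conjI allI impI ballI)
      fix p and x :: "'a \<Rightarrow>\<^sub>L real" assume p: "p tagged_division_of {0..1} \<and> delta_fine \<delta> p" and x: "x \<in> dual_ball"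
      have x1: "norm x \<le> 1" using x by simp
      have "\<bar>blinfun_apply x (w - (\<Sum>(t, I)\<in>p. len I *\<^sub>R f t))\<bar> \<le> norm (w - (\<Sum>(t, I)\<in>p. len I *\<^sub>R f t))"
        by (rule blinfun_apply_le_norm[OF x1])
      also have "\<dots> < e" using c p by blast
      finally show "\<bar>(\<Sum>(t, I)\<in>p. len I * blinfun_apply x (f t)) - blinfun_apply x w\<bar> < e"
        unfolding blinfun.diff_right blinfun_sum_scaleR by linarith
    qed (rule \<delta>)
  qed
  from equi_henstockI[OF this] show ?thesis using that by simp
qed

lemma mcshane_integrableI:
  fixes f :: "real \<Rightarrow> 'a::banach"
  assumes M: "equi_mcshane (\<lambda>x t. blinfun_apply x (f t)) dual_ball"
    and int: "\<And>x :: 'a \<Rightarrow>\<^sub>L real. norm x \<le> 1 \<Longrightarrow> integral {0..1} (\<lambda>t. blinfun_apply x (f t)) = blinfun_apply x w"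
  shows "mcshane_integrable f"
  unfolding mcshane_integrable_def
proof (intro exI[of _ w] allI impI)
  fix e :: real assume "0 < e"
  then have "0 < e / 2" by simp
  from equi_mcshaneD[OF M this] obtain \<delta> where \<delta>: "unit_gauge \<delta>"
    and close: "\<And>p x. free_partition p \<Longrightarrow> delta_fine \<delta> p \<Longrightarrow> x \<in> dual_ball \<Longrightarrow>
      \<bar>(\<Sum>(t, I)\<in>p. len I * blinfun_apply x (f t)) - integral {0..1} (\<lambda>t. blinfun_apply x (f t))\<bar> < e / 2" by metis
  show "\<exists>\<delta>. unit_gauge \<delta> \<and> (\<forall>p. free_partition p \<and> delta_fine \<delta> p \<longrightarrow> norm (w - (\<Sum>(t, I)\<in>p. len I *\<^sub>R f t)) < e)"
  proof (intro exI conjI allI impI)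
    fix p assume p: "free_partition p \<and> delta_fine \<delta> p"
    have "norm (w - (\<Sum>(t, I)\<in>p. len I *\<^sub>R f t)) \<le> e / 2"
    proof (rule norm_le_dual_ball)
      fix x :: "'a \<Rightarrow>\<^sub>L real" assume x: "x \<in> dual_ball"
      then have x1: "norm x \<le> 1" by simp
      have "\<bar>(\<Sum>(t, I)\<in>p. len I * blinfun_apply x (f t)) - blinfun_apply x w\<bar> < e / 2"
        using close[of p x] p x unfolding int[OF x1] by simp
      then show "blinfun_apply x (w - (\<Sum>(t, I)\<in>p. len I *\<^sub>R f t)) \<le> e / 2"
        unfolding blinfun.diff_right blinfun_sum_scaleR by linarith
    qed
    then show "norm (w - (\<Sum>(t, I)\<in>p. len I *\<^sub>R f t)) < e" using \<open>0 < e\<close> by simp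
  qed (rule \<delta>)
qed

lemma mcshane_integrableD:
  fixes f :: "real \<Rightarrow> 'a::banach"
  assumes "mcshane_integrable f"
  shows "equi_mcshane (\<lambda>x t. blinfun_apply x (f t)) dual_ball" "henstock_integrable f"
proof -
  obtain w where d: "\<And>e. 0 < e \<Longrightarrow> \<exists>\<delta>. unit_gauge \<delta> \<and> (\<forall>p. free_partition p \<and> delta_fine \<delta> p \<longrightarrow>
        norm (w - (\<Sum>(t, I)\<in>p. len I *\<^sub>R f t)) < e)"
    using assms unfolding mcshane_integrable_def by blast
  show "henstock_integrable f" unfolding henstock_integrable_def
  proof (intro exI[of _ w] allI impI)
    fix e :: real assume "0 < e"
    from d[OF this] show "\<exists>\<delta>. unit_gauge \<delta> \<and> (\<forall>p. p tagged_division_of {0..1} \<and> delta_fine \<delta> p \<longrightarrow>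
        norm (w - (\<Sum>(t, I)\<in>p. len I *\<^sub>R f t)) < e)" using tagged_division_free by blast
  qed
  show "equi_mcshane (\<lambda>x t. blinfun_apply x (f t)) dual_ball"
  proof (rule equi_mcshaneI(1)[where J = "\<lambda>x. blinfun_apply x w"])
    fix e :: real assume e: "0 < e"
    obtain \<delta> where \<delta>: "unit_gauge \<delta>" and c: "\<forall>p. free_partition p \<and> delta_fine \<delta> p \<longrightarrow>
        norm (w - (\<Sum>(t, I)\<in>p. len I *\<^sub>R f t)) < e" using d[OF e] by blast
    show "\<exists>\<delta>. unit_gauge \<delta> \<and> (\<forall>p. free_partition p \<and> delta_fine \<delta> p \<longrightarrow>
      (\<forall>x\<in>dual_ball. \<bar>(\<Sum>(t, I)\<in>p. len I * blinfun_apply x (f t)) - blinfun_apply x w\<bar> < e))"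
    proof (intro exI conjI allI impI ballI)
      fix p and x :: "'a \<Rightarrow>\<^sub>L real" assume p: "free_partition p \<and> delta_fine \<delta> p" and x: "x \<in> dual_ball"
      have x1: "norm x \<le> 1" using x by simp
      have "\<bar>blinfun_apply x (w - (\<Sum>(t, I)\<in>p. len I *\<^sub>R f t))\<bar> \<le> norm (w - (\<Sum>(t, I)\<in>p. len I *\<^sub>R f t))"
        by (rule blinfun_apply_le_norm[OF x1])
      also have "\<dots> < e" using c p by blast
      finally show "\<bar>(\<Sum>(t, I)\<in>p. len I * blinfun_apply x (f t)) - blinfun_apply x w\<bar> < e"
        unfolding blinfun.diff_right blinfun_sum_scaleR by linarith
    qed (rule \<delta>)
  qed
qed

section \<open>Selections and the Pettis integral\<close>

lemma henstock_selection_exists: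
  fixes \<Gamma> :: "real \<Rightarrow> 'a::banach set"
  assumes \<Gamma>: "\<forall>t\<in>{0..1}. \<Gamma> t \<in> cwk" and H: "mf_henstock_integrable \<Gamma>"
  shows "\<exists>g. g \<in> henstock_selections \<Gamma>"
proof -
  obtain \<Phi> where \<Phi>: "\<Phi> \<in> cwk" and EH: "equi_henstock (\<lambda>f t. support_fun f (\<Gamma> t)) dual_ball"
    and int: "\<And>f. norm f \<le> 1 \<Longrightarrow> integral {0..1} (\<lambda>t. support_fun f (\<Gamma> t)) = support_fun f \<Phi>"
    by (rule mf_henstockD[OF \<Gamma> H]) blast
  obtain v x where x: "x \<in> \<Phi>" and exposed: "\<And>\<epsilon>. 0 < \<epsilon> \<Longrightarrow>
      \<exists>\<beta>>0. \<forall>c\<in>\<Phi>. support_fun v \<Phi> - \<beta> < blinfun_apply v c \<longrightarrow> norm (c - x) \<le> \<epsilon>"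
    by (rule cwk_strongly_exposed_point[OF \<Phi>]) blast
  obtain c u where c: "0 \<le> c" and u: "norm u \<le> 1" and v: "v = c *\<^sub>R u" by (rule scale_to_dual_ball[of v])
  have "\<exists>y. t \<in> {0..1} \<longrightarrow> y \<in> face (\<Gamma> t) v" for t using face_nonempty \<Gamma> by blast
  then obtain g where g: "\<And>t. t \<in> {0..1} \<Longrightarrow> g t \<in> face (\<Gamma> t) v" by metis
  have gsel: "g t \<in> \<Gamma> t" "blinfun_apply v (g t) = support_fun v (\<Gamma> t)" if "t \<in> {0..1}" for t
    using g[OF that] by (auto simp: face_def)
  have "henstock_integrable g"
    unfolding henstock_integrable_def
  proof (intro exI[of _ x] allI impI)
    fix e :: real assume e: "0 < e"
    obtain \<beta> where \<beta>: "0 < \<beta>" "\<And>y. y \<in> \<Phi> \<Longrightarrow> support_fun v \<Phi> - \<beta> < blinfun_apply v y \<Longrightarrow> norm (y - x) \<le> e / 2"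
      using exposed[of "e / 2"] e by auto
    \<comment> \<open>The first entry leaves \<open>2 * \<kappa> \<le> e / 4\<close> for the
      distance from the Riemann sum to \<open>\<Phi>\<close>. The second keeps the total loss in
      \<open>v\<close> below \<open>\<beta>\<close>: at most \<open>c * \<kappa>\<close> from the
      sums and \<open>c * (2 * \<kappa>)\<close> from moving to a point of
      \<open>\<Phi>\<close>.\<close>
    define \<kappa> where "\<kappa> = min (e / 8) (\<beta> / (4 * (c + 1)))"
    have \<kappa>: "0 < \<kappa>" "\<kappa> \<le> e / 8"
      using e \<beta>(1) c by (simp add: \<kappa>_def, unfold \<kappa>_def, intro min.cobounded1)
    have "\<kappa> * (4 * (c + 1)) \<le> \<beta> / (4 * (c + 1)) * (4 * (c + 1))"
      using c by (intro mult_right_mono) (auto simp: \<kappa>_def)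
    then have "\<kappa> * (4 * (c + 1)) \<le> \<beta>" using c by simp
    moreover have "c * (3 * \<kappa>) < \<kappa> * (4 * (c + 1))"
    proof -
      have "0 \<le> c * \<kappa>" using c \<kappa>(1) by simp
      moreover have "\<kappa> * (4 * (c + 1)) = 4 * (c * \<kappa>) + 4 * \<kappa>" by (simp add: algebra_simps)
      moreover have "c * (3 * \<kappa>) = 3 * (c * \<kappa>)" by simp
      ultimately show ?thesis using \<kappa>(1) by linarith
    qed
    ultimately have c\<kappa>: "c * (3 * \<kappa>) < \<beta>" by linarith
    obtain \<delta> where \<delta>: "unit_gauge \<delta>" and close: "\<And>p f. p tagged_division_of {0..1} \<Longrightarrow> delta_fine \<delta> p \<Longrightarrow> f \<in> dual_ball \<Longrightarrow>
        \<bar>(\<Sum>(t, I)\<in>p. len I * support_fun f (\<Gamma> t)) - integral {0..1} (\<lambda>t. support_fun f (\<Gamma> t))\<bar> < \<kappa>"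
      using equi_henstockD[OF EH \<kappa>(1)] by metis
    show "\<exists>\<delta>. unit_gauge \<delta> \<and> (\<forall>p. p tagged_division_of {0..1} \<and> delta_fine \<delta> p \<longrightarrow>
        norm (x - (\<Sum>(t, I)\<in>p. len I *\<^sub>R g t)) < e)"
    proof (intro exI conjI allI impI)
      fix p assume p: "p tagged_division_of {0..1} \<and> delta_fine \<delta> p"
      then have fp: "free_partition p" using tagged_division_free by blast
      have close': "\<bar>(\<Sum>(t, I)\<in>p. len I * support_fun f (\<Gamma> t)) - support_fun f \<Phi>\<bar> < \<kappa>" if "norm f \<le> 1" for f
        using close[of p f] p that int[OF that] by simp
      define S where "S = (\<Sum>(t, I)\<in>p. len I *\<^sub>R g t)"
      \<comment> \<open>For each \<open>f\<close> in the dual ball the sum over \<open>g\<close> is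
        at most the sum of the support functions, which is within \<open>\<kappa>\<close> of the
        support function of \<open>\<Phi>\<close>; by separation this one-sided estimate bounds the
        distance to the convex set.\<close>
      have "infdist S \<Phi> \<le> \<kappa>"
      proof (rule infdist_le_support_fun[OF cwkD(2,1)[OF \<Phi>]])
        fix f :: "'a \<Rightarrow>\<^sub>L real" assume f: "norm f \<le> 1"
        have "blinfun_apply f S = (\<Sum>j\<in>p. len (snd j) * blinfun_apply f (g (fst j)))"
          unfolding S_def blinfun_sum_scaleR by (simp add: case_prod_unfold)
        also have "\<dots> \<le> (\<Sum>j\<in>p. len (snd j) * support_fun f (\<Gamma> (fst j)))"
        proof (intro sum_mono mult_left_mono)
          fix j assume "j \<in> p"
          then have t: "fst j \<in> {0..1}" by (rule free_partitionD(2)[OF fp])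
          then have "\<Gamma> (fst j) \<in> cwk" using \<Gamma> by blast
          then show "blinfun_apply f (g (fst j)) \<le> support_fun f (\<Gamma> (fst j))"
            using gsel(1)[OF t] by (rule support_fun_upper)
        qed simp
        also have "\<dots> \<le> support_fun f \<Phi> + \<kappa>" using close'[OF f] by (simp add: case_prod_unfold)
        finally show "blinfun_apply f S \<le> support_fun f \<Phi> + \<kappa>" .
      qed
      then have "(INF y\<in>\<Phi>. dist S y) < 2 * \<kappa>" using \<kappa>(1) cwkD(1)[OF \<Phi>] by (simp add: infdist_notempty)
      then obtain y where y: "y \<in> \<Phi>" "dist S y < 2 * \<kappa>"
        using cINF_less_iff[of \<Phi> "dist S" "2 * \<kappa>"] cwkD(1)[OF \<Phi>] by (auto intro: bdd_belowI2[of _ 0])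
      \<comment> \<open>In the direction \<open>v\<close> the choice of \<open>g\<close> turns the
        inequality between the sums into an equality, so \<open>S\<close> is almost maximal
        there.\<close>
      have "blinfun_apply v S = (\<Sum>j\<in>p. len (snd j) * blinfun_apply v (g (fst j)))"
        unfolding S_def blinfun_sum_scaleR by (simp add: case_prod_unfold)
      also have "\<dots> = (\<Sum>j\<in>p. c * (len (snd j) * support_fun u (\<Gamma> (fst j))))"
      proof (rule sum.cong[OF refl])
        fix j assume "j \<in> p"
        then have t: "fst j \<in> {0..1}" by (rule free_partitionD(2)[OF fp])
        then have "\<Gamma> (fst j) \<in> cwk" using \<Gamma> by blast
        then show "len (snd j) * blinfun_apply v (g (fst j)) = c * (len (snd j) * support_fun u (\<Gamma> (fst j)))"
          unfolding gsel(2)[OF t] by (simp add: v support_fun_scaleR_left[OF _ c])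
      qed
      also have "\<dots> = c * (\<Sum>(t, I)\<in>p. len I * support_fun u (\<Gamma> t))" by (simp add: sum_distrib_left case_prod_unfold)
      also have "\<dots> \<ge> c * (support_fun u \<Phi> - \<kappa>)" using close'[OF u] c by (intro mult_left_mono) auto
      finally have vS: "support_fun v \<Phi> - c * \<kappa> \<le> blinfun_apply v S"
        by (simp add: v support_fun_scaleR_left[OF \<Phi> c] right_diff_distrib)
      have "blinfun_apply v (S - y) = c * blinfun_apply u (S - y)" by (simp add: v blinfun.scaleR_left)
      also have "\<dots> \<le> c * (2 * \<kappa>)"
        using blinfun_apply_le_norm[OF u, of "S - y"] y(2) c by (intro mult_left_mono) (auto simp: dist_norm)
      finally have "support_fun v \<Phi> - \<beta> < blinfun_apply v y"
        using vS c\<kappa> by (simp add: blinfun.diff_right)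
      then have "norm (y - x) \<le> e / 2" by (rule \<beta>(2)[OF y(1)])
      moreover have "norm (x - S) \<le> norm (y - x) + dist S y"
        using norm_triangle_ineq[of "x - y" "y - S"] by (simp add: dist_norm norm_minus_commute)
      ultimately show "norm (x - (\<Sum>(t, I)\<in>p. len I *\<^sub>R g t)) < e"
        using y(2) \<kappa>(2) e unfolding S_def by linarith
    qed (rule \<delta>)
  qed
  then have "g \<in> henstock_selections \<Gamma>"
    using gsel(1) by (simp add: henstock_selections_def selections_def)
  then show ?thesis by blast
qed

section \<open>From McShane to Pettis integrability\<close>

lemma LI_minus_LI:
  fixes h :: "real \<Rightarrow> real"
  assumes h: "h absolutely_integrable_on {0..1}" and A: "A \<in> sets lebesgue" "A \<subseteq> {0..1}"
    and E: "E \<in> sets lebesgue" "E \<subseteq> {0..1}"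
  shows "LI A h - LI E h = LI (A - E) h - LI (E - A) h"
proof -
  have i: "integrable lebesgue (\<lambda>x. indicat_real B x *\<^sub>R h x)" if "B \<in> sets lebesgue" "B \<subseteq> {0..1}" for B
    using absolutely_integrable_subset01[OF h that] unfolding set_integrable_def .
  have AE: "A - E \<in> sets lebesgue" "A - E \<subseteq> {0..1}" "E - A \<in> sets lebesgue" "E - A \<subseteq> {0..1}" using A E by auto
  have "LI A h - LI E h = (LINT x|lebesgue. indicat_real A x *\<^sub>R h x - indicat_real E x *\<^sub>R h x)"
    unfolding set_lebesgue_integral_def by (rule Bochner_Integration.integral_diff[OF i[OF A] i[OF E], symmetric])
  also have "(\<lambda>x. indicat_real A x *\<^sub>R h x - indicat_real E x *\<^sub>R h x) =
      (\<lambda>x. indicat_real (A - E) x *\<^sub>R h x - indicat_real (E - A) x *\<^sub>R h x)"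
    by (rule ext) (auto simp: indicator_def)
  also have "(LINT x|lebesgue. indicat_real (A - E) x *\<^sub>R h x - indicat_real (E - A) x *\<^sub>R h x) = LI (A - E) h - LI (E - A) h"
    unfolding set_lebesgue_integral_def by (rule Bochner_Integration.integral_diff[OF i[OF AE(1,2)] i[OF AE(3,4)]])
  finally show ?thesis .
qed

lemma blinfun_pointwise_bounded: "\<exists>b. \<forall>x\<in>dual_ball. \<bar>blinfun_apply x (f t)\<bar> \<le> b"
  for f :: "real \<Rightarrow> 'a::banach"
  using blinfun_apply_le_norm by blast

text \<open>Finite unions of intervals approximate \<open>A\<close> in measure, and over them the
  integral of \<open>f\<close> is a vector. Equi-absolute continuity makes these vectors Cauchy in
  norm, and their limit represents the integral over \<open>A\<close>.\<close>

lemma mcshane_imp_pettis: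
  fixes f :: "real \<Rightarrow> 'a::banach"
  assumes M: "mcshane_integrable f"
  shows "pettis_integrable f"
proof -
  note EM = mcshane_integrableD(1)[OF M]
  have fint: "f integrable_on {0..1}"
    using mcshane_integrableD(2)[OF M] by (simp add: henstock_integrable_iff_integrable_on)
  have ball: "(\<lambda>t. blinfun_apply x (f t)) absolutely_integrable_on {0..1}" if "x \<in> dual_ball" for x :: "'a \<Rightarrow>\<^sub>L real"
    by (rule equi_mcshane_absolutely_integrable[OF EM blinfun_pointwise_bounded[of f] that])
  have abs: "(\<lambda>t. blinfun_apply x (f t)) absolutely_integrable_on {0..1}" for x :: "'a \<Rightarrow>\<^sub>L real"
  proof -
    obtain c u where u: "norm u \<le> 1" and x: "x = c *\<^sub>R u" by (rule scale_to_dual_ball[of x])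
    have "(\<lambda>t. c * blinfun_apply u (f t)) absolutely_integrable_on {0..1}"
      using ball[of u] u by (intro set_integrable_mult_right) simp
    then show ?thesis by (simp add: x blinfun.scaleR_left)
  qed
  have AC: "equi_absolutely_continuous (\<lambda>(x :: 'a \<Rightarrow>\<^sub>L real) t. blinfun_apply x (f t)) dual_ball"
    by (rule equi_mcshane_imp_absolutely_continuous[OF EM blinfun_pointwise_bounded[of f]])
  have "\<exists>w. \<forall>x :: 'a \<Rightarrow>\<^sub>L real. blinfun_apply x w = LI A (\<lambda>t. blinfun_apply x (f t))"
    if A: "A \<in> sets lebesgue" "A \<subseteq> {0..1}" for A
  proof -
    have "\<exists>\<D> E. \<D> division_of E \<and> E \<subseteq> {0..1} \<and> E \<in> sets lebesgue \<and>
        measure lebesgue ((A - E) \<union> (E - A)) < (1/2) ^ n" for n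
    proof -
      have "0 < (1/2::real) ^ n" by simp
      then obtain \<D> E where "\<D> division_of E" "E \<subseteq> {0..1}" "E \<in> sets lebesgue"
          "measure lebesgue ((A - E) \<union> (E - A)) < (1/2) ^ n"
        by (rule division_approximation[OF A])
      then show ?thesis by blast
    qed
    then obtain \<D> E where D: "\<And>n. \<D> n division_of E n" and E: "\<And>n. E n \<subseteq> {0..1}" "\<And>n. E n \<in> sets lebesgue"
      and small: "\<And>n. measure lebesgue ((A - E n) \<union> (E n - A)) < (1/2) ^ n" by metis
    define w where "w n = (\<Sum>K\<in>\<D> n. integral K f)" for n
    have xw: "blinfun_apply x (w n) = LI (E n) (\<lambda>t. blinfun_apply x (f t))" for x :: "'a \<Rightarrow>\<^sub>L real" and n
    proof -
      have "blinfun_apply x (integral K f) = integral K (\<lambda>t. blinfun_apply x (f t))" if K: "K \<in> \<D> n" for K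
      proof -
        obtain a b where ab: "K = cbox a b" using division_ofD(4)[OF D K] by blast
        have "K \<subseteq> {0..1}" using division_ofD(2)[OF D K] E(1) by blast
        then have "f integrable_on K" unfolding ab by (rule integrable_on_subcbox[OF fint])
        from integral_linear[OF this blinfun.bounded_linear_right[of x]] show ?thesis unfolding o_def by (rule sym)
      qed
      then show ?thesis unfolding LI_division[OF abs D E(1)] w_def blinfun.sum_right by (rule sum.cong[OF refl])
    qed
    have lmS: "(A - E n) \<union> (E n - A) \<in> sets lebesgue" "(A - E n) \<union> (E n - A) \<subseteq> {0..1}" for n
      using A E by auto
    have "Cauchy w"
    proof (rule CauchyI)
      fix e :: real assume e: "0 < e"
      then have "0 < e / 4" by simp
      then obtain \<eta> where \<eta>: "0 < \<eta>" and ac: "\<And>B (x :: 'a \<Rightarrow>\<^sub>L real). B \<in> sets lebesgue \<Longrightarrow> B \<subseteq> {0..1} \<Longrightarrow>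
          measure lebesgue B < \<eta> \<Longrightarrow> x \<in> dual_ball \<Longrightarrow> \<bar>LI B (\<lambda>t. blinfun_apply x (f t))\<bar> \<le> e / 4"
        using equi_absolutely_continuous_LI[OF AC ball] by metis
      obtain N where N: "(1/2::real) ^ N < \<eta> / 2" using real_arch_pow_inv[of "\<eta> / 2" "1/2"] \<eta> by auto
      have "norm (w m - w n) < e" if mn: "N \<le> m" "N \<le> n" for m n
      proof -
        have half: "(1/2::real) ^ k \<le> (1/2) ^ N" if "N \<le> k" for k using that by (intro power_decreasing) auto
        \<comment> \<open>\<open>?U\<close> contains both \<open>E m - E n\<close> and
          \<open>E n - E m\<close>, each of which contributes at most \<open>e / 4\<close> to the
          difference.\<close>
        let ?U = "((A - E m) \<union> (E m - A)) \<union> ((A - E n) \<union> (E n - A))"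
        have "measure lebesgue ?U \<le> measure lebesgue ((A - E m) \<union> (E m - A)) + measure lebesgue ((A - E n) \<union> (E n - A))"
          using lmS by (intro measure_Un_le) auto
        also have "\<dots> < \<eta>" using small[of m] small[of n] half[OF mn(1)] half[OF mn(2)] N by linarith
        finally have U: "measure lebesgue ?U < \<eta>" .
        have Ulm: "?U \<in> lmeasurable" using lmS by (intro lmeasurable01) auto
        have sm: "\<bar>LI B (\<lambda>t. blinfun_apply x (f t))\<bar> \<le> e / 4"
          if B: "B \<in> sets lebesgue" "B \<subseteq> {0..1}" "B \<subseteq> ?U" and x: "x \<in> dual_ball" for B and x :: "'a \<Rightarrow>\<^sub>L real"
          using measure_mono_fmeasurable[OF B(3,1) Ulm] U by (intro ac[OF B(1,2) _ x]) linarith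
        have "norm (w m - w n) \<le> e / 2"
        proof (rule norm_le_dual_ball)
          fix x :: "'a \<Rightarrow>\<^sub>L real" assume x: "x \<in> dual_ball"
          have "blinfun_apply x (w m - w n) = LI (E m - E n) (\<lambda>t. blinfun_apply x (f t)) - LI (E n - E m) (\<lambda>t. blinfun_apply x (f t))"
            unfolding blinfun.diff_right xw by (rule LI_minus_LI[OF abs E(2,1) E(2,1)])
          also have "\<dots> \<le> e / 2"
            using sm[of "E m - E n" x] sm[of "E n - E m" x] x E by fastforce
          finally show "blinfun_apply x (w m - w n) \<le> e / 2" .
        qed
        then show ?thesis using e by simp
      qed
      then show "\<exists>M. \<forall>m\<ge>M. \<forall>n\<ge>M. norm (w m - w n) < e" by blast
    qed
    then obtain w0 where w0: "w \<longlonglongrightarrow> w0" using Cauchy_convergent_iff convergent_def by blast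
    have "blinfun_apply x w0 = LI A (\<lambda>t. blinfun_apply x (f t))" for x :: "'a \<Rightarrow>\<^sub>L real"
    proof (rule LIMSEQ_unique)
      show "(\<lambda>n. blinfun_apply x (w n)) \<longlonglongrightarrow> blinfun_apply x w0"
        by (rule bounded_linear.tendsto[OF blinfun.bounded_linear_right w0])
      show "(\<lambda>n. blinfun_apply x (w n)) \<longlonglongrightarrow> LI A (\<lambda>t. blinfun_apply x (f t))"
      proof (rule LIMSEQ_I)
        fix e :: real assume "0 < e"
        then have "0 < e / 2" by simp
        then obtain \<rho> where \<rho>: "0 < \<rho>" "\<And>B. B \<in> sets lebesgue \<Longrightarrow> B \<subseteq> {0..1} \<Longrightarrow> measure lebesgue B < \<rho> \<Longrightarrow>
            LI B (\<lambda>t. \<bar>blinfun_apply x (f t)\<bar>) \<le> e / 2"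
          using LI_abs_continuous[OF abs[of x]] by metis
        obtain N where N: "(1/2::real) ^ N < \<rho>" using real_arch_pow_inv[of \<rho> "1/2"] \<rho> by auto
        have "norm (blinfun_apply x (w n) - LI A (\<lambda>t. blinfun_apply x (f t))) < e" if "N \<le> n" for n
        proof -
          have "(1/2::real) ^ n \<le> (1/2) ^ N" using that by (intro power_decreasing) auto
          then have "measure lebesgue ((A - E n) \<union> (E n - A)) < \<rho>" using small[of n] N by linarith
          from \<rho>(2)[OF lmS this] have "\<bar>LI A (\<lambda>t. blinfun_apply x (f t)) - LI (E n) (\<lambda>t. blinfun_apply x (f t))\<bar> \<le> e / 2"
            by (rule order_trans[OF LI_diff_le[OF abs A E(2,1)]])
          then show ?thesis unfolding xw real_norm_def using \<open>0 < e\<close> by linarith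
        qed
        then show "\<exists>N. \<forall>n\<ge>N. norm (blinfun_apply x (w n) - LI A (\<lambda>t. blinfun_apply x (f t))) < e" by blast
      qed
    qed
    then show ?thesis by blast
  qed
  then show ?thesis using abs unfolding pettis_integrable_def by blast
qed

section \<open>Equi-absolute continuity of Pettis integrals\<close>

lemma abs_LI_le: "\<bar>LI A h\<bar> \<le> LI A (\<lambda>x. \<bar>h x\<bar>)"
  using integral_abs_bound[of lebesgue "\<lambda>x. indicat_real A x *\<^sub>R h x"]
  by (simp add: set_lebesgue_integral_def abs_mult)

lemma LI_family_summable:
  fixes h :: "real \<Rightarrow> real"
  assumes h: "h absolutely_integrable_on {0..1}" and C: "\<And>n. C n \<in> sets lebesgue" "\<And>n. C n \<subseteq> {0..1}"
    and disj: "\<And>m n. m \<noteq> n \<Longrightarrow> C m \<inter> C n = {}"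
  shows "summable (\<lambda>n :: nat. LI (C n) (\<lambda>x. \<bar>h x\<bar>))"
proof -
  note ah = absolutely_integrable_abs01[OF h]
  note ahC = absolutely_integrable_subset01[OF ah C]
  have nn: "0 \<le> LI A (\<lambda>x. \<bar>h x\<bar>)" for A
    unfolding set_lebesgue_integral_def by (rule Bochner_Integration.integral_nonneg) simp
  show "summable (\<lambda>n. LI (C n) (\<lambda>x. \<bar>h x\<bar>))"
  proof (rule summableI_nonneg_bounded[where x = "LI {0..1} (\<lambda>x. \<bar>h x\<bar>)"])
    fix n :: nat
    have U: "(\<Union>i<n. C i) \<in> sets lebesgue" "(\<Union>i<n. C i) \<subseteq> {0..1}" using C by auto
    have "(\<Sum>i<n. LI (C i) (\<lambda>x. \<bar>h x\<bar>)) = LI (\<Union>i<n. C i) (\<lambda>x. \<bar>h x\<bar>)"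
      by (rule set_integral_finite_Union[symmetric]) (use disj ahC C in \<open>auto simp: disjoint_family_on_def\<close>)
    also have "\<dots> \<le> LI {0..1} (\<lambda>x. \<bar>h x\<bar>)"
      unfolding set_lebesgue_integral_def
    proof (rule integral_mono)
      show "integrable lebesgue (\<lambda>x. indicat_real (\<Union>i<n. C i) x *\<^sub>R \<bar>h x\<bar>)"
        using absolutely_integrable_subset01[OF ah U] unfolding set_integrable_def .
      show "integrable lebesgue (\<lambda>x. indicat_real {0..1} x *\<^sub>R \<bar>h x\<bar>)" using ah unfolding set_integrable_def .
      show "indicat_real (\<Union>i<n. C i) x *\<^sub>R \<bar>h x\<bar> \<le> indicat_real {0..1} x *\<^sub>R \<bar>h x\<bar>" for x
        using U(2) by (auto simp: indicator_def)
    qed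
    finally show "(\<Sum>i<n. LI (C i) (\<lambda>x. \<bar>h x\<bar>)) \<le> LI {0..1} (\<lambda>x. \<bar>h x\<bar>)" .
  qed (rule nn)
qed

text \<open>A failure provides sets of rapidly decreasing measure with integrals above
  \<open>e\<close> in absolute value. Removing from each the union of the later ones leaves disjoint
  sets \<open>C n\<close> with integrals above \<open>e / 2\<close>, realised by points
  \<open>w n\<close> of the Pettis integrals over \<open>C n\<close>. Every subseries of
  \<open>w\<close> has a weak sum in the space, because it is dominated by the support function of
  the integral over a union of sets \<open>C n\<close>; so \<open>w\<close> tends to 0 by
  \<open>orlicz_pettis\<close>, a contradiction.\<close>

lemma mf_pettis_imp_absolutely_continuous:
  fixes \<Gamma> :: "real \<Rightarrow> 'a::banach set"
  assumes P: "mf_pettis_integrable \<Gamma>"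
  shows "equi_absolutely_continuous (\<lambda>f t. support_fun f (\<Gamma> t)) dual_ball"
proof (rule ccontr)
  let ?h = "\<lambda>(f :: 'a \<Rightarrow>\<^sub>L real) t. support_fun f (\<Gamma> t)"
  assume "\<not> equi_absolutely_continuous ?h dual_ball"
  then obtain e where e: "0 < e" and bad: "\<And>\<eta>. 0 < \<eta> \<Longrightarrow> \<exists>\<D>. \<D> division_of \<Union>\<D> \<and> \<Union>\<D> \<subseteq> {0..1} \<and> sum len \<D> < \<eta> \<and>
      (\<exists>f\<in>dual_ball. \<not> \<bar>\<Sum>K\<in>\<D>. integral K (?h f)\<bar> \<le> e)"
    unfolding equi_absolutely_continuous_def by (auto simp: not_le)
  have h: "?h f absolutely_integrable_on {0..1}" for f using P unfolding mf_pettis_integrable_def by blast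
  have "\<forall>A. \<exists>W. A \<in> sets lebesgue \<longrightarrow> A \<subseteq> {0..1} \<longrightarrow> W \<in> cwk \<and> (\<forall>f. support_fun f W = LI A (?h f))"
    using P unfolding mf_pettis_integrable_def by blast
  then obtain W where W: "\<And>A. A \<in> sets lebesgue \<Longrightarrow> A \<subseteq> {0..1} \<Longrightarrow> W A \<in> cwk"
    "\<And>A f. A \<in> sets lebesgue \<Longrightarrow> A \<subseteq> {0..1} \<Longrightarrow> support_fun f (W A) = LI A (?h f)"
    by metis
  define Inv where "Inv = (\<lambda>(\<eta> :: real, f :: 'a \<Rightarrow>\<^sub>L real, E :: real set). 0 < \<eta> \<and> f \<in> dual_ball \<and>
      E \<in> sets lebesgue \<and> E \<subseteq> {0..1} \<and> measure lebesgue E < \<eta> \<and> e < \<bar>LI E (?h f)\<bar>)"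
  \<comment> \<open>\<open>\<eta>'\<close> is chosen after \<open>f\<close>: halving bounds the
    total measure of all later sets by \<open>2 * \<eta>'\<close>, and on sets of that size the
    integral of the absolute value of \<open>?h f\<close> is at most \<open>e / 2\<close>.\<close>
  define Step where "Step = (\<lambda>(\<eta> :: real, f :: 'a \<Rightarrow>\<^sub>L real, E :: real set) (\<eta>' :: real, f' :: 'a \<Rightarrow>\<^sub>L real, E' :: real set).
      \<eta>' \<le> \<eta> / 2 \<and> (\<forall>B\<in>sets lebesgue. B \<subseteq> {0..1} \<and> measure lebesgue B \<le> 2 * \<eta>' \<longrightarrow> LI B (\<lambda>x. \<bar>?h f x\<bar>) \<le> e / 2))"
  have start: "\<exists>f E. Inv (\<eta>, f, E)" if \<eta>: "0 < \<eta>" for \<eta>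
  proof -
    from bad[OF \<eta>] obtain \<D> f where D: "\<D> division_of \<Union>\<D>" "\<Union>\<D> \<subseteq> {0..1}" "sum len \<D> < \<eta>"
      and f: "f \<in> dual_ball" "\<not> \<bar>\<Sum>K\<in>\<D>. integral K (?h f)\<bar> \<le> e" by blast
    have "Inv (\<eta>, f, \<Union>\<D>)"
      using \<eta> f D lmeasurable_division[OF D(1)]
      by (simp add: Inv_def LI_division[OF h D(1,2)] sum_len_division[OF D(1)] fmeasurable_def)
    then show ?thesis by blast
  qed
  have "\<exists>s. \<forall>n. Inv (s n) \<and> Step (s n) (s (Suc n))"
  proof (rule dependent_nat_choice[where P = "\<lambda>_. Inv" and Q = "\<lambda>_. Step"])
    obtain f E where "Inv (1, f, E)" using start[of 1] by auto
    then show "\<exists>s. Inv s" by blast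
    fix s :: "real \<times> ('a \<Rightarrow>\<^sub>L real) \<times> real set" and n :: nat assume s: "Inv s"
    obtain \<eta> f E where sE: "s = (\<eta>, f, E)" by (cases s) auto
    have \<eta>: "0 < \<eta>" using s by (simp add: sE Inv_def)
    have "0 < e / 2" using e by simp
    then obtain \<rho> where \<rho>: "0 < \<rho>" "\<And>B. B \<in> sets lebesgue \<Longrightarrow> B \<subseteq> {0..1} \<Longrightarrow> measure lebesgue B < \<rho> \<Longrightarrow>
        LI B (\<lambda>x. \<bar>?h f x\<bar>) \<le> e / 2"
      using LI_abs_continuous[OF h[of f]] by metis
    define \<eta>' where "\<eta>' = min (\<eta> / 2) (\<rho> / 4)"
    have \<eta>': "0 < \<eta>'" "\<eta>' \<le> \<eta> / 2" "2 * \<eta>' < \<rho>" using \<eta> \<rho>(1) by (auto simp: \<eta>'_def)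
    obtain f' E' where "Inv (\<eta>', f', E')" using start[OF \<eta>'(1)] by blast
    moreover have "Step s (\<eta>', f', E')"
      using \<eta>' \<rho>(2) by (auto simp: Step_def sE)
    ultimately show "\<exists>s'. Inv s' \<and> Step s s'" by blast
  qed
  then obtain s where s: "\<And>n. Inv (s n)" "\<And>n. Step (s n) (s (Suc n))" by blast
  define \<eta> where "\<eta> n = fst (s n)" for n
  define z where "z n = fst (snd (s n))" for n
  define E where "E n = snd (snd (s n))" for n
  have sn: "s n = (\<eta> n, z n, E n)" for n by (simp add: \<eta>_def z_def E_def)
  have I: "0 < \<eta> n" "z n \<in> dual_ball" "E n \<in> sets lebesgue" "E n \<subseteq> {0..1}" "measure lebesgue (E n) < \<eta> n"
    "e < \<bar>LI (E n) (?h (z n))\<bar>" for n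
    using s(1)[of n] unfolding sn Inv_def by auto
  have half: "\<eta> (Suc n) \<le> \<eta> n / 2" and
    tailh: "\<And>B. B \<in> sets lebesgue \<Longrightarrow> B \<subseteq> {0..1} \<Longrightarrow> measure lebesgue B \<le> 2 * \<eta> (Suc n) \<Longrightarrow> LI B (\<lambda>x. \<bar>?h (z n) x\<bar>) \<le> e / 2" for n
    using s(2)[of n] unfolding sn Step_def by auto
  define U where "U n = (\<Union>k. E (Suc n + k))" for n
  have U: "U n \<in> sets lebesgue" "U n \<subseteq> {0..1}" for n using I(3,4) by (auto simp: U_def)
  have mU: "measure lebesgue (U n) \<le> 2 * \<eta> (Suc n)" for n
    unfolding U_def
  proof (rule measure_countable_Union_le)
    show "E (Suc n + k) \<in> lmeasurable" for k by (rule lmeasurable01[OF I(3,4)])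
    fix m
    \<comment> \<open>The subtracted last term carries the induction for this geometric
      bound.\<close>
    have geo: "(\<Sum>k\<le>m. \<eta> (Suc n + k)) \<le> 2 * \<eta> (Suc n) - \<eta> (Suc n + m)"
    proof (induction m)
      case 0
      show ?case by simp
    next
      case (Suc m)
      then show ?case using half[of "Suc n + m"] by simp
    qed
    have "measure lebesgue (\<Union>k\<le>m. E (Suc n + k)) \<le> (\<Sum>k\<le>m. measure lebesgue (E (Suc n + k)))"
      using I(3) by (intro measure_UNION_le) auto
    also have "\<dots> \<le> (\<Sum>k\<le>m. \<eta> (Suc n + k))" using I(5) by (intro sum_mono less_imp_le)
    finally show "measure lebesgue (\<Union>k\<le>m. E (Suc n + k)) \<le> 2 * \<eta> (Suc n)"
      using geo I(1)[of "Suc n + m"] by linarith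
  qed
  define C where "C n = E n - U n" for n
  have C: "C n \<in> sets lebesgue" "C n \<subseteq> {0..1}" for n using I(3,4) U by (auto simp: C_def)
  have disj: "C m \<inter> C n = {}" if "m \<noteq> n" for m n
  proof -
    have less: "C i \<inter> C j = {}" if ij: "i < j" for i j
    proof -
      obtain k where "j = Suc i + k" using ij by (auto simp: less_iff_Suc_add)
      then have "E j \<subseteq> U i" by (auto simp: U_def)
      then show ?thesis by (auto simp: C_def)
    qed
    show ?thesis
    proof (cases "m < n")
      case True
      then show ?thesis by (rule less)
    next
      case False
      then have "n < m" using that by simp
      then show ?thesis using less[of n m] by (simp add: Int_commute)
    qed
  qed
  have big: "e / 2 < \<bar>LI (C n) (?h (z n))\<bar>" for n
  proof -
    let ?S = "(E n - C n) \<union> (C n - E n)"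
    have S: "?S \<in> sets lebesgue" "?S \<subseteq> {0..1}" using C[of n] I(3,4)[of n] by blast+
    have SU: "?S \<subseteq> U n" by (auto simp: C_def)
    have "measure lebesgue ?S \<le> measure lebesgue (U n)"
      by (rule measure_mono_fmeasurable[OF SU S(1) lmeasurable01[OF U]])
    then have "LI ?S (\<lambda>x. \<bar>?h (z n) x\<bar>) \<le> e / 2" using mU[of n] by (intro tailh[OF S(1,2)]) linarith
    then have "\<bar>LI (E n) (?h (z n)) - LI (C n) (?h (z n))\<bar> \<le> e / 2"
      by (rule order_trans[OF LI_diff_le[OF h I(3,4) C]])
    then show ?thesis using I(6)[of n] by linarith
  qed
  have "\<exists>w. w \<in> W (C n) \<and> blinfun_apply (z n) w = LI (C n) (?h (z n))" for n
  proof -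
    obtain c where "c \<in> W (C n)" "blinfun_apply (z n) c = support_fun (z n) (W (C n))"
      by (rule support_fun_attained[OF W(1)[OF C]])
    then show ?thesis unfolding W(2)[OF C] by blast
  qed
  then have "\<forall>n. \<exists>w. w \<in> W (C n) \<and> blinfun_apply (z n) w = LI (C n) (?h (z n))" by blast
  from choice[OF this] obtain w where w: "\<And>n. w n \<in> W (C n)" "\<And>n. blinfun_apply (z n) (w n) = LI (C n) (?h (z n))"
    by blast
  \<comment> \<open>The support functions at \<open>f\<close> and \<open>- f\<close> bound the value
    from both sides; summability then follows from the disjointness of the sets
    \<open>C n\<close>.\<close>
  have wbound: "\<bar>blinfun_apply f (w n)\<bar> \<le> LI (C n) (\<lambda>x. \<bar>?h f x\<bar>) + LI (C n) (\<lambda>x. \<bar>?h (- f) x\<bar>)" for f n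
    using support_fun_upper[OF W(1)[OF C] w(1), of f n] support_fun_upper[OF W(1)[OF C] w(1), of "- f" n]
      abs_LI_le[of "C n" "?h f"] abs_LI_le[of "C n" "?h (- f)"]
    unfolding W(2)[OF C] blinfun.minus_left by linarith
  have summ: "summable (\<lambda>n. \<bar>blinfun_apply f (w n)\<bar>)" for f :: "'a \<Rightarrow>\<^sub>L real"
  proof (rule summable_rabs_comparison_test, intro exI allI impI)
    show "summable (\<lambda>n. LI (C n) (\<lambda>x. \<bar>?h f x\<bar>) + LI (C n) (\<lambda>x. \<bar>?h (- f) x\<bar>))"
      by (intro summable_add LI_family_summable[OF h C disj])
    show "\<bar>blinfun_apply f (w n)\<bar> \<le> LI (C n) (\<lambda>x. \<bar>?h f x\<bar>) + LI (C n) (\<lambda>x. \<bar>?h (- f) x\<bar>)" for n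
      by (rule wbound)
  qed
  have "w \<longlonglongrightarrow> 0"
  proof (rule orlicz_pettis)
    fix S :: "nat set"
    define A where "A n = (if n \<in> S then C n else {})" for n
    have A: "A n \<in> sets lebesgue" "A n \<subseteq> {0..1}" for n using C by (auto simp: A_def)
    have Ad: "A m \<inter> A n = {}" if "m \<noteq> n" for m n using disj[OF that] by (auto simp: A_def)
    have UA: "(\<Union>n. A n) \<in> sets lebesgue" "(\<Union>n. A n) \<subseteq> {0..1}" using A by auto
    \<comment> \<open>The candidate for the weak sum over \<open>S\<close>: linear in
      \<open>f\<close> and below the support function of the integral over the union, hence
      evaluation at a point.\<close>
    define \<phi> where "\<phi> = (\<lambda>f :: 'a \<Rightarrow>\<^sub>L real. (\<Sum>n. if n \<in> S then blinfun_apply f (w n) else 0))"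
    have s1: "summable (\<lambda>n. if n \<in> S then blinfun_apply f (w n) else 0)" for f :: "'a \<Rightarrow>\<^sub>L real"
      by (rule summable_comparison_test'[OF summ[of f]]) simp
    have lin: "linear \<phi>"
    proof (rule linearI)
      fix f g :: "'a \<Rightarrow>\<^sub>L real"
      have "(\<lambda>n. if n \<in> S then blinfun_apply (f + g) (w n) else 0) =
          (\<lambda>n. (if n \<in> S then blinfun_apply f (w n) else 0) + (if n \<in> S then blinfun_apply g (w n) else 0))"
        by (rule ext) (simp add: blinfun.add_left)
      then show "\<phi> (f + g) = \<phi> f + \<phi> g" unfolding \<phi>_def by (simp only: suminf_add[OF s1 s1])
    next
      fix c :: real and f :: "'a \<Rightarrow>\<^sub>L real"
      have "(\<lambda>n. if n \<in> S then blinfun_apply (c *\<^sub>R f) (w n) else 0) =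
          (\<lambda>n. c * (if n \<in> S then blinfun_apply f (w n) else 0))"
        by (rule ext) (simp add: blinfun.scaleR_left)
      then show "\<phi> (c *\<^sub>R f) = c *\<^sub>R \<phi> f" unfolding \<phi>_def by (simp only: suminf_mult[OF s1] real_scaleR_def)
    qed
    have "\<phi> f \<le> support_fun f (W (\<Union>n. A n))" for f
    proof -
      have sA: "summable (\<lambda>n. LI (A n) (?h f))"
      proof (rule summable_comparison_test')
        show "summable (\<lambda>n. LI (A n) (\<lambda>x. \<bar>?h f x\<bar>))" by (rule LI_family_summable[OF h A Ad])
        show "norm (LI (A n) (?h f)) \<le> LI (A n) (\<lambda>x. \<bar>?h f x\<bar>)" for n
          unfolding real_norm_def by (rule abs_LI_le)
      qed
      have "\<phi> f \<le> (\<Sum>n. LI (A n) (?h f))"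
        unfolding \<phi>_def
      proof (rule suminf_le[OF _ s1 sA])
        fix n
        have "blinfun_apply f (w n) \<le> LI (C n) (?h f)"
          using support_fun_upper[OF W(1)[OF C] w(1), of f n] unfolding W(2)[OF C] .
        then show "(if n \<in> S then blinfun_apply f (w n) else 0) \<le> LI (A n) (?h f)"
          by (simp add: A_def set_lebesgue_integral_def)
      qed
      also have "\<dots> = LI (\<Union>n. A n) (?h f)"
        by (rule lebesgue_integral_countable_add[OF A(1) Ad absolutely_integrable_subset01[OF h UA], symmetric])
      also have "\<dots> = support_fun f (W (\<Union>n. A n))" by (rule W(2)[OF UA, symmetric])
      finally show ?thesis .
    qed
    then obtain d where "\<And>f. blinfun_apply f d = \<phi> f"
      by (rule linear_dominated_by_support_fun[OF W(1)[OF UA] lin]) blast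
    then show "\<exists>u. \<forall>f :: 'a \<Rightarrow>\<^sub>L real. summable (\<lambda>k. \<bar>blinfun_apply f (w k)\<bar>) \<and>
        blinfun_apply f u = (\<Sum>k. if k \<in> S then blinfun_apply f (w k) else 0)"
      using summ unfolding \<phi>_def by blast
  qed
  then have "\<forall>\<^sub>F n in sequentially. norm (w n) < e / 2"
    using e tendsto_norm[of w 0] by (intro order_tendstoD(2)[where y = "0::real"]) auto
  then obtain n where "norm (w n) < e / 2" by (auto simp: eventually_sequentially)
  moreover have "\<bar>blinfun_apply (z n) (w n)\<bar> \<le> norm (w n)" using I(2)[of n] by (intro blinfun_apply_le_norm) simp
  ultimately show False using big[of n] unfolding w(2)[symmetric] by linarith
qed

lemma mf_mcshane_imp_selection_mcshane:
  fixes \<Gamma> :: "real \<Rightarrow> 'a::banach set"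
  assumes \<Gamma>: "\<forall>t\<in>{0..1}. \<Gamma> t \<in> cwk" and M: "mf_mcshane_integrable \<Gamma>"
    and f: "f \<in> selections \<Gamma>" "henstock_integrable f"
  shows "mcshane_integrable f"
proof -
  have fsel: "f t \<in> \<Gamma> t" if "t \<in> {0..1}" for t using f(1) that by (simp add: selections_def)
  note EM = mf_mcshaneD[OF \<Gamma> M]
  have ACs: "equi_absolutely_continuous (\<lambda>(x :: 'a \<Rightarrow>\<^sub>L real) t. support_fun x (\<Gamma> t)) dual_ball"
    by (rule equi_mcshane_imp_absolutely_continuous[OF EM support_fun_pointwise_bounded[OF \<Gamma>]])
  obtain w where EH: "equi_henstock (\<lambda>x t. blinfun_apply x (f t)) dual_ball"
    and int: "\<And>x :: 'a \<Rightarrow>\<^sub>L real. norm x \<le> 1 \<Longrightarrow> integral {0..1} (\<lambda>t. blinfun_apply x (f t)) = blinfun_apply x w"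
    by (rule henstock_integrableD[OF f(2)]) blast
  have AC: "equi_absolutely_continuous (\<lambda>(x :: 'a \<Rightarrow>\<^sub>L real) t. blinfun_apply x (f t)) dual_ball"
    unfolding equi_absolutely_continuous_def
  proof (intro allI impI)
    fix e :: real assume e: "0 < e"
    obtain \<eta> where \<eta>: "0 < \<eta>" and ac: "\<And>\<D>. \<D> division_of \<Union>\<D> \<and> \<Union>\<D> \<subseteq> {0..1} \<and> sum len \<D> < \<eta> \<Longrightarrow>
        \<forall>x\<in>dual_ball. \<bar>\<Sum>K\<in>\<D>. integral K (\<lambda>t. support_fun (x :: 'a \<Rightarrow>\<^sub>L real) (\<Gamma> t))\<bar> \<le> e"
      using ACs e unfolding equi_absolutely_continuous_def by blast
    show "\<exists>\<eta>>0. \<forall>\<D>. \<D> division_of \<Union>\<D> \<and> \<Union>\<D> \<subseteq> {0..1} \<and> sum len \<D> < \<eta> \<longrightarrow>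
        (\<forall>x\<in>dual_ball. \<bar>\<Sum>K\<in>\<D>. integral K (\<lambda>t. blinfun_apply (x :: 'a \<Rightarrow>\<^sub>L real) (f t))\<bar> \<le> e)"
    proof (intro exI conjI allI impI ballI, rule \<eta>)
      fix \<D> :: "real set set" and x :: "'a \<Rightarrow>\<^sub>L real"
      assume D: "\<D> division_of \<Union>\<D> \<and> \<Union>\<D> \<subseteq> {0..1} \<and> sum len \<D> < \<eta>" and x: "x \<in> dual_ball"
      have le: "(\<Sum>K\<in>\<D>. integral K (\<lambda>t. blinfun_apply y (f t))) \<le> e" if y: "y \<in> dual_ball" for y :: "'a \<Rightarrow>\<^sub>L real"
      proof -
        have "(\<Sum>K\<in>\<D>. integral K (\<lambda>t. blinfun_apply y (f t))) \<le> (\<Sum>K\<in>\<D>. integral K (\<lambda>t. support_fun y (\<Gamma> t)))"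
        proof (rule sum_mono, rule integral_le)
          fix K assume K: "K \<in> \<D>"
          have Dd: "\<D> division_of \<Union>\<D>" using D by blast
          obtain a b where ab: "K = cbox a b" using division_ofD(4)[OF Dd K] by blast
          have K01: "K \<subseteq> {0..1}" using D K by blast
          show "(\<lambda>t. blinfun_apply y (f t)) integrable_on K"
            unfolding ab by (rule integrable_on_subcbox[OF equi_henstock_integrable[OF EH y]]) (use K01 ab in simp)
          show "(\<lambda>t. support_fun y (\<Gamma> t)) integrable_on K"
            unfolding ab by (rule integrable_on_subcbox[OF equi_mcshane_integrable[OF EM y]]) (use K01 ab in simp)
          fix t assume "t \<in> K"
          then have "t \<in> {0..1}" using K01 by blast
          then show "blinfun_apply y (f t) \<le> support_fun y (\<Gamma> t)"
            using \<Gamma> fsel by (intro support_fun_upper) auto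
        qed
        also have "\<dots> \<le> e" using ac[OF D] y by (meson abs_le_D1)
        finally show ?thesis .
      qed
      have "- x \<in> dual_ball" using x by simp
      from le[OF this] have "- (\<Sum>K\<in>\<D>. integral K (\<lambda>t. blinfun_apply x (f t))) \<le> e"
        by (simp add: blinfun.minus_left sum_negf)
      with le[OF x] show "\<bar>\<Sum>K\<in>\<D>. integral K (\<lambda>t. blinfun_apply x (f t))\<bar> \<le> e" by linarith
    qed
  qed
  have "equi_mcshane (\<lambda>(x :: 'a \<Rightarrow>\<^sub>L real) t. blinfun_apply x (f t)) dual_ball"
    by (rule equi_henstock_imp_mcshane[OF EH AC blinfun_pointwise_bounded[of f]])
  then show ?thesis using int by (rule mcshane_integrableI)
qed

lemma mf_henstock_pettis_selection_imp_pettis: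
  fixes \<Gamma> :: "real \<Rightarrow> 'a::banach set"
  assumes \<Gamma>: "\<forall>t\<in>{0..1}. \<Gamma> t \<in> cwk" and H: "mf_henstock_integrable \<Gamma>"
    and f: "f \<in> pettis_selections \<Gamma>"
  shows "mf_pettis_integrable \<Gamma>"
proof -
  have fle: "blinfun_apply x (f t) \<le> support_fun x (\<Gamma> t)" if "t \<in> {0..1}" for x t
    using f \<Gamma> that by (intro support_fun_upper) (auto simp: pettis_selections_def selections_def)
  have P: "pettis_integrable f" using f by (simp add: pettis_selections_def)
  then have fi: "(\<lambda>t. blinfun_apply x (f t)) absolutely_integrable_on {0..1}" for x :: "'a \<Rightarrow>\<^sub>L real"
    unfolding pettis_integrable_def by blast
  have fw: "\<exists>w. \<forall>x :: 'a \<Rightarrow>\<^sub>L real. blinfun_apply x w = LI A (\<lambda>t. blinfun_apply x (f t))"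
    if "A \<in> sets lebesgue" "A \<subseteq> {0..1}" for A
    using P that unfolding pettis_integrable_def by blast
  obtain \<Phi> where \<Phi>: "\<Phi> \<in> cwk" and EH: "equi_henstock (\<lambda>f t. support_fun f (\<Gamma> t)) dual_ball"
    and int: "\<And>f. norm f \<le> 1 \<Longrightarrow> integral {0..1} (\<lambda>t. support_fun f (\<Gamma> t)) = support_fun f \<Phi>"
    by (rule mf_henstockD[OF \<Gamma> H]) blast
  have s: "(\<lambda>t. support_fun x (\<Gamma> t)) absolutely_integrable_on {0..1} \<and>
      LI {0..1} (\<lambda>t. support_fun x (\<Gamma> t)) = support_fun x \<Phi>" for x :: "'a \<Rightarrow>\<^sub>L real"
  proof -
    obtain c u where c: "0 \<le> c" and u: "norm u \<le> 1" and x: "x = c *\<^sub>R u" by (rule scale_to_dual_ball[of x])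
    have ub: "u \<in> dual_ball" using u by simp
    \<comment> \<open>A gauge integrable function with an absolutely integrable lower bound is
      absolutely integrable; the Pettis selection provides that bound.\<close>
    have ui: "(\<lambda>t. support_fun u (\<Gamma> t)) absolutely_integrable_on {0..1}"
      by (rule absolutely_integrable_absolutely_integrable_lbound[OF equi_henstock_integrable[OF EH ub] fi fle])
    have eq: "support_fun x (\<Gamma> t) = c * support_fun u (\<Gamma> t)" if "t \<in> {0..1}" for t
      unfolding x by (rule support_fun_scaleR_left) (use \<Gamma> that c in auto)
    have "(\<lambda>t. c * support_fun u (\<Gamma> t)) absolutely_integrable_on {0..1}"
      using ui by (rule set_integrable_mult_right)
    then have "(\<lambda>t. support_fun x (\<Gamma> t)) absolutely_integrable_on {0..1}"
      using eq by (subst set_integrable_cong[OF refl refl]) auto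
    moreover have "LI {0..1} (\<lambda>t. support_fun x (\<Gamma> t)) = LI {0..1} (\<lambda>t. c * support_fun u (\<Gamma> t))"
      by (rule set_lebesgue_integral_cong) (use eq in auto)
    moreover have "\<dots> = c * support_fun u \<Phi>"
      by (simp add: set_lebesgue_integral_eq_integral(2)[OF ui] int[OF u])
    moreover have "\<dots> = support_fun x \<Phi>" unfolding x by (rule support_fun_scaleR_left[OF \<Phi> c, symmetric])
    ultimately show ?thesis by simp
  qed
  note si = s[THEN conjunct1]
  have "\<exists>W\<in>cwk. \<forall>x. support_fun x W = LI A (\<lambda>t. support_fun x (\<Gamma> t))"
    if A: "A \<in> sets lebesgue" "A \<subseteq> {0..1}" for A
  proof -
    obtain a where a: "\<And>x :: 'a \<Rightarrow>\<^sub>L real. blinfun_apply x a = LI A (\<lambda>t. blinfun_apply x (f t))" using fw[OF A] by blast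
    obtain z where z: "\<And>x :: 'a \<Rightarrow>\<^sub>L real. blinfun_apply x z = LI {0..1} (\<lambda>t. blinfun_apply x (f t))" using fw[of "{0..1}"] by auto
    define p where "p x = LI A (\<lambda>t. support_fun x (\<Gamma> t))" for x
    note siA = absolutely_integrable_subset01[OF si A] and fiA = absolutely_integrable_subset01[OF fi A]
    have sub: "sublinear (\<lambda>x. support_fun x (\<Gamma> t))" if "t \<in> A" for t
      using A(2) \<Gamma> that by (intro sublinear_support_fun) auto
    have "sublinear p"
    proof (rule sublinearI)
      fix x y :: "'a \<Rightarrow>\<^sub>L real"
      have "p (x + y) \<le> LI A (\<lambda>t. support_fun x (\<Gamma> t) + support_fun y (\<Gamma> t))"
        unfolding p_def by (rule set_integral_mono[OF siA set_integral_add(1)[OF siA siA]]) (rule sublinear_add[OF sub])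
      also have "\<dots> = p x + p y" unfolding p_def by (rule set_integral_add(2)[OF siA siA])
      finally show "p (x + y) \<le> p x + p y" .
    next
      fix c :: real and x :: "'a \<Rightarrow>\<^sub>L real" assume "0 < c"
      then have c: "0 \<le> c" by simp
      have "p (c *\<^sub>R x) = LI A (\<lambda>t. c * support_fun x (\<Gamma> t))"
        unfolding p_def by (rule set_lebesgue_integral_cong[OF A(1)]) (use sublinear_scale[OF sub c] in auto)
      then show "p (c *\<^sub>R x) \<le> c * p x" by (simp add: p_def)
    qed
    \<comment> \<open>\<open>a\<close> and \<open>z\<close> represent the integrals of
      \<open>f\<close> over \<open>A\<close> and over the whole interval. Subtracting the selection
      leaves a nonnegative integrand, whose integral only grows when \<open>A\<close> is enlarged to
      the whole interval; adding the selection back produces the translation by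
      \<open>a - z\<close>.\<close>
    moreover have "p x \<le> support_fun x ((+) (a - z) ` \<Phi>)" for x
    proof -
      have "p x - blinfun_apply x a = LI A (\<lambda>t. support_fun x (\<Gamma> t) - blinfun_apply x (f t))"
        unfolding p_def a by (rule set_integral_diff(2)[OF siA fiA, symmetric])
      also have "\<dots> \<le> LI {0..1} (\<lambda>t. support_fun x (\<Gamma> t) - blinfun_apply x (f t))"
        unfolding set_lebesgue_integral_def
      proof (rule integral_mono)
        note d = set_integral_diff(1)[OF si fi, of x x]
        show "integrable lebesgue (\<lambda>t. indicat_real {0..1} t *\<^sub>R (support_fun x (\<Gamma> t) - blinfun_apply x (f t)))"
          using d unfolding set_integrable_def .
        show "integrable lebesgue (\<lambda>t. indicat_real A t *\<^sub>R (support_fun x (\<Gamma> t) - blinfun_apply x (f t)))"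
          using absolutely_integrable_subset01[OF d A] unfolding set_integrable_def .
        show "indicat_real A t *\<^sub>R (support_fun x (\<Gamma> t) - blinfun_apply x (f t))
            \<le> indicat_real {0..1} t *\<^sub>R (support_fun x (\<Gamma> t) - blinfun_apply x (f t))" for t
          using A(2) fle[of t x] by (auto simp: indicator_def)
      qed
      also have "\<dots> = support_fun x \<Phi> - blinfun_apply x z"
        unfolding z s[THEN conjunct2, symmetric] by (rule set_integral_diff(2)[OF si fi])
      finally show ?thesis unfolding support_fun_translation[OF \<Phi>] blinfun.diff_right by linarith
    qed
    ultimately obtain W where "W \<in> cwk" "\<And>x. support_fun x W = p x"
      by (rule sublinear_dominated_by_support_fun[OF cwk_translation[OF \<Phi>]]) blast
    then show ?thesis unfolding p_def by blast
  qed
  then show ?thesis using si unfolding mf_pettis_integrable_def by blast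
qed

lemma mf_henstock_pettis_imp_mcshane:
  fixes \<Gamma> :: "real \<Rightarrow> 'a::banach set"
  assumes \<Gamma>: "\<forall>t\<in>{0..1}. \<Gamma> t \<in> cwk" and H: "mf_henstock_integrable \<Gamma>" and P: "mf_pettis_integrable \<Gamma>"
  shows "mf_mcshane_integrable \<Gamma>"
proof -
  obtain \<Phi> where \<Phi>: "\<Phi> \<in> cwk" and EH: "equi_henstock (\<lambda>f t. support_fun f (\<Gamma> t)) dual_ball"
    and int: "\<And>f. norm f \<le> 1 \<Longrightarrow> integral {0..1} (\<lambda>t. support_fun f (\<Gamma> t)) = support_fun f \<Phi>"
    by (rule mf_henstockD[OF \<Gamma> H]) blast
  show ?thesis
    by (rule mf_mcshaneI[OF \<Gamma> \<Phi> equi_henstock_imp_mcshane[OF EH mf_pettis_imp_absolutely_continuous[OF P]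
          support_fun_pointwise_bounded[OF \<Gamma>]] int])
qed

theorem theorem3p3:
  fixes \<Gamma> :: "real \<Rightarrow> 'a::banach set"
  assumes "\<forall>t\<in>{0..1}. \<Gamma> t \<in> cwk"
  shows
    "(mf_mcshane_integrable \<Gamma> \<longleftrightarrow>
        mf_henstock_integrable \<Gamma> \<and> henstock_selections \<Gamma> \<subseteq> mcshane_selections \<Gamma>) \<and>
     (mf_mcshane_integrable \<Gamma> \<longleftrightarrow>
        mf_henstock_integrable \<Gamma> \<and> henstock_selections \<Gamma> \<subseteq> pettis_selections \<Gamma>) \<and>
     (mf_mcshane_integrable \<Gamma> \<longleftrightarrow>
        mf_henstock_integrable \<Gamma> \<and> pettis_selections \<Gamma> \<noteq> {}) \<and>
     (mf_mcshane_integrable \<Gamma> \<longleftrightarrow>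
        mf_henstock_integrable \<Gamma> \<and> mf_pettis_integrable \<Gamma>)"
proof -
  let ?i = "mf_mcshane_integrable \<Gamma>"
  let ?ii = "mf_henstock_integrable \<Gamma> \<and> henstock_selections \<Gamma> \<subseteq> mcshane_selections \<Gamma>"
  let ?iii = "mf_henstock_integrable \<Gamma> \<and> henstock_selections \<Gamma> \<subseteq> pettis_selections \<Gamma>"
  let ?iv = "mf_henstock_integrable \<Gamma> \<and> pettis_selections \<Gamma> \<noteq> {}"
  let ?v = "mf_henstock_integrable \<Gamma> \<and> mf_pettis_integrable \<Gamma>"
  have 1: "?i \<Longrightarrow> ?ii"
    using mf_mcshane_imp_henstock[OF assms] mf_mcshane_imp_selection_mcshane[OF assms]
    by (auto simp: henstock_selections_def mcshane_selections_def)
  have 2: "?ii \<Longrightarrow> ?iii"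
    using mcshane_imp_pettis by (auto simp: mcshane_selections_def pettis_selections_def)
  have 3: "?iii \<Longrightarrow> ?iv" using henstock_selection_exists[OF assms] by blast
  have 4: "?iv \<Longrightarrow> ?v" using mf_henstock_pettis_selection_imp_pettis[OF assms] by blast
  have 5: "?v \<Longrightarrow> ?i" using mf_henstock_pettis_imp_mcshane[OF assms] by blast
  show ?thesis using 1 2 3 4 5 by argo
qed

end
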